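(* Assume $G$ is non-unimodular and that for $\lambda$-almost every $z\in Z$ the stabilizer $H_z=\{h\in H:h[o(z)]=o(z)\}$ is compact. Then $U$ is reproducing, i.e. there exists $\eta\in L^2(\mathbb R^d)$ with $\|f\|^2=\int_G|\langle f,U_g\eta\rangle|^2dg$ for all $f\in L^2(\mathbb R^d)$.
   Context: $H$: lcsc group with Haar measure $dh$, modular function $\Delta_H$; continuous linear representation $h[\cdot]$ of $H$ on $\mathbb R^n$; $\langle h^\dagger[a],y\rangle=\langle a,h^{-1}[y]\rangle$; $G=\mathbb R^n\rtimes H$ with $(a_1,h_1)(a_2,h_2)=(a_1+h_1^\dagger[a_2],h_1h_2)$, left Haar measure $dg=\alpha(h)^{-1}da\,dh$, $\alpha(h)=|\det(y\mapsto h^{-1}[y])|$, $\Delta_G(a,h)=\Delta_H(h)/\alpha(h)$. (H1): continuous action $x\mapsto h.x$ on $\mathbb R^d$ by smooth maps with $|h.E|=\beta(h)|E|$ for Borel $E$. (H2): $\Phi:\mathbb R^d\to\mathbb R^n$ $C^1$ with $\Phi(h.x)=h[\Phi(x)]$. $U_{(a,h)}f(x)=\beta(h)^{-1/2}e^{-2\pi i\langle\Phi(x),a\rangle}f(h^{-1}.x)$. Assumption 1: the set of critical points of $\Phi$ (rank $d\Phi_x<n$) is Lebesgue-null; $X$ an open $H$-invariant subset of the regular points with null complement; $Y=\Phi(X)$. Assumption 2: every $H$-orbit in $Y$ is locally closed in $Y$. $Z$ lcsc space, $\pi:Y\to Z$ Borel with $\pi(y)=\pi(y')$ iff same orbit,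 $o:Z\to Y$ Borel section, $\lambda$ a measure on $Z$ with null sets exactly those $E$ with $\pi^{-1}(E)$ Lebesgue-null. *)

theory Defs
  imports "HOL-Analysis.Analysis"
begin

text \<open>An abstract topological group structure on the whole type 'h, given by
  multiplication, unit and inverse. Hausdorffness and second countability are
  imposed by the type classes in the theorem statement.\<close>

definition lcsc_group :: "('h::topological_space \<Rightarrow> 'h \<Rightarrow> 'h) \<Rightarrow> 'h \<Rightarrow> ('h \<Rightarrow> 'h) \<Rightarrow> bool" where
  "lcsc_group mul e hinv \<longleftrightarrow>
     (\<forall>x y z. mul (mul x y) z = mul x (mul y z)) \<and>
     (\<forall>x. mul e x = x \<and> mul x e = x) \<and>
     (\<forall>x. mul (hinv x) x = e \<and> mul x (hinv x) = e) \<and>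
     continuous_on UNIV (\<lambda>p. mul (fst p) (snd p)) \<and>
     continuous_on UNIV hinv \<and>
     locally_compact_space (euclidean :: 'h topology)"

definition left_haar_measure :: "('h::topological_space \<Rightarrow> 'h \<Rightarrow> 'h) \<Rightarrow> 'h measure \<Rightarrow> bool" where
  "left_haar_measure mul dh \<longleftrightarrow>
     sets dh = sets borel \<and>
     (\<forall>h E. E \<in> sets borel \<longrightarrow> emeasure dh ((mul h) ` E) = emeasure dh E) \<and>
     (\<forall>K. compact K \<longrightarrow> emeasure dh K < \<infinity>) \<and>
     (\<forall>U. open U \<longrightarrow> U \<noteq> {} \<longrightarrow> emeasure dh U > 0)"

definition dagger :: "('h \<Rightarrow> 'h) \<Rightarrow> ('h \<Rightarrow> real^'n \<Rightarrow> real^'n) \<Rightarrow> 'h \<Rightarrow> real^'n \<Rightarrow> real^'n" where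
  "dagger hinv rep h = adjoint (rep (hinv h))"

definition Gmul :: "('h \<Rightarrow> 'h \<Rightarrow> 'h) \<Rightarrow> ('h \<Rightarrow> 'h) \<Rightarrow> ('h \<Rightarrow> real^'n \<Rightarrow> real^'n)
    \<Rightarrow> ((real^'n) \<times> 'h) \<Rightarrow> ((real^'n) \<times> 'h) \<Rightarrow> ((real^'n) \<times> 'h)" where
  "Gmul mul hinv rep g1 g2 = (fst g1 + dagger hinv rep (snd g1) (fst g2), mul (snd g1) (snd g2))"

definition alpha :: "('h \<Rightarrow> 'h) \<Rightarrow> ('h \<Rightarrow> real^'n \<Rightarrow> real^'n) \<Rightarrow> 'h \<Rightarrow> real" where
  "alpha hinv rep h = \<bar>det (matrix (rep (hinv h)))\<bar>"

definition haar_G :: "('h \<Rightarrow> 'h) \<Rightarrow> ('h \<Rightarrow> real^'n \<Rightarrow> real^'n) \<Rightarrow> 'h measure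
    \<Rightarrow> ((real^'n) \<times> 'h) measure" where
  "haar_G hinv rep dh = density (lborel \<Otimes>\<^sub>M dh) (\<lambda>g. ennreal (1 / alpha hinv rep (snd g)))"

definition unimodular_G :: "('h \<Rightarrow> 'h \<Rightarrow> 'h) \<Rightarrow> ('h \<Rightarrow> 'h) \<Rightarrow> ('h \<Rightarrow> real^'n \<Rightarrow> real^'n)
    \<Rightarrow> 'h measure \<Rightarrow> bool" where
  "unimodular_G mul hinv rep dh \<longleftrightarrow>
     (\<forall>g0 E. E \<in> sets (haar_G hinv rep dh) \<longrightarrow>
        emeasure (haar_G hinv rep dh) ((\<lambda>g. Gmul mul hinv rep g g0) ` E)
          = emeasure (haar_G hinv rep dh) E)"

text \<open>\<open>C\<^sup>\<infinity>\<close> real functions: continuous, and all partial derivatives exist and are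
  again \<open>C\<^sup>\<infinity>\<close> (coinductively, i.e. partial derivatives of all orders exist and
  are continuous).\<close>

coinductive smooth_fun :: "('a::euclidean_space \<Rightarrow> real) \<Rightarrow> bool" where
  "continuous_on UNIV g \<Longrightarrow>
   (\<forall>i\<in>Basis. \<exists>g'. (\<forall>x. ((\<lambda>t. g (x + t *\<^sub>R i)) has_real_derivative g' x) (at 0)) \<and> smooth_fun g')
   \<Longrightarrow> smooth_fun g"

definition smooth_map :: "('a::euclidean_space \<Rightarrow> 'b::euclidean_space) \<Rightarrow> bool" where
  "smooth_map F \<longleftrightarrow> (\<forall>j\<in>Basis. smooth_fun (\<lambda>x. F x \<bullet> j))"

definition locally_closed_in :: "'a::topological_space set \<Rightarrow> 'a set \<Rightarrow> bool" where
  "locally_closed_in Y S \<longleftrightarrow> (\<exists>U C. open U \<and> closed C \<and> S = Y \<inter> U \<inter> C)"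

definition L2 :: "('a::euclidean_space \<Rightarrow> complex) \<Rightarrow> bool" where
  "L2 f \<longleftrightarrow> f \<in> borel_measurable lebesgue \<and> integrable lebesgue (\<lambda>x. (cmod (f x))\<^sup>2)"

definition L2_norm_sq :: "('a::euclidean_space \<Rightarrow> complex) \<Rightarrow> real" where
  "L2_norm_sq f = (\<integral>x. (cmod (f x))\<^sup>2 \<partial>lebesgue)"

definition L2_inner :: "('a::euclidean_space \<Rightarrow> complex) \<Rightarrow> ('a \<Rightarrow> complex) \<Rightarrow> complex" where
  "L2_inner f g = (\<integral>x. f x * cnj (g x) \<partial>lebesgue)"

definition Urep :: "('h \<Rightarrow> 'h) \<Rightarrow> ('h \<Rightarrow> real^'d \<Rightarrow> real^'d) \<Rightarrow> ('h \<Rightarrow> real)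
    \<Rightarrow> (real^'d \<Rightarrow> real^'n) \<Rightarrow> ((real^'n) \<times> 'h) \<Rightarrow> (real^'d \<Rightarrow> complex) \<Rightarrow> real^'d \<Rightarrow> complex" where
  "Urep hinv act \<beta> \<Phi> g f x =
     complex_of_real (\<beta> (snd g) powr (-1/2))
     * exp (- 2 * of_real pi * \<i> * complex_of_real (\<Phi> x \<bullet> fst g))
     * f (act (hinv (snd g)) x)"

end

theory Submission
  imports Defs "HOL-Probability.Probability"
begin

text \<open>
  Near a regular point \<open>\<Phi>\<close> is injective on
  the translates of an \<open>n\<close>-dimensional slice, so Plancherel along the slices, combined with an orthonormal
  family, gives countably many bounded functions \<open>e\<^sub>k\<close> with
  \<open>\<Sum>\<^sub>k \<integral> \<bar>\<integral> F e\<^sub>k exp (2\<pi>i \<Phi>\<cdot>a)\<bar>\<^sup>2 da = \<parallel>F\<parallel>\<^sup>2\<close> for all \<open>F\<close>; no disintegration along the fibres of \<open>\<Phi>\<close> is needed.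
  Compactness of the stabilizers yields Borel weights \<open>b\<^sub>i\<close> on \<open>Y\<close> with \<open>\<integral> \<Sum>\<^sub>i b\<^sub>i(h\<inverse>[y])\<^sup>2 dh = 1\<close> for almost every \<open>y\<close>,
  and by equivariance the vectors \<open>(b\<^sub>i \<circ> \<Phi>) e\<^sub>k\<close> together reproduce the norm of every \<open>f\<close>.

  To replace this countable family by a single vector, translate its \<open>m\<close>-th member by some \<open>g\<^sub>m \<in> H\<close> and rescale it
  so that its orbit integral is unchanged. This divides its squared norm by \<open>\<delta> g\<^sub>m\<close>, where
  \<open>\<delta> = \<alpha> \<cdot> (modulus of right translation on H)\<close> is non-trivial because \<open>G\<close> is not unimodular. When \<open>\<delta> g\<^sub>m\<close> grows
  fast enough the sum converges in \<open>L\<^sup>2\<close>, and the translated vectors live over disjoint subsets of \<open>\<real>\<^sup>n\<close>,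
  so that their orbit integrals add up by Plancherel.
\<close>

section \<open>Plancherel identity for integrable functions\<close>

text \<open>For fixed \<open>h\<close> the coefficient of \<open>f\<close> against
  \<open>U_(a,h) \<eta>\<close> is, up to a factor, the Fourier transform in \<open>a\<close> of the
  push-forward of \<open>f(x) cnj (\<eta> (h^-1.x)) dx\<close> under \<open>\<Phi>\<close>. By
  Plancherel its square integral in \<open>a\<close> sees one average of \<open>f\<close> over each
  fibre of \<open>\<Phi>\<close>, so recovering \<open>f\<close> on the fibre takes a whole frame
  read at the same \<open>h\<close>. A single vector must store these infinitely many pieces at
  different places of \<open>\<real>^n\<close>, to be read at different \<open>h\<close>.

  The obstacle is the norm: the squared norms of the pieces need not be summable, and shrinking a
  piece also shrinks its orbit integral. Only the modular function of \<open>G\<close> offers a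
  gain: \<open>\<delta>\<close> is the reciprocal of \<open>\<Delta>_G\<close>, so a unimodular
  \<open>G\<close> would leave the norms as they are.

  Compactness of the stabilizers acts twice. It makes the time that an orbit spends in a piece of
  \<open>Y\<close> finite, which normalises the weights; and it makes the set of group elements that
  return a piece to itself compact. On this set \<open>\<delta>\<close> is bounded, so a translation
  with larger \<open>\<delta>\<close> leaves no overlap.\<close>

lemma bounded_borel_AE_limit_continuous:
  fixes u :: "'a::euclidean_space \<Rightarrow> 'b::euclidean_space"
  assumes [measurable]: "u \<in> borel_measurable borel" and M: "\<And>x. norm (u x) \<le> M"
  obtains g where "\<And>n. continuous_on UNIV (g n)" "\<And>n x. norm (g n x) \<le> M"
    "AE x in lborel. (\<lambda>n. g n x) \<longlonglongrightarrow> u x"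
proof -
  have "u \<in> borel_measurable (lebesgue_on UNIV)"
    unfolding lebesgue_on_UNIV_eq using assms(1) by (intro measurable_completion) simp
  then have "u measurable_on UNIV"
    using measurable_on_iff_borel_measurable[of UNIV u] by simp
  then obtain N g where N: "negligible N" and g: "\<And>n. continuous_on UNIV (g n)"
    and lim: "\<And>x. x \<notin> N \<Longrightarrow> (\<lambda>n::nat. g n x) \<longlonglongrightarrow> u x"
    unfolding measurable_on_def by auto
  have M0: "0 \<le> M" using M[of 0] norm_ge_zero[of "u 0"] by linarith
  let ?C = "cball (0::'b) M"
  have C: "closed ?C" "convex ?C" "?C \<noteq> {}" using M0 by auto
  \<comment> \<open>Clipping by the nearest-point projection onto \<open>cball 0 M\<close> keeps
    continuity and fixes the values of \<open>u\<close>, so the limit survives and the bound becomes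
    uniform.\<close>
  define G where "G n x = closest_point ?C (g n x)" for n x
  have contC: "continuous_on UNIV (closest_point ?C)"
    using C by (intro continuous_on_closest_point)
  have 1: "continuous_on UNIV (G n)" for n
    unfolding G_def using continuous_on_compose2[OF contC g[of n]] by auto
  have 2: "norm (G n x) \<le> M" for n x
    using closest_point_in_set[OF C(1,3), of "g n x"] by (simp add: G_def)
  have 3: "(\<lambda>n. G n x) \<longlonglongrightarrow> u x" if "x \<notin> N" for x
  proof -
    have "isCont (closest_point ?C) (u x)"
      using contC by (simp add: continuous_on_eq_continuous_at)
    from isCont_tendsto_compose[OF this lim[OF that]]
    show ?thesis using M[of x] by (simp add: G_def closest_point_self)
  qed
  have "AE x in lebesgue. x \<notin> N"
    using N by (simp add: negligible_iff_null_sets AE_not_in)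
  then have "AE x in lborel. x \<notin> N" by (simp add: AE_completion_iff)
  then have "AE x in lborel. (\<lambda>n. G n x) \<longlonglongrightarrow> u x" using 3 by (auto elim: eventually_mono)
  with 1 2 show ?thesis using that by blast
qed

lemma power_norm_diff_le:
  fixes a b c :: "'b::real_normed_vector"
  shows "norm (a - c) ^ p \<le> 2 ^ p * (norm (a - b) ^ p + norm (b - c) ^ p)"
proof -
  let ?m = "max (norm (a - b)) (norm (b - c))"
  have "norm (a - c) \<le> 2 * ?m"
    using norm_triangle_ineq[of "a - b" "b - c"] by simp
  then have "norm (a - c) ^ p \<le> (2 * ?m) ^ p" by (intro power_mono) auto
  also have "\<dots> = 2 ^ p * ?m ^ p" by (simp add: power_mult_distrib)
  also have "?m ^ p \<le> norm (a - b) ^ p + norm (b - c) ^ p"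
    by (auto simp: max_def)
  finally show ?thesis by (simp add: mult_left_mono)
qed

text \<open>Truncating \<open>u\<close> both in space and in size leaves a bounded function of
  bounded support, for which the a.e. approximants converge in \<open>p\<close>-mean by dominated
  convergence. Exponent \<open>1\<close> serves the continuity of translations, exponent
  \<open>2\<close> the convergence of Haar means.\<close>

lemma continuous_compact_support_dense:
  fixes u :: "'a::euclidean_space \<Rightarrow> 'b::euclidean_space"
  assumes [measurable]: "u \<in> borel_measurable borel"
    and fin: "(\<integral>\<^sup>+x. ennreal (norm (u x) ^ p) \<partial>lborel) < \<infinity>" and p: "0 < p" and e: "0 < (e::real)"
  obtains g K M where "continuous_on UNIV g" "\<And>x. norm x > K \<Longrightarrow> g x = 0" "\<And>x. norm (g x) \<le> M"
    "(\<integral>\<^sup>+x. ennreal (norm (u x - g x) ^ p) \<partial>lborel) < e"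
proof -
  define T where "T n x = (if norm x \<le> real n \<and> norm (u x) \<le> real n then u x else 0)" for n x
  have [measurable]: "T n \<in> borel_measurable borel" for n unfolding T_def by measurable
  have "(\<lambda>n. \<integral>\<^sup>+x. ennreal (norm (u x - T n x) ^ p) \<partial>lborel) \<longlonglongrightarrow> (\<integral>\<^sup>+_. 0 \<partial>(lborel :: 'a measure))"
  proof (rule nn_integral_dominated_convergence[where w="\<lambda>x. ennreal (norm (u x) ^ p)"])
    show "AE x in lborel. ennreal (norm (u x - T j x) ^ p) \<le> ennreal (norm (u x) ^ p)" for j
      using p by (auto simp: T_def intro!: AE_I2 ennreal_leI)
    have "(\<lambda>i. ennreal (norm (u x - T i x) ^ p)) \<longlonglongrightarrow> 0" for x
    proof (rule tendsto_eventually)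
      obtain N :: nat where N: "max (norm x) (norm (u x)) \<le> real N" using real_arch_simple by blast
      have "\<And>n. n \<ge> N \<Longrightarrow> max (norm x) (norm (u x)) \<le> real n"
        using N by (meson of_nat_mono order_trans)
      then show "\<forall>\<^sub>F i in sequentially. ennreal (norm (u x - T i x) ^ p) = 0"
        unfolding eventually_sequentially using p
        by (intro exI[of _ N]) (auto simp: T_def)
    qed
    then show "AE x in lborel. (\<lambda>i. ennreal (norm (u x - T i x) ^ p)) \<longlonglongrightarrow> 0" by simp
  qed (use fin in \<open>auto\<close>)
  then have limT: "(\<lambda>n. \<integral>\<^sup>+x. ennreal (norm (u x - T n x) ^ p) \<partial>lborel) \<longlonglongrightarrow> 0" by simp
  \<comment> \<open>Two errors below \<open>e'\<close>, each multiplied by the constant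
    \<open>2 ^ p\<close> of \<open>power_norm_diff_le\<close>, add up to \<open>e\<close>.\<close>
  define e' where "e' = e / (2 * 2 ^ p)"
  have e': "0 < e'" using e by (simp add: e'_def)
  have "\<forall>\<^sub>F n in sequentially. (\<integral>\<^sup>+x. ennreal (norm (u x - T n x) ^ p) \<partial>lborel) < e'"
    using limT e' by (intro order_tendstoD(2)) auto
  then obtain n where n: "(\<integral>\<^sup>+x. ennreal (norm (u x - T n x) ^ p) \<partial>lborel) < e'"
    unfolding eventually_sequentially by blast
  have Tb: "norm (T n x) \<le> real n" for x by (auto simp: T_def)
  obtain G where G: "\<And>m. continuous_on UNIV (G m)" "\<And>m x. norm (G m x) \<le> real n"
    "AE x in lborel. (\<lambda>m::nat. G m x) \<longlonglongrightarrow> T n x"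
    using bounded_borel_AE_limit_continuous[of "T n" "real n"] Tb by auto
  \<comment> \<open>A continuous cutoff that is \<open>1\<close> where \<open>T n\<close> lives: it
    does not affect the limit, but gives the approximants bounded support.\<close>
  define c where "c x = max 0 (min 1 (real n + 1 - norm x))" for x :: 'a
  have c01: "0 \<le> c x" "c x \<le> 1" for x by (auto simp: c_def)
  have cT: "c x *\<^sub>R T n x = T n x" for x by (auto simp: c_def T_def)
  have c0: "c x = 0" if "norm x > real n + 1" for x using that by (auto simp: c_def)
  define H where "H m x = c x *\<^sub>R G m x" for m x
  have contc: "continuous_on UNIV c" unfolding c_def by (intro continuous_intros)
  have contH: "continuous_on UNIV (H m)" for m
    unfolding H_def by (intro continuous_intros contc G)
  have [measurable]: "H m \<in> borel_measurable borel" for m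
    using contH by (rule borel_measurable_continuous_onI)
  have Hb: "norm (H m x) \<le> real n" for m x
    using mult_mono[OF c01(2)[of x] G(2)[of m x]] c01[of x] by (simp add: H_def)
  have "(\<lambda>m. \<integral>\<^sup>+x. ennreal (norm (T n x - H m x) ^ p) \<partial>lborel) \<longlonglongrightarrow> (\<integral>\<^sup>+_. 0 \<partial>(lborel :: 'a measure))"
  proof (rule nn_integral_dominated_convergence[where w="\<lambda>x. ennreal ((2 * real n) ^ p) * indicator (cball 0 (real n + 1)) x"])
    show "AE x in lborel. ennreal (norm (T n x - H j x) ^ p) \<le> ennreal ((2 * real n) ^ p) * indicator (cball 0 (real n + 1)) x" for j
    proof (intro AE_I2)
      fix x
      show "ennreal (norm (T n x - H j x) ^ p) \<le> ennreal ((2 * real n) ^ p) * indicator (cball 0 (real n + 1)) x"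
      proof (cases "norm x \<le> real n + 1")
        case True
        have "norm (T n x - H j x) \<le> 2 * real n"
          using Tb[of x] Hb[of j x] norm_triangle_ineq4[of "T n x" "H j x"] by linarith
        then have "norm (T n x - H j x) ^ p \<le> (2 * real n) ^ p" by (intro power_mono) auto
        then show ?thesis using True by (auto simp: ennreal_leI)
      next
        case False
        then show ?thesis using c0[of x] p by (auto simp: H_def T_def)
      qed
    qed
    show "(\<integral>\<^sup>+ x. ennreal ((2 * real n) ^ p) * indicator (cball (0::'a) (real n + 1)) x \<partial>lborel) < \<infinity>"
      by (subst nn_integral_cmult_indicator) (simp_all add: ennreal_mult_less_top emeasure_bounded_finite[OF bounded_cball, simplified])
    show "(\<lambda>x. ennreal ((2 * real n) ^ p) * indicator (cball 0 (real n + 1)) x) \<in> borel_measurable lborel"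
      unfolding measurable_lborel2 by (intro borel_measurable_times_ennreal borel_measurable_const borel_measurable_indicator borel_closed closed_cball)
    show "AE x in lborel. (\<lambda>i. ennreal (norm (T n x - H i x) ^ p)) \<longlonglongrightarrow> 0"
      using G(3)
    proof eventually_elim
      fix x assume "(\<lambda>m. G m x) \<longlonglongrightarrow> T n x"
      then have "(\<lambda>m. H m x) \<longlonglongrightarrow> c x *\<^sub>R T n x" unfolding H_def by (intro tendsto_intros)
      then have "(\<lambda>m. H m x) \<longlonglongrightarrow> T n x" by (simp add: cT)
      then have "(\<lambda>m. norm (T n x - H m x) ^ p) \<longlonglongrightarrow> norm (T n x - T n x) ^ p" by (intro tendsto_intros)
      then show "(\<lambda>i. ennreal (norm (T n x - H i x) ^ p)) \<longlonglongrightarrow> 0"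
        using tendsto_ennrealI[of "\<lambda>m. norm (T n x - H m x) ^ p" "norm (T n x - T n x) ^ p"]
        by (simp only: diff_self norm_zero zero_power[OF p] ennreal_0)
    qed
  qed auto
  then have "\<forall>\<^sub>F m in sequentially. (\<integral>\<^sup>+x. ennreal (norm (T n x - H m x) ^ p) \<partial>lborel) < e'"
    using e' by (intro order_tendstoD(2)) auto
  then obtain m where m: "(\<integral>\<^sup>+x. ennreal (norm (T n x - H m x) ^ p) \<partial>lborel) < e'"
    unfolding eventually_sequentially by blast
  have "(\<integral>\<^sup>+x. ennreal (norm (u x - H m x) ^ p) \<partial>lborel)
      \<le> (\<integral>\<^sup>+x. ennreal (2 ^ p) * (ennreal (norm (u x - T n x) ^ p) + ennreal (norm (T n x - H m x) ^ p)) \<partial>lborel)"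
    using power_norm_diff_le[where b="T n _"]
    by (intro nn_integral_mono) (auto simp flip: ennreal_mult ennreal_plus intro!: ennreal_leI)
  also have "\<dots> = ennreal (2 ^ p) * ((\<integral>\<^sup>+x. ennreal (norm (u x - T n x) ^ p) \<partial>lborel) + (\<integral>\<^sup>+x. ennreal (norm (T n x - H m x) ^ p) \<partial>lborel))"
    by (subst nn_integral_cmult) (auto simp: nn_integral_add)
  also have "\<dots> < ennreal (2 ^ p) * (ennreal e' + ennreal e')"
    using n m by (intro ennreal_mult_strict_left_mono add_strict_mono) (auto simp flip: ennreal_plus)
  also have "\<dots> = ennreal e" using e by (simp add: e'_def field_simps flip: ennreal_plus ennreal_mult)
  finally show ?thesis
    using that[of "H m" "real n + 1" "real n"] contH Hb c0 by (auto simp: H_def)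
qed

lemma lborel_nn_integral_translation:
  fixes f :: "'a::euclidean_space \<Rightarrow> ennreal"
  assumes [measurable]: "f \<in> borel_measurable borel"
  shows "(\<integral>\<^sup>+x. f (x + s) \<partial>lborel) = (\<integral>\<^sup>+x. f x \<partial>lborel)"
proof -
  have "(\<integral>\<^sup>+x. f x \<partial>lborel) = (\<integral>\<^sup>+x. f x \<partial>distr lborel borel ((+) s))"
    by (simp only: lborel_distr_plus)
  also have "\<dots> = (\<integral>\<^sup>+x. f (s + x) \<partial>lborel)" by (subst nn_integral_distr) auto
  finally show ?thesis by (simp add: add.commute)
qed

text \<open>For continuous \<open>g\<close> of bounded support this is dominated convergence. A
  general \<open>u\<close> costs two further errors, one of them translated, and Lebesgue measure
  does not see the translation.\<close>

lemma L1_translation_tendsto: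
  fixes u :: "'a::euclidean_space \<Rightarrow> 'b::euclidean_space"
  assumes u: "integrable lborel u" and s: "s \<longlonglongrightarrow> 0"
  shows "(\<lambda>k. \<integral>\<^sup>+z. ennreal (norm (u (z + s k) - u z)) \<partial>lborel) \<longlonglongrightarrow> 0"
proof (rule order_tendstoI)
  fix a :: ennreal assume "0 < a"
  have [measurable]: "u \<in> borel_measurable borel" using u by auto
  obtain e :: real where e: "0 < e" "ennreal e < a"
  proof -
    obtain b where b: "0 < b" "b < a" using dense[OF \<open>0 < a\<close>] by blast
    then have "b \<noteq> top" by auto
    with b show ?thesis using that[of "enn2real b"] by (simp add: enn2real_positive_iff less_top)
  qed
  have "(\<integral>\<^sup>+x. ennreal (norm (u x) ^ 1) \<partial>lborel) < \<infinity>" using u by (simp add: integrable_iff_bounded)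
  then obtain g K M where g: "continuous_on UNIV g" "\<And>x. norm x > K \<Longrightarrow> g x = 0" "\<And>x. norm (g x) \<le> M"
    and d: "(\<integral>\<^sup>+x. ennreal (norm (u x - g x) ^ 1) \<partial>lborel) < e / 4"
    using continuous_compact_support_dense[of u 1 "e/4"] e(1) by auto
  have [measurable]: "g \<in> borel_measurable borel" using g(1) by (rule borel_measurable_continuous_onI)
  \<comment> \<open>From \<open>N\<close> on the shifts are shorter than \<open>1\<close>, so all
    differences vanish outside \<open>cball 0 (K + 1)\<close>.\<close>
  obtain N where N: "\<And>k. k \<ge> N \<Longrightarrow> norm (s k) < 1" using LIMSEQ_D[OF s, of 1] by auto
  have "(\<lambda>k. \<integral>\<^sup>+z. ennreal (norm (g (z + s (k + N)) - g z)) \<partial>lborel) \<longlonglongrightarrow> (\<integral>\<^sup>+_. 0 \<partial>(lborel :: 'a measure))"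
  proof (rule nn_integral_dominated_convergence[where w="\<lambda>x. ennreal (2 * M) * indicator (cball 0 (K + 1)) x"])
    have "norm (g (z + s (k + N)) - g z) \<le> 2 * M" for z k
      using g(3)[of z] g(3)[of "z + s (k+N)"] norm_triangle_ineq4[of "g (z + s (k+N))" "g z"] by linarith
    moreover have "g (z + s (k + N)) - g z = 0" if "norm z > K + 1" for z k
    proof -
      have "norm (s (k+N)) < 1" using N by simp
      moreover have "norm z \<le> norm (z + s (k + N)) + norm (s (k+N))"
        using norm_triangle_ineq4[of "z + s (k+N)" "s (k+N)"] by simp
      ultimately show ?thesis using that g(2) by simp
    qed
    ultimately show "AE z in lborel. ennreal (norm (g (z + s (k + N)) - g z)) \<le> ennreal (2 * M) * indicator (cball 0 (K + 1)) z" for k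
      by (intro AE_I2) (auto simp: indicator_def ennreal_leI not_le)
    show "(\<integral>\<^sup>+ x. ennreal (2 * M) * indicator (cball (0::'a) (K + 1)) x \<partial>lborel) < \<infinity>"
      by (subst nn_integral_cmult_indicator) (simp_all add: ennreal_mult_less_top emeasure_bounded_finite[OF bounded_cball, simplified])
    show "(\<lambda>z. ennreal (2 * M) * indicator (cball 0 (K + 1)) z) \<in> borel_measurable lborel"
      unfolding measurable_lborel2 by (intro borel_measurable_times_ennreal borel_measurable_const borel_measurable_indicator borel_closed closed_cball)
    have "(\<lambda>k. norm (g (z + s (k + N)) - g z)) \<longlonglongrightarrow> 0" for z
    proof -
      have "(\<lambda>k. z + s (k + N)) \<longlonglongrightarrow> z + 0" using LIMSEQ_ignore_initial_segment[OF s] by (intro tendsto_intros)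
      moreover have "isCont g z" using g(1) by (simp add: continuous_on_eq_continuous_at)
      ultimately have "(\<lambda>k. g (z + s (k + N))) \<longlonglongrightarrow> g z" using isCont_tendsto_compose by fastforce
      then have "(\<lambda>k. norm (g (z + s (k + N)) - g z)) \<longlonglongrightarrow> norm (g z - g z)" by (intro tendsto_intros)
      then show ?thesis by simp
    qed
    then have "(\<lambda>k. ennreal (norm (g (z + s (k + N)) - g z))) \<longlonglongrightarrow> 0" for z
      using tendsto_ennrealI[of "\<lambda>k. norm (g (z + s (k + N)) - g z)" 0] by (simp only: ennreal_0)
    then show "AE z in lborel. (\<lambda>k. ennreal (norm (g (z + s (k + N)) - g z))) \<longlonglongrightarrow> 0" by simp
  qed (simp_all)
  then have "(\<lambda>k. \<integral>\<^sup>+z. ennreal (norm (g (z + s (k + N)) - g z)) \<partial>lborel) \<longlonglongrightarrow> 0" by simp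
  then have "(\<lambda>k. \<integral>\<^sup>+z. ennreal (norm (g (z + s k) - g z)) \<partial>lborel) \<longlonglongrightarrow> 0"
    by (rule LIMSEQ_offset)
  then have "\<forall>\<^sub>F k in sequentially. (\<integral>\<^sup>+z. ennreal (norm (g (z + s k) - g z)) \<partial>lborel) < ennreal (e / 4)"
    using e(1) by (intro order_tendstoD(2)) auto
  then show "\<forall>\<^sub>F k in sequentially. (\<integral>\<^sup>+z. ennreal (norm (u (z + s k) - u z)) \<partial>lborel) < a"
  proof eventually_elim
    fix k assume k: "(\<integral>\<^sup>+z. ennreal (norm (g (z + s k) - g z)) \<partial>lborel) < ennreal (e / 4)"
    have "(\<integral>\<^sup>+z. ennreal (norm (u (z + s k) - u z)) \<partial>lborel)
       \<le> (\<integral>\<^sup>+z. ennreal (norm (u (z + s k) - g (z + s k))) + (ennreal (norm (g (z + s k) - g z)) + ennreal (norm (u z - g z))) \<partial>lborel)"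
    proof (intro nn_integral_mono)
      fix z
      have "norm (u (z + s k) - u z) \<le> norm (u (z + s k) - g (z + s k)) + (norm (g (z + s k) - g z) + norm (u z - g z))"
        using norm_triangle_ineq[of "u (z + s k) - g (z + s k)" "g (z + s k) - u z"]
          norm_triangle_ineq4[of "g (z + s k) - g z" "u z - g z"] by simp
      then show "ennreal (norm (u (z + s k) - u z)) \<le> ennreal (norm (u (z + s k) - g (z + s k))) + (ennreal (norm (g (z + s k) - g z)) + ennreal (norm (u z - g z)))"
        by (simp add: ennreal_leI flip: ennreal_plus)
    qed
    also have "\<dots> = (\<integral>\<^sup>+z. ennreal (norm (u (z + s k) - g (z + s k))) \<partial>lborel) + ((\<integral>\<^sup>+z. ennreal (norm (g (z + s k) - g z)) \<partial>lborel) + (\<integral>\<^sup>+z. ennreal (norm (u z - g z)) \<partial>lborel))"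
      by (simp add: nn_integral_add)
    also have "(\<integral>\<^sup>+z. ennreal (norm (u (z + s k) - g (z + s k))) \<partial>lborel) = (\<integral>\<^sup>+z. ennreal (norm (u z - g z)) \<partial>lborel)"
      by (rule lborel_nn_integral_translation) simp
    also have "(\<integral>\<^sup>+z. ennreal (norm (u z - g z)) \<partial>lborel) + ((\<integral>\<^sup>+z. ennreal (norm (g (z + s k) - g z)) \<partial>lborel) + (\<integral>\<^sup>+z. ennreal (norm (u z - g z)) \<partial>lborel))
       \<le> ennreal (e/4) + (ennreal (e/4) + ennreal (e/4))"
      using k d by (intro add_mono) auto
    also have "\<dots> \<le> ennreal e" using e(1) by (simp add: ennreal_leI flip: ennreal_plus)
    finally show "(\<integral>\<^sup>+z. ennreal (norm (u (z + s k) - u z)) \<partial>lborel) < a" using e(2) by simp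
  qed
qed simp

lemma borel_measurable_cnj_comp [measurable (raw)]:
  "f \<in> borel_measurable M \<Longrightarrow> (\<lambda>x. cnj (f x)) \<in> borel_measurable M"
  by (rule borel_measurable_continuous_on[OF continuous_on_cnj[OF continuous_on_id]])

lemma borel_measurable_cis_comp [measurable (raw)]:
  "f \<in> borel_measurable M \<Longrightarrow> (\<lambda>x. cis (f x)) \<in> borel_measurable M"
  by (rule borel_measurable_continuous_on[OF continuous_on_cis[OF continuous_on_id]])

section \<open>Gaussian integrals and their Fourier transforms\<close>

lemma
  fixes f :: "'a::euclidean_space \<Rightarrow> real \<Rightarrow> complex"
  assumes f: "\<And>b. b \<in> Basis \<Longrightarrow> integrable lborel (f b)"
  shows integrable_lborel_prod: "integrable lborel (\<lambda>x. \<Prod>b\<in>Basis. f b (x \<bullet> b))"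
    and integral_lborel_prod: "(\<integral>x. (\<Prod>b\<in>Basis. f b (x \<bullet> b)) \<partial>lborel) = (\<Prod>b\<in>Basis. \<integral>t. f b t \<partial>lborel)"
proof -
  interpret P: product_sigma_finite "\<lambda>_::'a. lborel :: real measure" by standard
  have [measurable]: "f b \<in> borel_measurable borel" if "b \<in> Basis" for b using f[OF that] by auto
  have meas: "(\<lambda>g. \<Sum>b\<in>Basis. g b *\<^sub>R b) \<in> measurable (\<Pi>\<^sub>M b\<in>Basis. lborel) (borel :: 'a measure)"
    by measurable
  have m: "(\<lambda>x::'a. \<Prod>b\<in>Basis. f b (x \<bullet> b)) \<in> borel_measurable borel" by measurable
  have eq: "(\<Prod>b\<in>Basis. f b ((\<Sum>b'\<in>Basis. g b' *\<^sub>R b') \<bullet> b)) = (\<Prod>b\<in>Basis. f b (g b))" for g :: "'a \<Rightarrow> real"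
    by (intro prod.cong) (auto simp: inner_sum_left inner_Basis if_distrib cong: if_cong)
  show "integrable lborel (\<lambda>x. \<Prod>b\<in>Basis. f b (x \<bullet> b))"
    using P.product_integrable_prod[of Basis f] f
    by (subst lborel_eq) (simp add: integrable_distr_eq[OF meas m] eq)
  show "(\<integral>x. (\<Prod>b\<in>Basis. f b (x \<bullet> b)) \<partial>lborel) = (\<Prod>b\<in>Basis. \<integral>t. f b t \<partial>lborel)"
    using P.product_integral_prod[of Basis f] f
    by (subst lborel_eq) (simp add: integral_distr[OF meas m] eq)
qed

text \<open>The characteristic function of the standard normal law supplies the value; the
  substitution by \<open>k = sqrt (2 * c)\<close> turns its density into a multiple of
  \<open>exp (- c * x\<^sup>2)\<close>.\<close>

lemma
  fixes c t :: real
  assumes c: "0 < c"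
  shows integrable_gaussian_cis_real: "integrable lborel (\<lambda>x. complex_of_real (exp (- c * x\<^sup>2)) * cis (t * x))"
    and integral_gaussian_cis_real: "(\<integral>x. complex_of_real (exp (- c * x\<^sup>2)) * cis (t * x) \<partial>lborel)
      = complex_of_real (sqrt (pi / c) * exp (- t\<^sup>2 / (4 * c)))"
proof -
  define k where "k = sqrt (2 * c)"
  have k: "0 < k" "k\<^sup>2 = 2 * c" using c by (auto simp: k_def)
  have int_std: "integrable lborel (\<lambda>x. std_normal_density x *\<^sub>R cis (s * x))" for s :: real
    by (rule Bochner_Integration.integrable_bound[OF integrable_normal_density[of 1 0]]) (auto simp: cis_conv_exp)
  have "(\<integral>x. std_normal_density x *\<^sub>R cis (s * x) \<partial>lborel) = complex_of_real (exp (- (s\<^sup>2) / 2))" for s :: real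
  proof -
    have "char std_normal_distribution s = (\<integral>x. std_normal_density x *\<^sub>R cis (s * x) \<partial>lborel)"
      unfolding char_def by (subst integral_density) (auto simp: cis_conv_exp)
    then show ?thesis by (simp add: char_std_normal_distribution)
  qed
  from this[of "t / k"] have "(\<integral>x. std_normal_density x *\<^sub>R cis (t / k * x) \<partial>lborel) = complex_of_real (exp (- ((t/k)\<^sup>2) / 2))" .
  then have 1: "k *\<^sub>R (\<integral>x. std_normal_density (k * x) *\<^sub>R cis (t / k * (k * x)) \<partial>lborel) = complex_of_real (exp (- ((t/k)\<^sup>2) / 2))"
    using lborel_integral_real_affine[of k "\<lambda>x. std_normal_density x *\<^sub>R cis (t / k * x)" 0] k by simp
  have 2: "std_normal_density (k * x) *\<^sub>R cis (t / k * (k * x)) = (1 / sqrt (2 * pi)) *\<^sub>R (complex_of_real (exp (- c * x\<^sup>2)) * cis (t * x))" for x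
    using k c by (simp add: std_normal_density_def power_mult_distrib scaleR_conv_of_real)
  have "integrable lborel (\<lambda>x. std_normal_density (0 + k * x) *\<^sub>R cis (t / k * (0 + k * x)))"
    using k by (intro lborel_integrable_real_affine[OF int_std]) auto
  then have "integrable lborel (\<lambda>x. (1 / sqrt (2 * pi)) *\<^sub>R (complex_of_real (exp (- c * x\<^sup>2)) * cis (t * x)))"
    by (simp only: add_0 2)
  from integrable_scaleR_right[OF this, of "sqrt (2 * pi)"]
  show "integrable lborel (\<lambda>x. complex_of_real (exp (- c * x\<^sup>2)) * cis (t * x))" by simp
  have "(k / sqrt (2 * pi)) *\<^sub>R (\<integral>x. complex_of_real (exp (- c * x\<^sup>2)) * cis (t * x) \<partial>lborel) = complex_of_real (exp (- ((t/k)\<^sup>2) / 2))"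
    using 1 unfolding 2 by simp
  then have "(\<integral>x. complex_of_real (exp (- c * x\<^sup>2)) * cis (t * x) \<partial>lborel) = (sqrt (2 * pi) / k) *\<^sub>R complex_of_real (exp (- ((t/k)\<^sup>2) / 2))"
    using k by (metis (no_types, lifting) divide_eq_0_iff less_irrefl real_sqrt_eq_zero_cancel_iff mult_eq_0_iff pi_neq_zero zero_neq_numeral scaleR_scaleR scaleR_one times_divide_times_eq mult.commute divide_self)
  moreover have "sqrt (2 * pi) / k = sqrt (pi / c)" using c by (simp add: k_def real_sqrt_divide[symmetric])
  moreover have "- ((t/k)\<^sup>2) / 2 = - t\<^sup>2 / (4 * c)" using k by (simp add: power_divide)
  ultimately show "(\<integral>x. complex_of_real (exp (- c * x\<^sup>2)) * cis (t * x) \<partial>lborel)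
      = complex_of_real (sqrt (pi / c) * exp (- t\<^sup>2 / (4 * c)))" by (simp add: scaleR_conv_of_real)
qed

lemma
  fixes \<xi> :: "'a::euclidean_space"
  assumes c: "0 < c"
  shows integrable_gaussian_cis: "integrable lborel (\<lambda>x. complex_of_real (exp (- c * (norm x)\<^sup>2)) * cis (x \<bullet> \<xi>))"
    and integral_gaussian_cis: "(\<integral>x. complex_of_real (exp (- c * (norm x)\<^sup>2)) * cis (x \<bullet> \<xi>) \<partial>lborel)
      = complex_of_real (sqrt (pi / c) ^ DIM('a) * exp (- (norm \<xi>)\<^sup>2 / (4 * c)))"
proof -
  have nrm: "(norm x)\<^sup>2 = (\<Sum>b\<in>Basis. (x \<bullet> b)\<^sup>2)" for x :: 'a
    by (simp add: norm_eq_sqrt_inner euclidean_inner[of x x] power2_eq_square sum_nonneg)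
  have eq: "complex_of_real (exp (- c * (norm x)\<^sup>2)) * cis (x \<bullet> \<xi>) =
      (\<Prod>b\<in>Basis. complex_of_real (exp (- c * (x \<bullet> b)\<^sup>2)) * cis ((\<xi> \<bullet> b) * (x \<bullet> b)))" for x
  proof -
    have "cis (x \<bullet> \<xi>) = (\<Prod>b\<in>Basis. cis ((\<xi> \<bullet> b) * (x \<bullet> b)))"
      unfolding cis_conv_exp by (subst euclidean_inner) (simp add: exp_sum sum_distrib_left mult.commute)
    moreover have "exp (- c * (norm x)\<^sup>2) = (\<Prod>b\<in>Basis. exp (- c * (x \<bullet> b)\<^sup>2))"
      unfolding nrm by (simp add: sum_distrib_left exp_sum flip: sum_negf)
    ultimately show ?thesis by (simp add: prod.distrib)
  qed
  show "integrable lborel (\<lambda>x. complex_of_real (exp (- c * (norm x)\<^sup>2)) * cis (x \<bullet> \<xi>))"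
    unfolding eq by (intro integrable_lborel_prod integrable_gaussian_cis_real c)
  have "(\<integral>x. complex_of_real (exp (- c * (norm x)\<^sup>2)) * cis (x \<bullet> \<xi>) \<partial>lborel) =
     (\<Prod>b\<in>(Basis::'a set). complex_of_real (sqrt (pi / c) * exp (- (\<xi> \<bullet> b)\<^sup>2 / (4 * c))))"
    unfolding eq integral_gaussian_cis_real[OF c, symmetric]
    by (intro integral_lborel_prod integrable_gaussian_cis_real c)
  also have "\<dots> = complex_of_real (sqrt (pi / c) ^ DIM('a) * (\<Prod>b\<in>(Basis::'a set). exp (- (\<xi> \<bullet> b)\<^sup>2 / (4 * c))))"
    by (simp add: prod.distrib)
  also have "(\<Prod>b\<in>(Basis::'a set). exp (- (\<xi> \<bullet> b)\<^sup>2 / (4 * c))) = exp (- (norm \<xi>)\<^sup>2 / (4 * c))"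
    unfolding nrm by (simp add: exp_sum sum_divide_distrib flip: sum_negf)
  finally show "(\<integral>x. complex_of_real (exp (- c * (norm x)\<^sup>2)) * cis (x \<bullet> \<xi>) \<partial>lborel)
      = complex_of_real (sqrt (pi / c) ^ DIM('a) * exp (- (norm \<xi>)\<^sup>2 / (4 * c)))" .
qed

lemma
  assumes c: "0 < c"
  shows integrable_gaussian: "integrable lborel (\<lambda>x::'a::euclidean_space. exp (- c * (norm x)\<^sup>2))"
    and integral_gaussian: "(\<integral>x. exp (- c * (norm x)\<^sup>2) \<partial>(lborel :: 'a measure)) = sqrt (pi / c) ^ DIM('a)"
proof -
  have 1: "integrable lborel (\<lambda>x::'a. complex_of_real (exp (- c * (norm x)\<^sup>2)))"
    using integrable_gaussian_cis[OF c, of "0::'a"] by simp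
  then show "integrable lborel (\<lambda>x::'a. exp (- c * (norm x)\<^sup>2))"
    using integrable_Re by fastforce
  have "complex_of_real (\<integral>x. exp (- c * (norm x)\<^sup>2) \<partial>(lborel :: 'a measure)) = (\<integral>x. complex_of_real (exp (- c * (norm x)\<^sup>2)) \<partial>(lborel :: 'a measure))"
    by simp
  also have "\<dots> = complex_of_real (sqrt (pi / c) ^ DIM('a))"
    using integral_gaussian_cis[OF c, of "0::'a"] by simp
  finally show "(\<integral>x. exp (- c * (norm x)\<^sup>2) \<partial>(lborel :: 'a measure)) = sqrt (pi / c) ^ DIM('a)"
    using of_real_eq_iff by blast
qed

section \<open>Plancherel by Gaussian damping\<close>

text \<open>Expanding the square and exchanging integrals leaves only the Gram function of
  \<open>k\<close>, the integral of \<open>k y c * cnj (k y' c)\<close> over \<open>c\<close>. Two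
  kernels with the same Gram function thus give the same square integral, which is how the Fourier
  side and the convolution side are compared. The bound \<open>C\<close> makes the triple integral
  absolutely convergent.\<close>

lemma
  fixes u :: "'a::euclidean_space \<Rightarrow> complex" and k :: "'a \<Rightarrow> 'c \<Rightarrow> complex"
  assumes M: "sigma_finite_measure M" and u: "integrable lborel u"
    and k[measurable]: "case_prod k \<in> borel_measurable (borel \<Otimes>\<^sub>M M)"
    and kb: "\<And>y c. cmod (k y c) \<le> B"
    and ki: "\<And>y y'. integrable M (\<lambda>c. k y c * cnj (k y' c))"
    and kC: "\<And>y y'. (\<integral>c. cmod (k y c * cnj (k y' c)) \<partial>M) \<le> C"
  shows integrable_square_integral_operator: "integrable M (\<lambda>c. (cmod (\<integral>y. u y * k y c \<partial>lborel))\<^sup>2)"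
    and integral_square_integral_operator: "complex_of_real (\<integral>c. (cmod (\<integral>y. u y * k y c \<partial>lborel))\<^sup>2 \<partial>M) =
      (\<integral>p. u (fst p) * cnj (u (snd p)) * (\<integral>c. k (fst p) c * cnj (k (snd p) c) \<partial>M) \<partial>(lborel \<Otimes>\<^sub>M lborel))"
proof -
  interpret M: sigma_finite_measure M by fact
  interpret PS: pair_sigma_finite "lborel \<Otimes>\<^sub>M (lborel :: 'a measure)" M
    by unfold_locales
  have [measurable]: "u \<in> borel_measurable borel" using u by auto
  have [measurable]: "case_prod k \<in> borel_measurable (lborel \<Otimes>\<^sub>M M)" using k by (simp cong: measurable_cong_sets)
  have [measurable (raw)]: "(\<lambda>x. k (f x) (g x)) \<in> borel_measurable N"
    if "f \<in> measurable N borel" "g \<in> measurable N M" for f g and N :: "'z measure"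
    using measurable_compose[OF measurable_Pair[OF that] k] by simp
  define F where "F p c = u (fst p) * cnj (u (snd p)) * (k (fst p) c * cnj (k (snd p) c))" for p c
  have [measurable]: "(\<lambda>(p, c). F p c) \<in> borel_measurable ((lborel \<Otimes>\<^sub>M lborel) \<Otimes>\<^sub>M M)"
    unfolding F_def by measurable
  have uu: "integrable (lborel \<Otimes>\<^sub>M lborel) (\<lambda>p. u (fst p) * cnj (u (snd p)))"
  proof (rule lborel_pair.Fubini_integrable)
    show "integrable lborel (\<lambda>x. \<integral>y. norm (u (fst (x, y)) * cnj (u (snd (x, y)))) \<partial>lborel)"
      using u by (simp add: norm_mult)
    show "AE x in lborel. integrable lborel (\<lambda>y. u (fst (x, y)) * cnj (u (snd (x, y))))"
      using u by simp
  qed measurable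
  have Fi: "integrable ((lborel \<Otimes>\<^sub>M lborel) \<Otimes>\<^sub>M M) (case_prod F)"
  proof (rule PS.Fubini_integrable)
    have eq: "(\<integral>y. cmod (case (x, y) of (x, y) \<Rightarrow> F x y) \<partial>M) = cmod (u (fst x) * cnj (u (snd x))) * (\<integral>c. cmod (k (fst x) c * cnj (k (snd x) c)) \<partial>M)" for x
      unfolding F_def by (simp add: norm_mult mult.assoc)
    show "integrable (lborel \<Otimes>\<^sub>M lborel) (\<lambda>x. \<integral>y. cmod (case (x, y) of (x, y) \<Rightarrow> F x y) \<partial>M)"
    proof (rule Bochner_Integration.integrable_bound[OF integrable_mult_right[OF integrable_norm[OF uu], of C]])
      show "AE x in lborel \<Otimes>\<^sub>M lborel. norm (\<integral>y. cmod (case (x, y) of (x, y) \<Rightarrow> F x y) \<partial>M) \<le> norm (C * norm (u (fst x) * cnj (u (snd x))))"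
      proof (intro AE_I2)
        fix x :: "'a \<times> 'a"
        have "0 \<le> (\<integral>c. cmod (k (fst x) c * cnj (k (snd x) c)) \<partial>M)" by simp
        with kC[of "fst x" "snd x"] show "norm (\<integral>y. cmod (case (x, y) of (x, y) \<Rightarrow> F x y) \<partial>M) \<le> norm (C * norm (u (fst x) * cnj (u (snd x))))"
          unfolding eq using mult_left_mono[of "\<integral>c. cmod (k (fst x) c * cnj (k (snd x) c)) \<partial>M" "\<bar>C\<bar>" "cmod (u (fst x) * cnj (u (snd x)))"]
          by (simp add: abs_mult mult.commute)
      qed
    qed measurable
    show "AE x in lborel \<Otimes>\<^sub>M lborel. integrable M (\<lambda>y. case (x, y) of (x, y) \<Rightarrow> F x y)"
      unfolding F_def using ki by simp
  qed measurable
  have inner: "(\<integral>p. F p c \<partial>(lborel \<Otimes>\<^sub>M lborel)) = complex_of_real ((cmod (\<integral>y. u y * k y c \<partial>lborel))\<^sup>2)" if c: "c \<in> space M" for c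
  proof -
    have [measurable]: "(\<lambda>y. k y c) \<in> borel_measurable borel" using c by measurable
    have uk: "integrable lborel (\<lambda>y. u y * k y c)"
    proof (rule Bochner_Integration.integrable_bound[OF integrable_mult_right[OF integrable_norm[OF u], of B]])
      have "cmod (u y * k y c) \<le> \<bar>B\<bar> * cmod (u y)" for y
        using mult_left_mono[of "cmod (k y c)" "\<bar>B\<bar>" "cmod (u y)"] kb[of y c] by (simp add: norm_mult mult.commute)
      then show "AE y in lborel. norm (u y * k y c) \<le> norm (B * norm (u y))" by (simp add: abs_mult)
    qed measurable
    have "integrable (lborel \<Otimes>\<^sub>M lborel) (\<lambda>p. (u (fst p) * k (fst p) c) * cnj (u (snd p) * k (snd p) c))"
    proof (rule lborel_pair.Fubini_integrable)
      show "integrable lborel (\<lambda>x. \<integral>y. norm ((u (fst (x, y)) * k (fst (x, y)) c) * cnj (u (snd (x, y)) * k (snd (x, y)) c)) \<partial>lborel)"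
        using integrable_norm[OF uk] by (simp add: norm_mult)
      show "AE x in lborel. integrable lborel (\<lambda>y. (u (fst (x, y)) * k (fst (x, y)) c) * cnj (u (snd (x, y)) * k (snd (x, y)) c))"
      proof (rule AE_I2)
        fix x
        show "integrable lborel (\<lambda>y. (u (fst (x, y)) * k (fst (x, y)) c) * cnj (u (snd (x, y)) * k (snd (x, y)) c))"
          unfolding fst_conv snd_conv using integrable_cnj[OF uk] by (rule integrable_mult_right)
      qed
    qed measurable
    from lborel_pair.integral_fst'[OF this]
    have "(\<integral>p. F p c \<partial>(lborel \<Otimes>\<^sub>M lborel)) = (\<integral>x. \<integral>y. (u x * k x c) * cnj (u y * k y c) \<partial>lborel \<partial>lborel)"
      unfolding F_def fst_conv snd_conv complex_cnj_mult by (simp only: mult_ac)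
    also have "\<dots> = (\<integral>x. u x * k x c \<partial>lborel) * cnj (\<integral>y. u y * k y c \<partial>lborel)"
      by (simp only: integral_mult_right_zero integral_mult_left_zero integral_bounded_linear[OF bounded_linear_cnj uk])
    finally show ?thesis by (simp only: complex_norm_square)
  qed
  have "integrable M (\<lambda>c. \<integral>p. F p c \<partial>(lborel \<Otimes>\<^sub>M lborel))" using PS.integrable_snd[OF Fi] .
  then have "integrable M (\<lambda>c. complex_of_real ((cmod (\<integral>y. u y * k y c \<partial>lborel))\<^sup>2))"
    by (rule Bochner_Integration.integrable_cong[THEN iffD1, rotated 2]) (simp_all add: inner)
  then show "integrable M (\<lambda>c. (cmod (\<integral>y. u y * k y c \<partial>lborel))\<^sup>2)"
    using integrable_Re by fastforce
  have "complex_of_real (\<integral>c. (cmod (\<integral>y. u y * k y c \<partial>lborel))\<^sup>2 \<partial>M) = (\<integral>c. complex_of_real ((cmod (\<integral>y. u y * k y c \<partial>lborel))\<^sup>2) \<partial>M)"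
    by (simp only: integral_complex_of_real)
  also have "\<dots> = (\<integral>c. \<integral>p. F p c \<partial>(lborel \<Otimes>\<^sub>M lborel) \<partial>M)"
    by (rule Bochner_Integration.integral_cong) (simp_all add: inner)
  also have "\<dots> = (\<integral>p. \<integral>c. F p c \<partial>M \<partial>(lborel \<Otimes>\<^sub>M lborel))"
    by (rule PS.Fubini_integral[OF Fi])
  finally show "complex_of_real (\<integral>c. (cmod (\<integral>y. u y * k y c \<partial>lborel))\<^sup>2 \<partial>M) =
      (\<integral>p. u (fst p) * cnj (u (snd p)) * (\<integral>c. k (fst p) c * cnj (k (snd p) c) \<partial>M) \<partial>(lborel \<Otimes>\<^sub>M lborel))"
    by (simp add: F_def)
qed

lemma lborel_integral_affine:
  fixes f :: "'a::euclidean_space \<Rightarrow> complex"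
  assumes [measurable]: "f \<in> borel_measurable borel" and r: "0 < r"
  shows "(\<integral>x. f x \<partial>lborel) = complex_of_real (r ^ DIM('a)) * (\<integral>x. f (z + r *\<^sub>R x) \<partial>lborel)"
  using r by (subst lborel_affine[of r z]) (simp_all add: integral_density integral_distr scaleR_conv_of_real)

lemma lborel_nn_integral_affine:
  fixes f :: "'a::euclidean_space \<Rightarrow> ennreal"
  assumes [measurable]: "f \<in> borel_measurable borel" and r: "0 < r"
  shows "(\<integral>\<^sup>+x. f x \<partial>lborel) = ennreal (r ^ DIM('a)) * (\<integral>\<^sup>+x. f (z + r *\<^sub>R x) \<partial>lborel)"
  using r by (subst lborel_affine[of r z]) (simp_all add: nn_integral_density nn_integral_distr nn_integral_cmult)

text \<open>Completing the square about the midpoint: a product of two Gaussians in \<open>z\<close>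
  splits into a Gaussian in \<open>y - y'\<close> and one in \<open>z\<close> centred at the
  midpoint.\<close>

lemma gaussian_product_center:
  fixes y y' z :: "'a::real_inner"
  shows "(norm (y - z))\<^sup>2 + (norm (y' - z))\<^sup>2 = (norm (y - y'))\<^sup>2 / 2 + 2 * (norm (z - (1/2) *\<^sub>R (y + y')))\<^sup>2"
  unfolding power2_norm_eq_inner by (simp add: inner_simps inner_commute field_simps)

text \<open>For a non-integrable \<open>f\<close> the left side is \<open>0\<close> by the
  convention for Bochner integrals, so the bound is trivial there.\<close>

lemma integral_norm_bound_nn:
  fixes f :: "'a \<Rightarrow> complex"
  shows "ennreal (cmod (\<integral>x. f x \<partial>M)) \<le> (\<integral>\<^sup>+x. ennreal (cmod (f x)) \<partial>M)"
  by (cases "integrable M f") (auto intro: integral_norm_bound_ennreal simp: not_integrable_integral_eq)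

text \<open>Damping the Fourier side by a Gaussian amounts to convolving \<open>u\<close> with a Gaussian of width \<open>r\<close>:
  both sides are the same double integral of \<open>u(y) cnj (u(y'))\<close>.\<close>

lemma gaussian_damped_plancherel:
  fixes u :: "'a::euclidean_space \<Rightarrow> complex"
  assumes u: "integrable lborel u" and r: "0 < (r::real)"
  shows "(\<integral>\<^sup>+a. ennreal (exp (- (2 * pi\<^sup>2 * r\<^sup>2) * (norm a)\<^sup>2) * (cmod (\<integral>y. u y * cis (2 * pi * (y \<bullet> a)) \<partial>lborel))\<^sup>2) \<partial>lborel) =
    (\<integral>\<^sup>+z. ennreal ((cmod (\<integral>s. u (z + r *\<^sub>R s) * complex_of_real (exp (- (norm s)\<^sup>2) / sqrt pi ^ DIM('a)) \<partial>lborel))\<^sup>2) \<partial>lborel)"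
proof -
  have [measurable]: "u \<in> borel_measurable borel" using u by auto
  let ?n = "DIM('a)"
  \<comment> \<open>\<open>E\<close> is the common Gram function. \<open>k1\<close> carries half of
    the damping exponent, since it enters squared; \<open>k2\<close> is a Gaussian density of total
    mass \<open>1\<close>, and its products with itself integrate to the same Gaussian in
    \<open>y - y'\<close>.\<close>
  define E where "E y y' = (1 / (sqrt (2 * pi) * r)) ^ ?n * exp (- (norm (y - y'))\<^sup>2 / (2 * r\<^sup>2))" for y y' :: 'a
  define k1 where "k1 y a = complex_of_real (exp (- (pi\<^sup>2 * r\<^sup>2) * (norm a)\<^sup>2)) * cis (2 * pi * (y \<bullet> a))" for y a :: 'a
  define k2 where "k2 y z = complex_of_real (exp (- (norm (y - z))\<^sup>2 / r\<^sup>2) / (r * sqrt pi) ^ ?n)" for y z :: 'a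
  define c1 where "c1 = 2 * pi\<^sup>2 * r\<^sup>2"
  have c1: "0 < c1" using r by (simp add: c1_def)
  define c2 where "c2 = 2 / r\<^sup>2"
  have c2: "0 < c2" using r by (simp add: c2_def)
  have [measurable]: "case_prod k1 \<in> borel_measurable (borel \<Otimes>\<^sub>M lborel)" unfolding k1_def by measurable
  have [measurable]: "case_prod k2 \<in> borel_measurable (borel \<Otimes>\<^sub>M lborel)" unfolding k2_def by measurable
  have k1k1: "k1 y a * cnj (k1 y' a) = complex_of_real (exp (- c1 * (norm a)\<^sup>2)) * cis (a \<bullet> ((2 * pi) *\<^sub>R (y - y')))" for y y' a
  proof -
    have e: "exp (- (pi\<^sup>2 * r\<^sup>2) * (norm a)\<^sup>2) * exp (- (pi\<^sup>2 * r\<^sup>2) * (norm a)\<^sup>2) = exp (- c1 * (norm a)\<^sup>2)"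
      unfolding c1_def by (simp flip: exp_add)
    have c: "cis (2 * pi * (y \<bullet> a)) * cnj (cis (2 * pi * (y' \<bullet> a))) = cis (a \<bullet> ((2 * pi) *\<^sub>R (y - y')))"
      unfolding cis_cnj cis_mult by (simp add: inner_simps inner_commute algebra_simps)
    show ?thesis unfolding e[symmetric] c[symmetric] k1_def by simp
  qed
  have k2k2: "k2 y z * cnj (k2 y' z) = complex_of_real (exp (- (norm (y - y'))\<^sup>2 / (2 * r\<^sup>2)) / (r * sqrt pi) ^ (2 * ?n) * exp (- c2 * (norm (z - (1/2) *\<^sub>R (y + y')))\<^sup>2))" for y y' z
  proof -
    have "exp (- (norm (y - z))\<^sup>2 / r\<^sup>2) * exp (- (norm (y' - z))\<^sup>2 / r\<^sup>2) = exp (- ((norm (y - z))\<^sup>2 + (norm (y' - z))\<^sup>2) / r\<^sup>2)"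
      by (simp add: diff_divide_distrib flip: exp_add)
    also have "\<dots> = exp (- (norm (y - y'))\<^sup>2 / (2 * r\<^sup>2)) * exp (- c2 * (norm (z - (1/2) *\<^sub>R (y + y')))\<^sup>2)"
      unfolding gaussian_product_center c2_def using r by (simp add: field_simps flip: exp_add)
    finally have "exp (- (norm (y - z))\<^sup>2 / r\<^sup>2) * exp (- (norm (y' - z))\<^sup>2 / r\<^sup>2) = exp (- (norm (y - y'))\<^sup>2 / (2 * r\<^sup>2)) * exp (- c2 * (norm (z - (1/2) *\<^sub>R (y + y')))\<^sup>2)" .
    moreover have "(r * sqrt pi) ^ (2 * ?n) = (r * sqrt pi) ^ ?n * (r * sqrt pi) ^ ?n"
      by (simp only: mult_2 power_add)
    ultimately show ?thesis
      unfolding k2_def complex_cnj_complex_of_real of_real_mult[symmetric]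
      unfolding times_divide_times_eq by (simp only: times_divide_eq_left)
  qed
  have g2: "integrable lborel (\<lambda>z::'a. exp (- c2 * (norm (z - m))\<^sup>2))" and g2': "(\<integral>z. exp (- c2 * (norm (z - m))\<^sup>2) \<partial>lborel) = sqrt (pi / c2) ^ ?n" for m :: 'a
  proof -
    have "integrable (distr lborel borel ((+) (- m))) (\<lambda>z::'a. exp (- c2 * (norm z)\<^sup>2))"
      using integrable_gaussian[OF c2, where 'a='a] by (simp only: lborel_distr_plus)
    then show "integrable lborel (\<lambda>z::'a. exp (- c2 * (norm (z - m))\<^sup>2))"
      by (subst (asm) integrable_distr_eq) auto
    have "(\<integral>z. exp (- c2 * (norm z)\<^sup>2) \<partial>(distr lborel borel ((+) (- m)))) = sqrt (pi / c2) ^ ?n"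
      using integral_gaussian[OF c2, where 'a='a] by (simp only: lborel_distr_plus)
    then show "(\<integral>z. exp (- c2 * (norm (z - m))\<^sup>2) \<partial>lborel) = sqrt (pi / c2) ^ ?n"
      by (subst (asm) integral_distr) auto
  qed
  have i1: "integrable lborel (\<lambda>a. k1 y a * cnj (k1 y' a))" for y y'
    unfolding k1k1 by (rule integrable_gaussian_cis[OF c1])
  have i2: "integrable lborel (\<lambda>z. k2 y z * cnj (k2 y' z))" for y y'
    unfolding k2k2 by (intro integrable_of_real integrable_mult_right g2)
  have I1: "(\<integral>a. k1 y a * cnj (k1 y' a) \<partial>lborel) = complex_of_real (E y y')" for y y'
  proof -
    have "sqrt (pi / c1) = 1 / (sqrt (2 * pi) * r)"
      using r by (simp add: c1_def real_sqrt_divide real_sqrt_mult field_simps power2_eq_square)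
    moreover have "- (norm ((2 * pi) *\<^sub>R (y - y')))\<^sup>2 / (4 * c1) = - (norm (y - y'))\<^sup>2 / (2 * r\<^sup>2)"
      unfolding norm_scaleR using r by (simp add: c1_def power_mult_distrib field_simps)
    ultimately show ?thesis
      unfolding k1k1 integral_gaussian_cis[OF c1] E_def by simp
  qed
  have I2: "(\<integral>z. k2 y z * cnj (k2 y' z) \<partial>lborel) = complex_of_real (E y y')" for y y'
  proof -
    have "sqrt (pi / c2) / (r * sqrt pi)\<^sup>2 = 1 / (sqrt (2 * pi) * r)"
      using r by (simp add: c2_def real_sqrt_divide real_sqrt_mult field_simps power2_eq_square)
    then have "sqrt (pi / c2) ^ ?n / (r * sqrt pi) ^ (2 * ?n) = (1 / (sqrt (2 * pi) * r)) ^ ?n"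
      by (metis power_divide power_mult)
    moreover have swap: "A / P * S = S / P * A" for A P S :: real by simp
    ultimately show ?thesis
      unfolding k2k2 integral_complex_of_real integral_mult_right_zero g2' E_def by (subst swap) (simp only:)
  qed
  have b1: "cmod (k1 y a) \<le> 1" for y a unfolding k1_def by (simp add: norm_mult)
  have b2: "cmod (k2 y a) \<le> 1 / (r * sqrt pi) ^ ?n" for y a
    unfolding k2_def norm_of_real using r by (simp add: divide_right_mono)
  have C1: "(\<integral>a. cmod (k1 y a * cnj (k1 y' a)) \<partial>lborel) \<le> E 0 0" for y y'
  proof -
    have "(\<integral>a. cmod (k1 y a * cnj (k1 y' a)) \<partial>lborel) = (\<integral>a. exp (- c1 * (norm a)\<^sup>2) \<partial>(lborel :: 'a measure))"
      unfolding k1k1 by (simp add: norm_mult)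
    also have "complex_of_real \<dots> = (\<integral>a. k1 0 a * cnj (k1 0 a) \<partial>lborel)"
      unfolding k1k1 by simp
    finally show ?thesis unfolding I1 of_real_eq_iff by simp
  qed
  have C2: "(\<integral>a. cmod (k2 y a * cnj (k2 y' a)) \<partial>lborel) \<le> E y y'" for y y'
  proof -
    have "complex_of_real (cmod (k2 y a * cnj (k2 y' a))) = k2 y a * cnj (k2 y' a)" for a
      unfolding k2k2 norm_of_real using r by simp
    then have "complex_of_real (\<integral>a. cmod (k2 y a * cnj (k2 y' a)) \<partial>lborel) = complex_of_real (E y y')"
      unfolding I2[symmetric] integral_complex_of_real[symmetric] by simp
    then show ?thesis by (simp only: of_real_eq_iff)
  qed
  have "E y y' \<le> (1 / (sqrt (2 * pi) * r)) ^ ?n" for y y'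
    using r by (simp add: E_def mult_left_le)
  with C2 have C2: "(\<integral>a. cmod (k2 y a * cnj (k2 y' a)) \<partial>lborel) \<le> (1 / (sqrt (2 * pi) * r)) ^ ?n" for y y'
    using order_trans by blast
  note A1 = integrable_square_integral_operator[OF sigma_finite_lborel u \<open>case_prod k1 \<in> _\<close> b1 i1 C1]
    integral_square_integral_operator[OF sigma_finite_lborel u \<open>case_prod k1 \<in> _\<close> b1 i1 C1]
  note A2 = integrable_square_integral_operator[OF sigma_finite_lborel u \<open>case_prod k2 \<in> _\<close> b2 i2 C2]
    integral_square_integral_operator[OF sigma_finite_lborel u \<open>case_prod k2 \<in> _\<close> b2 i2 C2]
  have "complex_of_real (\<integral>a. (cmod (\<integral>y. u y * k1 y a \<partial>lborel))\<^sup>2 \<partial>lborel) = complex_of_real (\<integral>z. (cmod (\<integral>y. u y * k2 y z \<partial>lborel))\<^sup>2 \<partial>lborel)"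
    unfolding A1(2) A2(2) I1 I2 ..
  then have eq: "(\<integral>\<^sup>+a. ennreal ((cmod (\<integral>y. u y * k1 y a \<partial>lborel))\<^sup>2) \<partial>lborel) = (\<integral>\<^sup>+z. ennreal ((cmod (\<integral>y. u y * k2 y z \<partial>lborel))\<^sup>2) \<partial>lborel)"
    by (subst (1 2) nn_integral_eq_integral) (simp_all add: A1(1) A2(1))
  have e1: "(cmod (\<integral>y. u y * k1 y a \<partial>lborel))\<^sup>2 = exp (- (2 * pi\<^sup>2 * r\<^sup>2) * (norm a)\<^sup>2) * (cmod (\<integral>y. u y * cis (2 * pi * (y \<bullet> a)) \<partial>lborel))\<^sup>2" for a
  proof -
    have "(\<integral>y. u y * k1 y a \<partial>lborel) = (\<integral>y. complex_of_real (exp (- (pi\<^sup>2 * r\<^sup>2) * (norm a)\<^sup>2)) * (u y * cis (2 * pi * (y \<bullet> a))) \<partial>lborel)"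
      unfolding k1_def by (simp add: mult_ac)
    also have "\<dots> = complex_of_real (exp (- (pi\<^sup>2 * r\<^sup>2) * (norm a)\<^sup>2)) * (\<integral>y. u y * cis (2 * pi * (y \<bullet> a)) \<partial>lborel)"
      by (rule integral_mult_right_zero)
    finally show ?thesis by (simp add: norm_mult power_mult_distrib flip: exp_double)
  qed
  have e2: "(\<integral>y. u y * k2 y z \<partial>lborel) = (\<integral>s. u (z + r *\<^sub>R s) * complex_of_real (exp (- (norm s)\<^sup>2) / sqrt pi ^ DIM('a)) \<partial>lborel)" for z
  proof -
    have "(\<integral>y. u y * k2 y z \<partial>lborel) = complex_of_real (r ^ ?n) * (\<integral>s. u (z + r *\<^sub>R s) * k2 (z + r *\<^sub>R s) z \<partial>lborel)"
      by (rule lborel_integral_affine[OF _ r]) measurable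
    also have "\<dots> = (\<integral>s. complex_of_real (r ^ ?n) * (u (z + r *\<^sub>R s) * k2 (z + r *\<^sub>R s) z) \<partial>lborel)"
      by (rule integral_mult_right_zero[symmetric])
    also have "\<dots> = (\<integral>s. u (z + r *\<^sub>R s) * complex_of_real (exp (- (norm s)\<^sup>2) / sqrt pi ^ ?n) \<partial>lborel)"
      using r by (intro Bochner_Integration.integral_cong) (simp_all add: k2_def power_mult_distrib)
    finally show ?thesis .
  qed
  show ?thesis using eq unfolding e1 e2 .
qed

text \<open>\<open>u\<close> need not be square integrable, so both sides may be infinite, and each
  inequality is proved by Fatou's lemma as the width \<open>r\<close> tends to \<open>0\<close>. On
  the Fourier side the damping factor tends to \<open>1\<close>; on the other side
  \<open>U r\<close> tends to \<open>u\<close> almost everywhere along a subsequence.\<close>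

theorem plancherel_L1:
  fixes u :: "'a::euclidean_space \<Rightarrow> complex"
  assumes u: "integrable lborel u"
  shows "(\<integral>\<^sup>+a. ennreal ((cmod (\<integral>y. u y * cis (2 * pi * (y \<bullet> a)) \<partial>lborel))\<^sup>2) \<partial>lborel)
    = (\<integral>\<^sup>+y. ennreal ((cmod (u y))\<^sup>2) \<partial>lborel)"
proof -
  have [measurable]: "u \<in> borel_measurable borel" using u by auto
  define \<kappa> where "\<kappa> s = exp (- (norm s)\<^sup>2) / sqrt pi ^ DIM('a)" for s :: 'a
  have [measurable]: "\<kappa> \<in> borel_measurable borel" unfolding \<kappa>_def by measurable
  have \<kappa>0: "0 \<le> \<kappa> s" and \<kappa>1: "\<kappa> s \<le> 1 / sqrt pi ^ DIM('a)" for s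
    by (simp_all add: \<kappa>_def divide_right_mono)
  have \<kappa>i: "integrable lborel \<kappa>" and \<kappa>I: "(\<integral>s. \<kappa> s \<partial>lborel) = 1"
    unfolding \<kappa>_def using integrable_gaussian[of 1, where 'a='a] integral_gaussian[of 1, where 'a='a] by simp_all
  then have \<kappa>n: "(\<integral>\<^sup>+s. ennreal (\<kappa> s) \<partial>lborel) = 1"
    using \<kappa>0 by (subst nn_integral_eq_integral) auto
  define uh where "uh a = (\<integral>y. u y * cis (2 * pi * (y \<bullet> a)) \<partial>lborel)" for a
  define U where "U r z = (\<integral>s. u (z + r *\<^sub>R s) * complex_of_real (\<kappa> s) \<partial>lborel)" for r z
  have [measurable]: "uh \<in> borel_measurable borel" unfolding uh_def by measurable
  have [measurable]: "U r \<in> borel_measurable borel" for r unfolding U_def by measurable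
  have iden: "(\<integral>\<^sup>+a. ennreal (exp (- (2 * pi\<^sup>2 * r\<^sup>2) * (norm a)\<^sup>2) * (cmod (uh a))\<^sup>2) \<partial>lborel) = (\<integral>\<^sup>+z. ennreal ((cmod (U r z))\<^sup>2) \<partial>lborel)"
    if "0 < r" for r
    using gaussian_damped_plancherel[OF u that] unfolding uh_def U_def \<kappa>_def .
  \<comment> \<open>\<open>U r z\<close> averages \<open>u\<close> against the probability density
    \<open>\<kappa>\<close>, so by Cauchy-Schwarz the averaging does not increase the square
    integral.\<close>
  have up: "(\<integral>\<^sup>+z. ennreal ((cmod (U r z))\<^sup>2) \<partial>lborel) \<le> (\<integral>\<^sup>+y. ennreal ((cmod (u y))\<^sup>2) \<partial>lborel)" for r
  proof -
    have "ennreal ((cmod (U r z))\<^sup>2) \<le> (\<integral>\<^sup>+s. ennreal ((cmod (u (z + r *\<^sub>R s)))\<^sup>2) * ennreal (\<kappa> s) \<partial>lborel)" for z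
    proof -
      have "ennreal (cmod (U r z)) \<le> (\<integral>\<^sup>+s. ennreal (cmod (u (z + r *\<^sub>R s) * complex_of_real (\<kappa> s))) \<partial>lborel)"
        unfolding U_def by (rule integral_norm_bound_nn)
      also have "\<dots> = (\<integral>\<^sup>+s. ennreal (cmod (u (z + r *\<^sub>R s)) * sqrt (\<kappa> s)) * ennreal (sqrt (\<kappa> s)) \<partial>lborel)"
        by (intro nn_integral_cong) (simp add: norm_mult mult.assoc \<kappa>0 flip: ennreal_mult)
      finally have "(ennreal (cmod (U r z)))\<^sup>2 \<le> (\<integral>\<^sup>+s. ennreal (cmod (u (z + r *\<^sub>R s)) * sqrt (\<kappa> s)) * ennreal (sqrt (\<kappa> s)) \<partial>lborel)\<^sup>2"
        by (rule power_mono) simp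
      also have "\<dots> \<le> (\<integral>\<^sup>+s. (ennreal (cmod (u (z + r *\<^sub>R s)) * sqrt (\<kappa> s)))\<^sup>2 \<partial>lborel) * (\<integral>\<^sup>+s. (ennreal (sqrt (\<kappa> s)))\<^sup>2 \<partial>lborel)"
        by (rule Cauchy_Schwarz_nn_integral) measurable
      also have "(\<integral>\<^sup>+s. (ennreal (sqrt (\<kappa> s)))\<^sup>2 \<partial>lborel) = 1"
        unfolding \<kappa>n[symmetric] by (intro nn_integral_cong) (simp add: \<kappa>0 ennreal_power)
      also have "(\<integral>\<^sup>+s. (ennreal (cmod (u (z + r *\<^sub>R s)) * sqrt (\<kappa> s)))\<^sup>2 \<partial>lborel) = (\<integral>\<^sup>+s. ennreal ((cmod (u (z + r *\<^sub>R s)))\<^sup>2) * ennreal (\<kappa> s) \<partial>lborel)"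
        by (intro nn_integral_cong) (simp add: \<kappa>0 ennreal_power power_mult_distrib flip: ennreal_mult)
      finally show ?thesis by (simp add: ennreal_power)
    qed
    then have "(\<integral>\<^sup>+z. ennreal ((cmod (U r z))\<^sup>2) \<partial>lborel) \<le> (\<integral>\<^sup>+z. \<integral>\<^sup>+s. ennreal ((cmod (u (z + r *\<^sub>R s)))\<^sup>2) * ennreal (\<kappa> s) \<partial>lborel \<partial>lborel)"
      by (intro nn_integral_mono)
    also have "\<dots> = (\<integral>\<^sup>+s. \<integral>\<^sup>+z. ennreal ((cmod (u (z + r *\<^sub>R s)))\<^sup>2) * ennreal (\<kappa> s) \<partial>lborel \<partial>lborel)"
      by (rule lborel_pair.Fubini') measurable
    also have "\<dots> = (\<integral>\<^sup>+s. (\<integral>\<^sup>+z. ennreal ((cmod (u z))\<^sup>2) \<partial>lborel) * ennreal (\<kappa> s) \<partial>lborel)"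
      by (intro nn_integral_cong)
        (simp add: nn_integral_multc lborel_nn_integral_translation[of "\<lambda>z. ennreal ((cmod (u z))\<^sup>2)"])
    also have "\<dots> = (\<integral>\<^sup>+z. ennreal ((cmod (u z))\<^sup>2) \<partial>lborel)"
      by (simp add: nn_integral_cmult \<kappa>n)
    finally show ?thesis .
  qed
  define r where "r k = 1 / real (Suc k)" for k
  have r0: "0 < r k" for k by (simp add: r_def)
  have rlim: "r \<longlonglongrightarrow> 0" unfolding r_def using LIMSEQ_inverse_real_of_nat by (simp add: inverse_eq_divide)
  \<comment> \<open>\<open>\<omega>\<close> is the translation modulus of \<open>u\<close> in
    \<open>L^1\<close>; averaged against \<open>\<kappa>\<close> at scale \<open>r\<close> it
    dominates the distance from \<open>U r\<close> to \<open>u\<close>.\<close>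
  define \<omega> where "\<omega> s = (\<integral>\<^sup>+z. ennreal (cmod (u (z + s) - u z)) \<partial>lborel)" for s
  have [measurable]: "\<omega> \<in> borel_measurable borel" unfolding \<omega>_def by measurable
  define N where "N = (\<integral>\<^sup>+z. ennreal (cmod (u z)) \<partial>lborel)"
  have N: "N < \<infinity>" using u by (simp add: N_def integrable_iff_bounded)
  have \<omega>N: "\<omega> s \<le> 2 * N" for s
  proof -
    have "\<omega> s \<le> (\<integral>\<^sup>+z. ennreal (cmod (u (z + s))) + ennreal (cmod (u z)) \<partial>lborel)"
      unfolding \<omega>_def by (intro nn_integral_mono) (simp add: norm_triangle_ineq4 ennreal_leI flip: ennreal_plus)
    also have "\<dots> = 2 * N"
      by (simp add: nn_integral_add N_def lborel_nn_integral_translation[of "\<lambda>z. ennreal (cmod (u z))"] mult_2)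
    finally show ?thesis .
  qed
  have Ui: "integrable lborel (\<lambda>s. u (z + r k *\<^sub>R s) * complex_of_real (\<kappa> s))" for z k
  proof (rule Bochner_Integration.integrable_bound)
    have "(\<integral>\<^sup>+x. ennreal (cmod (u x)) \<partial>lborel) = ennreal (r k ^ DIM('a)) * (\<integral>\<^sup>+x. ennreal (cmod (u (z + r k *\<^sub>R x))) \<partial>lborel)"
      by (rule lborel_nn_integral_affine[OF _ r0]) measurable
    with N have "(\<integral>\<^sup>+x. ennreal (cmod (u (z + r k *\<^sub>R x))) \<partial>lborel) < \<infinity>"
      using r0[of k] by (auto simp: N_def ennreal_mult_less_top less_top)
    then show "integrable lborel (\<lambda>s. (1 / sqrt pi ^ DIM('a)) * cmod (u (z + r k *\<^sub>R s)))"
      by (intro integrable_mult_right) (simp add: integrable_iff_bounded)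
    show "AE s in lborel. norm (u (z + r k *\<^sub>R s) * complex_of_real (\<kappa> s)) \<le> norm (1 / sqrt pi ^ DIM('a) * cmod (u (z + r k *\<^sub>R s)))"
      using mult_left_mono[OF \<kappa>1, of "cmod (u (z + r k *\<^sub>R s))" for s] \<kappa>0 by (simp add: norm_mult)
  qed measurable
  have kc: "(\<integral>s. complex_of_real (\<kappa> s) * c \<partial>lborel) = c" for c
    by (simp add: \<kappa>I)
  have diff: "(\<integral>\<^sup>+z. ennreal (cmod (U (r k) z - u z)) \<partial>lborel) \<le> (\<integral>\<^sup>+s. \<omega> (r k *\<^sub>R s) * ennreal (\<kappa> s) \<partial>lborel)" for k
  proof -
    have "ennreal (cmod (U (r k) z - u z)) \<le> (\<integral>\<^sup>+s. ennreal (cmod (u (z + r k *\<^sub>R s) - u z)) * ennreal (\<kappa> s) \<partial>lborel)" for z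
    proof -
      have "U (r k) z - u z = (\<integral>s. u (z + r k *\<^sub>R s) * complex_of_real (\<kappa> s) - complex_of_real (\<kappa> s) * u z \<partial>lborel)"
        unfolding U_def by (subst Bochner_Integration.integral_diff[OF Ui]) (use \<kappa>i in \<open>auto simp: kc \<kappa>I\<close>)
      also have "\<dots> = (\<integral>s. (u (z + r k *\<^sub>R s) - u z) * complex_of_real (\<kappa> s) \<partial>lborel)"
        by (simp add: algebra_simps)
      finally have "ennreal (cmod (U (r k) z - u z)) \<le> (\<integral>\<^sup>+s. ennreal (cmod ((u (z + r k *\<^sub>R s) - u z) * complex_of_real (\<kappa> s))) \<partial>lborel)"
        by (simp only: integral_norm_bound_nn)
      then show ?thesis by (simp add: norm_mult \<kappa>0 ennreal_mult)
    qed
    then have "(\<integral>\<^sup>+z. ennreal (cmod (U (r k) z - u z)) \<partial>lborel) \<le> (\<integral>\<^sup>+z. \<integral>\<^sup>+s. ennreal (cmod (u (z + r k *\<^sub>R s) - u z)) * ennreal (\<kappa> s) \<partial>lborel \<partial>lborel)"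
      by (intro nn_integral_mono)
    also have "\<dots> = (\<integral>\<^sup>+s. \<integral>\<^sup>+z. ennreal (cmod (u (z + r k *\<^sub>R s) - u z)) * ennreal (\<kappa> s) \<partial>lborel \<partial>lborel)"
      by (rule lborel_pair.Fubini') measurable
    also have "\<dots> = (\<integral>\<^sup>+s. \<omega> (r k *\<^sub>R s) * ennreal (\<kappa> s) \<partial>lborel)"
      unfolding \<omega>_def by (intro nn_integral_cong nn_integral_multc) measurable
    finally show ?thesis .
  qed
  have "(\<lambda>k. \<integral>\<^sup>+s. \<omega> (r k *\<^sub>R s) * ennreal (\<kappa> s) \<partial>lborel) \<longlonglongrightarrow> (\<integral>\<^sup>+_. 0 \<partial>(lborel :: 'a measure))"
  proof (rule nn_integral_dominated_convergence[where w="\<lambda>s. 2 * N * ennreal (\<kappa> s)"])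
    show "AE s in lborel. \<omega> (r k *\<^sub>R s) * ennreal (\<kappa> s) \<le> 2 * N * ennreal (\<kappa> s)" for k
      using \<omega>N by (intro AE_I2 mult_right_mono) auto
    show "(\<integral>\<^sup>+s. 2 * N * ennreal (\<kappa> s) \<partial>lborel) < \<infinity>"
      using N by (simp add: nn_integral_cmult \<kappa>n ennreal_mult_less_top)
    show "AE s in lborel. (\<lambda>k. \<omega> (r k *\<^sub>R s) * ennreal (\<kappa> s)) \<longlonglongrightarrow> 0"
    proof (rule AE_I2)
      fix s :: 'a
      have "(\<lambda>k. r k *\<^sub>R s) \<longlonglongrightarrow> 0 *\<^sub>R s" using rlim by (intro tendsto_intros)
      then have "(\<lambda>k. \<omega> (r k *\<^sub>R s)) \<longlonglongrightarrow> 0" unfolding \<omega>_def by (intro L1_translation_tendsto[OF u]) simp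
      then have "(\<lambda>k. \<omega> (r k *\<^sub>R s) * ennreal (\<kappa> s)) \<longlonglongrightarrow> 0 * ennreal (\<kappa> s)"
        by (intro tendsto_mult_ennreal tendsto_const) auto
      then show "(\<lambda>k. \<omega> (r k *\<^sub>R s) * ennreal (\<kappa> s)) \<longlonglongrightarrow> 0" by simp
    qed
  qed measurable
  then have lim0: "(\<lambda>k. \<integral>\<^sup>+s. \<omega> (r k *\<^sub>R s) * ennreal (\<kappa> s) \<partial>lborel) \<longlonglongrightarrow> 0" by simp
  have fin: "(\<integral>\<^sup>+s. \<omega> (r k *\<^sub>R s) * ennreal (\<kappa> s) \<partial>lborel) < \<infinity>" for k
  proof -
    have "(\<integral>\<^sup>+s. \<omega> (r k *\<^sub>R s) * ennreal (\<kappa> s) \<partial>lborel) \<le> (\<integral>\<^sup>+s. 2 * N * ennreal (\<kappa> s) \<partial>lborel)"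
      using \<omega>N by (intro nn_integral_mono mult_right_mono) auto
    also have "\<dots> < \<infinity>" using N by (simp add: nn_integral_cmult \<kappa>n ennreal_mult_less_top)
    finally show ?thesis .
  qed
  have Uint: "integrable lborel (\<lambda>z. U (r k) z - u z)" for k
    using le_less_trans[OF diff fin] by (simp add: integrable_iff_bounded)
  have "(\<lambda>k. \<integral>\<^sup>+z. ennreal (cmod (U (r k) z - u z)) \<partial>lborel) \<longlonglongrightarrow> 0"
    using diff by (intro tendsto_sandwich[OF _ _ tendsto_const lim0]) auto
  then have "(\<lambda>k. ennreal (\<integral>z. cmod (U (r k) z - u z) \<partial>lborel)) \<longlonglongrightarrow> ennreal 0"
    using Uint by (simp add: nn_integral_eq_integral)
  then have "(\<lambda>k. \<integral>z. cmod (U (r k) z - u z) \<partial>lborel) \<longlonglongrightarrow> 0"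
    by (subst (asm) tendsto_ennreal_iff) auto
  \<comment> \<open>Fatou's lemma calls for convergence almost everywhere, which convergence in
    \<open>L^1\<close> provides only along a subsequence.\<close>
  from tendsto_L1_AE_subseq[OF Uint this] obtain \<rho> where \<rho>: "strict_mono \<rho>"
    and ae: "AE z in lborel. (\<lambda>k. U (r (\<rho> k)) z - u z) \<longlonglongrightarrow> 0" by blast
  show ?thesis unfolding uh_def[symmetric]
  proof (rule antisym)
    have "(\<integral>\<^sup>+y. ennreal ((cmod (u y))\<^sup>2) \<partial>lborel) = (\<integral>\<^sup>+z. liminf (\<lambda>k. ennreal ((cmod (U (r (\<rho> k)) z))\<^sup>2)) \<partial>lborel)"
    proof (rule nn_integral_cong_AE, use ae in eventually_elim)
      fix z assume "(\<lambda>k. U (r (\<rho> k)) z - u z) \<longlonglongrightarrow> 0"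
      then have "(\<lambda>k. U (r (\<rho> k)) z) \<longlonglongrightarrow> u z" by (simp add: LIM_zero_iff)
      then have "(\<lambda>k. ennreal ((cmod (U (r (\<rho> k)) z))\<^sup>2)) \<longlonglongrightarrow> ennreal ((cmod (u z))\<^sup>2)"
        by (intro tendsto_ennrealI tendsto_intros)
      then show "ennreal ((cmod (u z))\<^sup>2) = liminf (\<lambda>k. ennreal ((cmod (U (r (\<rho> k)) z))\<^sup>2))"
        by (simp only: lim_imp_Liminf[OF sequentially_bot])
    qed
    also have "\<dots> \<le> liminf (\<lambda>k. \<integral>\<^sup>+z. ennreal ((cmod (U (r (\<rho> k)) z))\<^sup>2) \<partial>lborel)"
      by (rule nn_integral_liminf) measurable
    also have "\<dots> \<le> (\<integral>\<^sup>+a. ennreal ((cmod (uh a))\<^sup>2) \<partial>lborel)"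
      unfolding iden[OF r0, symmetric]
      by (intro Liminf_le always_eventually allI nn_integral_mono ennreal_leI) (auto intro!: mult_left_le_one_le)
    finally show "(\<integral>\<^sup>+y. ennreal ((cmod (u y))\<^sup>2) \<partial>lborel) \<le> (\<integral>\<^sup>+a. ennreal ((cmod (uh a))\<^sup>2) \<partial>lborel)" .
  next
    have "(\<integral>\<^sup>+a. ennreal ((cmod (uh a))\<^sup>2) \<partial>lborel) = (\<integral>\<^sup>+a. liminf (\<lambda>k. ennreal (exp (- (2 * pi\<^sup>2 * (r k)\<^sup>2) * (norm a)\<^sup>2) * (cmod (uh a))\<^sup>2)) \<partial>lborel)"
    proof (rule nn_integral_cong)
      fix a
      have "(\<lambda>k. exp (- (2 * pi\<^sup>2 * (r k)\<^sup>2) * (norm a)\<^sup>2) * (cmod (uh a))\<^sup>2) \<longlonglongrightarrow> exp (- (2 * pi\<^sup>2 * 0\<^sup>2) * (norm a)\<^sup>2) * (cmod (uh a))\<^sup>2"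
        by (intro tendsto_intros rlim)
      then have "(\<lambda>k. ennreal (exp (- (2 * pi\<^sup>2 * (r k)\<^sup>2) * (norm a)\<^sup>2) * (cmod (uh a))\<^sup>2)) \<longlonglongrightarrow> ennreal ((cmod (uh a))\<^sup>2)"
        by (intro tendsto_ennrealI) simp
      then show "ennreal ((cmod (uh a))\<^sup>2) = liminf (\<lambda>k. ennreal (exp (- (2 * pi\<^sup>2 * (r k)\<^sup>2) * (norm a)\<^sup>2) * (cmod (uh a))\<^sup>2))"
        by (simp only: lim_imp_Liminf[OF sequentially_bot])
    qed
    also have "\<dots> \<le> liminf (\<lambda>k. \<integral>\<^sup>+a. ennreal (exp (- (2 * pi\<^sup>2 * (r k)\<^sup>2) * (norm a)\<^sup>2) * (cmod (uh a))\<^sup>2) \<partial>lborel)"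
      by (rule nn_integral_liminf) measurable
    also have "\<dots> \<le> (\<integral>\<^sup>+y. ennreal ((cmod (u y))\<^sup>2) \<partial>lborel)"
      unfolding iden[OF r0] by (intro Liminf_le always_eventually allI up) simp
    finally show "(\<integral>\<^sup>+a. ennreal ((cmod (uh a))\<^sup>2) \<partial>lborel) \<le> (\<integral>\<^sup>+y. ennreal ((cmod (u y))\<^sup>2) \<partial>lborel)" .
  qed
qed

section \<open>A Parseval family of bounded Borel functions\<close>

text \<open>A list of length \<open>m\<close> is a pattern of answers to membership in
  \<open>A 0\<close>, ..., \<open>A (m - 1)\<close>, the latest answer at the head. Consing an
  answer splits an atom in two, so the atoms of one length partition \<open>R\<close>.\<close>

primrec atom :: "'a set \<Rightarrow> (nat \<Rightarrow> 'a set) \<Rightarrow> bool list \<Rightarrow> 'a set" where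
  "atom R A [] = R"
| "atom R A (b # l) = (if b then atom R A l \<inter> A (length l) else atom R A l - A (length l))"

lemma atom_same_side:
  "x \<in> atom R A l \<Longrightarrow> y \<in> atom R A l \<Longrightarrow> i < length l \<Longrightarrow> x \<in> A i \<longleftrightarrow> y \<in> A i"
  by (induction l) (auto simp: less_Suc_eq split: if_splits)

lemma sum_lists_Suc:
  fixes f :: "bool list \<Rightarrow> 'b::comm_monoid_add"
  shows "(\<Sum>l | length l = Suc m. f l) = (\<Sum>l | length l = m. f (True # l) + f (False # l))"
proof -
  have fin: "finite {l :: bool list. length l = k}" for k
    using finite_lists_length_eq[of "UNIV :: bool set" k] by simp
  have "{l :: bool list. length l = Suc m} = (#) True ` {l. length l = m} \<union> (#) False ` {l. length l = m}"
    by (auto simp: length_Suc_conv image_iff)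
  moreover have "(#) True ` {l. length l = m} \<inter> (#) False ` {l. length l = m} = {}" by auto
  ultimately show ?thesis
    by (simp add: sum.union_disjoint fin sum.reindex sum.distrib)
qed

lemma sum_indicator_atoms:
  "(\<Sum>l | length l = m. indicator (atom R A l) x) = (indicator R x :: real)"
proof (induction m)
  case (Suc m)
  have "indicator (atom R A (True # l)) x + indicator (atom R A (False # l)) x = (indicator (atom R A l) x :: real)" for l
    by (auto simp: indicator_def)
  then show ?case unfolding sum_lists_Suc by (simp only: Suc)
qed simp

text \<open>Pythagoras on a two-point space with masses \<open>p\<close> and \<open>q\<close>: a
  function with integrals \<open>a\<close> and \<open>b\<close> over the two points splits into its
  mean and its component along the normalised Haar function.\<close>

lemma complex_unbalanced_parallelogram:
  fixes a b :: complex and p q :: real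
  assumes "0 < p" "0 < q"
  shows "(cmod a)\<^sup>2 / p + (cmod b)\<^sup>2 / q = (cmod (a + b))\<^sup>2 / (p + q) + (cmod (q * a - p * b))\<^sup>2 / (p * q * (p + q))"
proof -
  have r: "x\<^sup>2 / p + y\<^sup>2 / q = (x + y)\<^sup>2 / (p + q) + (q * x - p * y)\<^sup>2 / (p * q * (p + q))" for x y :: real
  proof -
    have "x\<^sup>2 / p + y\<^sup>2 / q = (x\<^sup>2 * q + y\<^sup>2 * p) / (p * q)"
      using assms by (simp add: field_simps)
    also have "\<dots> = (x\<^sup>2 * q + y\<^sup>2 * p) * (p + q) / (p * q * (p + q))"
      using assms by simp
    also have "(x\<^sup>2 * q + y\<^sup>2 * p) * (p + q) = (x + y)\<^sup>2 * (p * q) + (q * x - p * y)\<^sup>2"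
      by (simp add: power2_eq_square algebra_simps)
    also have "\<dots> / (p * q * (p + q)) = (x + y)\<^sup>2 / (p + q) + (q * x - p * y)\<^sup>2 / (p * q * (p + q))"
      using assms by (simp add: add_divide_distrib)
    finally show ?thesis .
  qed
  show ?thesis
    using r[of "Re a" "Re b"] r[of "Im a" "Im b"] by (simp add: cmod_power2 add_divide_distrib)
qed

section \<open>Mean squares over atoms and the Haar system\<close>

context
  fixes E :: "'a::euclidean_space set" and q :: "'a \<Rightarrow> complex"
  assumes E[measurable]: "E \<in> sets borel" and Efin: "emeasure lborel E < \<infinity>"
    and q[measurable]: "q \<in> borel_measurable borel"
    and q2: "integrable lborel (\<lambda>x. (cmod (q x))\<^sup>2)"
begin

lemma integrable_indicator_of_square: "integrable lborel (\<lambda>x. indicator E x *\<^sub>R q x)"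
proof (rule Bochner_Integration.integrable_bound)
  show "integrable lborel (\<lambda>x. indicator E x + (cmod (q x))\<^sup>2)"
    using Efin q2 by (intro Bochner_Integration.integrable_add integrable_real_indicator) auto
  have "a \<le> 1 + a\<^sup>2" for a :: real
  proof -
    have "2 * a \<le> 1 + a\<^sup>2" using sum_squares_bound[of 1 a] by simp
    moreover have "0 \<le> a\<^sup>2" by simp
    ultimately show ?thesis by linarith
  qed
  then show "AE x in lborel. norm (indicator E x *\<^sub>R q x) \<le> norm (indicator E x + (cmod (q x))\<^sup>2)"
    by (auto simp: indicator_def intro!: AE_I2)
qed measurable

lemma integrable_indicator_square_diff: "integrable lborel (\<lambda>x. indicator E x * (cmod (q x - t))\<^sup>2)"
proof (rule Bochner_Integration.integrable_bound)
  show "integrable lborel (\<lambda>x. 4 * (cmod (q x))\<^sup>2 + 4 * (cmod t)\<^sup>2 * indicator E x)"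
    using Efin q2 by (intro Bochner_Integration.integrable_add integrable_mult_right integrable_real_indicator) auto
  have "(cmod (q x - t))\<^sup>2 \<le> 4 * (cmod (q x))\<^sup>2 + 4 * (cmod t)\<^sup>2" for x
    using power_norm_diff_le[of "q x" t 2 0] by simp
  then show "AE x in lborel. norm (indicator E x * (cmod (q x - t))\<^sup>2) \<le> norm (4 * (cmod (q x))\<^sup>2 + 4 * (cmod t)\<^sup>2 * indicator E x)"
    by (auto simp: indicator_def intro!: AE_I2)
qed measurable

lemma integral_indicator_square_diff:
  "(\<integral>x. indicator E x * (cmod (q x - t))\<^sup>2 \<partial>lborel) = (\<integral>x. indicator E x * (cmod (q x))\<^sup>2 \<partial>lborel)
     - 2 * Re (cnj t * (\<integral>x. indicator E x *\<^sub>R q x \<partial>lborel)) + (cmod t)\<^sup>2 * measure lborel E"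
proof -
  note i1 = integrable_indicator_of_square
  have "(cmod (q x - t))\<^sup>2 = (cmod (q x))\<^sup>2 - 2 * Re (cnj t * q x) + (cmod t)\<^sup>2" for x
    unfolding cmod_power2 by (simp add: power2_eq_square algebra_simps)
  then have "indicator E x * (cmod (q x - t))\<^sup>2 = indicator E x * (cmod (q x))\<^sup>2 - 2 * Re (cnj t * (indicator E x *\<^sub>R q x)) + (cmod t)\<^sup>2 * indicator E x" for x
    by (cases "x \<in> E") auto
  moreover have "integrable lborel (\<lambda>x. indicator E x * (cmod (q x))\<^sup>2)"
    using integrable_indicator_square_diff[of 0] by simp
  moreover have "integrable lborel (\<lambda>x. Re (cnj t * (indicator E x *\<^sub>R q x)))"
    by (intro integrable_Re integrable_mult_right i1)
  moreover have "(\<integral>x. Re (cnj t * (indicator E x *\<^sub>R q x)) \<partial>lborel) = Re (cnj t * (\<integral>x. indicator E x *\<^sub>R q x \<partial>lborel))"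
    by (subst integral_Re) (simp_all only: integrable_mult_right i1 integral_mult_right_zero)
  moreover have "integrable lborel (\<lambda>x. (cmod t)\<^sup>2 * indicator E x)"
    using Efin by (intro integrable_mult_right integrable_real_indicator) auto
  ultimately show ?thesis using Efin by simp
qed

text \<open>The variance of \<open>q\<close> on \<open>E\<close> is non-negative: \<open>t\<close>
  is taken to be the mean. For a null set \<open>E\<close> the quotient is \<open>0\<close>.\<close>

lemma mean_square_upper:
  "(cmod (\<integral>x. indicator E x *\<^sub>R q x \<partial>lborel))\<^sup>2 / measure lborel E \<le> (\<integral>x. indicator E x * (cmod (q x))\<^sup>2 \<partial>lborel)"
proof (cases "measure lborel E = 0")
  case False
  let ?I = "\<integral>x. indicator E x *\<^sub>R q x \<partial>lborel" and ?p = "measure lborel E"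
  have p: "0 < ?p" using False by (simp add: zero_less_measure_iff)
  have "0 \<le> (\<integral>x. indicator E x * (cmod (q x - ?I / ?p))\<^sup>2 \<partial>lborel)" by (intro integral_nonneg_AE) auto
  also have "\<dots> = (\<integral>x. indicator E x * (cmod (q x))\<^sup>2 \<partial>lborel) - 2 * Re (cnj (?I / ?p) * ?I) + (cmod (?I / ?p))\<^sup>2 * ?p"
    by (rule integral_indicator_square_diff)
  also have "Re (cnj (?I / ?p) * ?I) = (cmod ?I)\<^sup>2 / ?p"
    unfolding cmod_power2 by (simp add: power2_eq_square add_divide_distrib)
  also have "(cmod (?I / ?p))\<^sup>2 * ?p = (cmod ?I)\<^sup>2 / ?p" using p by (simp add: norm_divide power2_eq_square)
  finally show ?thesis by simp
qed simp

text \<open>The mean is the best constant approximation, so an arbitrary \<open>t\<close> yields a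
  lower bound for the mean term. The freedom in \<open>t\<close> allows sampling a continuous
  approximant of \<open>q\<close>.\<close>

lemma mean_square_lower:
  "(\<integral>x. indicator E x * (cmod (q x))\<^sup>2 \<partial>lborel) - (\<integral>x. indicator E x * (cmod (q x - t))\<^sup>2 \<partial>lborel)
    \<le> (cmod (\<integral>x. indicator E x *\<^sub>R q x \<partial>lborel))\<^sup>2 / measure lborel E"
proof -
  let ?I = "\<integral>x. indicator E x *\<^sub>R q x \<partial>lborel" and ?p = "measure lborel E"
  have eq: "(\<integral>x. indicator E x * (cmod (q x))\<^sup>2 \<partial>lborel) - (\<integral>x. indicator E x * (cmod (q x - t))\<^sup>2 \<partial>lborel)
     = 2 * Re (cnj t * ?I) - (cmod t)\<^sup>2 * ?p"
    unfolding integral_indicator_square_diff by simp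
  show ?thesis
  proof (cases "?p = 0")
    case True
    then have "emeasure lborel E = 0" using Efin emeasure_eq_ennreal_measure[of lborel E] by auto
    then have "E \<in> null_sets lborel" by auto
    then have "AE x in lborel. x \<notin> E" by (rule AE_not_in)
    then have "AE x in lborel. indicator E x *\<^sub>R q x = 0" by (auto elim: eventually_mono)
    then have "?I = 0" by (rule integral_eq_zero_AE)
    with True show ?thesis unfolding eq by simp
  next
    case False
    have p: "0 < ?p" using False by (simp add: zero_less_measure_iff)
    have "Re (cnj t * ?I) \<le> cmod t * cmod ?I"
      using complex_Re_le_cmod[of "cnj t * ?I"] by (simp add: norm_mult)
    moreover have "2 * (cmod t * cmod ?I) - (cmod t)\<^sup>2 * ?p \<le> (cmod ?I)\<^sup>2 / ?p"
    proof -
      have "0 \<le> (cmod ?I - cmod t * ?p)\<^sup>2" by simp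
      then show ?thesis unfolding pos_le_divide_eq[OF p] by (simp add: power2_diff algebra_simps power2_eq_square)
    qed
    ultimately show ?thesis unfolding eq by linarith
  qed
qed

end

text \<open>The Haar function of the split of atom \<open>l\<close>: mean zero, and norm one in
  \<open>L^2\<close> if both parts have positive measure. If one part is null the denominator is
  \<open>0\<close>, and so is the function.\<close>

definition haar :: "('a::euclidean_space) set \<Rightarrow> (nat \<Rightarrow> 'a set) \<Rightarrow> bool list \<Rightarrow> 'a \<Rightarrow> real" where
  "haar R A l x = (let p = measure lborel (atom R A (True # l)); q = measure lborel (atom R A (False # l)) in
     (q * indicator (atom R A (True # l)) x - p * indicator (atom R A (False # l)) x) / sqrt (p * q * (p + q)))"

context
  fixes R :: "'a::euclidean_space set" and A :: "nat \<Rightarrow> 'a set"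
  assumes R[measurable]: "R \<in> sets borel" and Rfin: "emeasure lborel R < \<infinity>"
    and A: "\<And>i. A i \<in> sets borel"
begin

lemma atom_sets[measurable]: "atom R A l \<in> sets borel"
  using R A by (induction l) auto

lemma atom_subset: "atom R A l \<subseteq> R" by (induction l) auto

lemma atom_finite: "emeasure lborel (atom R A l) < \<infinity>"
  using emeasure_mono[OF atom_subset[of l], of lborel] Rfin by (auto intro: le_less_trans)

lemma haar_measurable[measurable]: "haar R A l \<in> borel_measurable borel"
  unfolding haar_def Let_def by (intro borel_measurable_divide borel_measurable_diff borel_measurable_times borel_measurable_const borel_measurable_indicator atom_sets)

lemma haar_bounded: "\<exists>B. \<forall>x. \<bar>haar R A l x\<bar> \<le> B"
proof -
  define p where "p = measure lborel (atom R A (True # l))"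
  define q where "q = measure lborel (atom R A (False # l))"
  have "\<bar>haar R A l x\<bar> \<le> (q + p) / sqrt (p * q * (p + q))" for x
    unfolding haar_def Let_def p_def[symmetric] q_def[symmetric] abs_divide
    by (auto simp: p_def q_def indicator_def intro!: divide_right_mono)
  then show ?thesis by blast
qed

lemma measure_atom_split: "measure lborel (atom R A l) = measure lborel (atom R A (True # l)) + measure lborel (atom R A (False # l))"
proof -
  have eq: "atom R A l = atom R A (True # l) \<union> atom R A (False # l)" by auto
  have disj: "atom R A (True # l) \<inter> atom R A (False # l) = {}" by auto
  show ?thesis
    by (subst eq, rule measure_Union[OF _ _ _ _ disj]) (use atom_finite atom_sets in \<open>auto simp del: atom.simps simp: less_top\<close>)
qed

context
  fixes q :: "'a \<Rightarrow> complex"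
  assumes q[measurable]: "q \<in> borel_measurable borel"
    and q2: "integrable lborel (\<lambda>x. (cmod (q x))\<^sup>2)"
begin

text \<open>Refining one atom adds exactly the squared Haar coefficient to the mean term. If one
  half is null, both its own mean term and the Haar coefficient vanish.\<close>

lemma haar_split:
  "(cmod (\<integral>x. indicator (atom R A (True # l)) x *\<^sub>R q x \<partial>lborel))\<^sup>2 / measure lborel (atom R A (True # l))
   + (cmod (\<integral>x. indicator (atom R A (False # l)) x *\<^sub>R q x \<partial>lborel))\<^sup>2 / measure lborel (atom R A (False # l))
   = (cmod (\<integral>x. indicator (atom R A l) x *\<^sub>R q x \<partial>lborel))\<^sup>2 / measure lborel (atom R A l)
    + (cmod (\<integral>x. q x * haar R A l x \<partial>lborel))\<^sup>2"
proof -
  define p where "p = measure lborel (atom R A (True # l))"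
  define r where "r = measure lborel (atom R A (False # l))"
  define a where "a = (\<integral>x. indicator (atom R A (True # l)) x *\<^sub>R q x \<partial>lborel)"
  define b where "b = (\<integral>x. indicator (atom R A (False # l)) x *\<^sub>R q x \<partial>lborel)"
  note int = integrable_indicator_of_square[OF atom_sets atom_finite q q2]
  have ab: "(\<integral>x. indicator (atom R A l) x *\<^sub>R q x \<partial>lborel) = a + b"
    unfolding a_def b_def Bochner_Integration.integral_add[OF int int, symmetric]
    by (intro Bochner_Integration.integral_cong) (auto simp: indicator_def)
  have pr: "measure lborel (atom R A l) = p + r" unfolding p_def r_def by (rule measure_atom_split)
  have z: "(\<integral>x. indicator (atom R A l') x *\<^sub>R q x \<partial>lborel) = 0" if "measure lborel (atom R A l') = 0" for l'
  proof -
    have "emeasure lborel (atom R A l') = 0"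
      using atom_finite[of l'] that emeasure_eq_ennreal_measure[of lborel "atom R A l'"] by auto
    then have "atom R A l' \<in> null_sets lborel" by auto
    then have "AE x in lborel. x \<notin> atom R A l'" by (rule AE_not_in)
    then have "AE x in lborel. indicator (atom R A l') x *\<^sub>R q x = 0" by (auto elim: eventually_mono)
    then show ?thesis by (rule integral_eq_zero_AE)
  qed
  have h: "(\<integral>x. q x * haar R A l x \<partial>lborel) = (r * a - p * b) / sqrt (p * r * (p + r))"
  proof -
    have "q x * haar R A l x = (r * (indicator (atom R A (True # l)) x *\<^sub>R q x) - p * (indicator (atom R A (False # l)) x *\<^sub>R q x)) / sqrt (p * r * (p + r))" for x
      unfolding haar_def Let_def p_def r_def by (simp add: scaleR_conv_of_real algebra_simps diff_divide_distrib del: atom.simps)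
    then have "(\<integral>x. q x * haar R A l x \<partial>lborel) = (\<integral>x. (r * (indicator (atom R A (True # l)) x *\<^sub>R q x) - p * (indicator (atom R A (False # l)) x *\<^sub>R q x)) / sqrt (p * r * (p + r)) \<partial>lborel)"
      by simp
    also have "\<dots> = (\<integral>x. r * (indicator (atom R A (True # l)) x *\<^sub>R q x) - p * (indicator (atom R A (False # l)) x *\<^sub>R q x) \<partial>lborel) / sqrt (p * r * (p + r))"
      by (rule integral_divide_zero)
    also have "(\<integral>x. r * (indicator (atom R A (True # l)) x *\<^sub>R q x) - p * (indicator (atom R A (False # l)) x *\<^sub>R q x) \<partial>lborel) = r * a - p * b"
      unfolding a_def b_def by (subst Bochner_Integration.integral_diff) (simp_all only: int integrable_mult_right integral_mult_right_zero)
    finally show ?thesis .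
  qed
  show ?thesis unfolding ab pr h a_def[symmetric] b_def[symmetric] p_def[symmetric] r_def[symmetric]
  proof (cases "0 < p \<and> 0 < r")
    case True
    then have "(cmod ((r * a - p * b) / sqrt (p * r * (p + r))))\<^sup>2 = (cmod (r * a - p * b))\<^sup>2 / (p * r * (p + r))"
      by (simp add: norm_divide power_divide)
    with True show "(cmod a)\<^sup>2 / p + (cmod b)\<^sup>2 / r = (cmod (a + b))\<^sup>2 / (p + r) + (cmod ((r * a - p * b) / sqrt (p * r * (p + r))))\<^sup>2"
      using complex_unbalanced_parallelogram[of p r a b] by simp
  next
    case False
    then have "p = 0 \<or> r = 0" using measure_nonneg[of lborel] by (metis p_def r_def order_le_less)
    moreover have "p = 0 \<Longrightarrow> a = 0" unfolding p_def a_def by (rule z)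
    moreover have "r = 0 \<Longrightarrow> b = 0" unfolding r_def b_def by (rule z)
    ultimately show "(cmod a)\<^sup>2 / p + (cmod b)\<^sup>2 / r = (cmod (a + b))\<^sup>2 / (p + r) + (cmod ((r * a - p * b) / sqrt (p * r * (p + r))))\<^sup>2"
      by auto
  qed
qed

text \<open>Telescoping of \<open>haar_split\<close> over the levels, starting from
  \<open>R\<close>, the only atom of level \<open>0\<close>.\<close>

lemma haar_partial_sums:
  "(\<Sum>l | length l = m. (cmod (\<integral>x. indicator (atom R A l) x *\<^sub>R q x \<partial>lborel))\<^sup>2 / measure lborel (atom R A l))
   = (cmod (\<integral>x. indicator R x *\<^sub>R q x \<partial>lborel))\<^sup>2 / measure lborel R
     + (\<Sum>l | length l < m. (cmod (\<integral>x. q x * haar R A l x \<partial>lborel))\<^sup>2)"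
proof (induction m)
  case (Suc m)
  have fin: "finite {l :: bool list. length l = k}" for k
    using finite_lists_length_eq[of "UNIV :: bool set" k] by simp
  have fin': "finite {l :: bool list. length l < k}" for k
    by (rule finite_subset[OF _ finite_lists_length_le[of "UNIV :: bool set" k]]) auto
  have "{l :: bool list. length l < Suc m} = {l. length l < m} \<union> {l. length l = m}" by auto
  then have "(\<Sum>l | length l < Suc m. (cmod (\<integral>x. q x * haar R A l x \<partial>lborel))\<^sup>2) =
    (\<Sum>l | length l < m. (cmod (\<integral>x. q x * haar R A l x \<partial>lborel))\<^sup>2) + (\<Sum>l | length l = m. (cmod (\<integral>x. q x * haar R A l x \<partial>lborel))\<^sup>2)"
    by (simp only: ) (rule sum.union_disjoint[OF fin' fin], auto)
  then show ?case unfolding sum_lists_Suc haar_split sum.distrib Suc by simp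
qed simp

text \<open>The upper bound is \<open>mean_square_upper\<close> on each atom. For the lower bound
  \<open>q\<close> is replaced by a continuous \<open>g\<close> with small error, and
  \<open>g\<close> is almost constant on deep atoms: since the \<open>A i\<close> contain small
  neighbourhoods of every point, the atoms around a point eventually lie in any neighbourhood of
  it.\<close>

lemma haar_means_tendsto:
  assumes basis: "\<And>x U. open U \<Longrightarrow> x \<in> U \<Longrightarrow> \<exists>i. x \<in> A i \<and> A i \<subseteq> U"
  shows "(\<lambda>m. \<Sum>l | length l = m. (cmod (\<integral>x. indicator (atom R A l) x *\<^sub>R q x \<partial>lborel))\<^sup>2 / measure lborel (atom R A l))
    \<longlonglongrightarrow> (\<integral>x. indicator R x * (cmod (q x))\<^sup>2 \<partial>lborel)"
proof -
  let ?N = "\<lambda>m. \<Sum>l | length l = m. (cmod (\<integral>x. indicator (atom R A l) x *\<^sub>R q x \<partial>lborel))\<^sup>2 / measure lborel (atom R A l)"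
  have i2: "integrable lborel (\<lambda>x. indicator (atom R A l) x * (cmod (q x))\<^sup>2)" for l
    using integrable_indicator_square_diff[OF atom_sets[of l] atom_finite[of l] q q2, of 0] by simp
  have part: "(\<Sum>l | length l = m. (\<integral>x. indicator (atom R A l) x * (cmod (q x))\<^sup>2 \<partial>lborel)) = (\<integral>x. indicator R x * (cmod (q x))\<^sup>2 \<partial>lborel)" for m
  proof -
    have "(\<Sum>l | length l = m. (\<integral>x. indicator (atom R A l) x * (cmod (q x))\<^sup>2 \<partial>lborel)) = (\<integral>x. (\<Sum>l | length l = m. indicator (atom R A l) x * (cmod (q x))\<^sup>2) \<partial>lborel)"
      by (rule Bochner_Integration.integral_sum[symmetric]) (rule i2)
    also have "\<dots> = (\<integral>x. indicator R x * (cmod (q x))\<^sup>2 \<partial>lborel)"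
      by (simp only: sum_distrib_right[symmetric] sum_indicator_atoms)
    finally show ?thesis .
  qed
  have up: "?N m \<le> (\<integral>x. indicator R x * (cmod (q x))\<^sup>2 \<partial>lborel)" for m
    unfolding part[of m, symmetric] by (intro sum_mono mean_square_upper[OF atom_sets atom_finite q q2])
  have low: "\<exists>M. \<forall>m\<ge>M. (\<integral>x. indicator R x * (cmod (q x))\<^sup>2 \<partial>lborel) - e < ?N m" if e: "0 < e" for e
  proof -
    have fin2: "(\<integral>\<^sup>+x. ennreal (norm (q x) ^ 2) \<partial>lborel) < \<infinity>" using q2 by (simp add: integrable_iff_bounded)
    \<comment> \<open>Both the error of \<open>g\<close> and the integrated oscillation
      \<open>D m\<close> are brought below \<open>e / 8\<close>; the factor \<open>4\<close> of
      \<open>power_norm_diff_le\<close> then restores \<open>e\<close>.\<close>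
    have e8: "0 < e / 8" using e by simp
    obtain g K B where g1: "continuous_on UNIV g" and "\<And>x. norm x > K \<Longrightarrow> g x = 0" and g2: "\<And>x. norm (g x) \<le> B"
      and d: "(\<integral>\<^sup>+x. ennreal (norm (q x - g x) ^ 2) \<partial>lborel) < ennreal (e / 8)"
      by (rule continuous_compact_support_dense[OF q fin2 pos2 e8]) (rule that)
    note g = g1 g2
    have [measurable]: "g \<in> borel_measurable borel" using g(1) by (rule borel_measurable_continuous_onI)
    have qg: "integrable lborel (\<lambda>x. (cmod (q x - g x))\<^sup>2)"
      using d by (auto simp: integrable_iff_bounded intro: less_trans)
    have d': "(\<integral>x. (cmod (q x - g x))\<^sup>2 \<partial>lborel) < e / 8"
      using d e qg by (subst (asm) nn_integral_eq_integral) (auto simp: ennreal_less_iff)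
    \<comment> \<open>A sample value of \<open>g\<close> on the atom; on an empty atom the choice is
      arbitrary, but the indicator is \<open>0\<close>.\<close>
    define t where "t l = g (SOME x. x \<in> atom R A l)" for l
    define D where "D m x = (\<Sum>l | length l = m. indicator (atom R A l) x * (cmod (g x - t l))\<^sup>2)" for m x
    have [measurable]: "D m \<in> borel_measurable borel" for m unfolding D_def by measurable
    have tB: "cmod (t l) \<le> B" for l unfolding t_def by (rule g(2))
    have Db: "D m x \<le> (2 * B)\<^sup>2 * indicator R x" and D0: "0 \<le> D m x" for m x
    proof -
      have "D m x \<le> (\<Sum>l | length l = m. indicator (atom R A l) x * (2 * B)\<^sup>2)"
        unfolding D_def
      proof (intro sum_mono mult_left_mono power_mono)
        show "cmod (g x - t l) \<le> 2 * B" for l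
          using norm_triangle_ineq4[of "g x" "t l"] g(2)[of x] tB[of l] by linarith
      qed auto
      then show "D m x \<le> (2 * B)\<^sup>2 * indicator R x"
        by (simp only: sum_distrib_right[symmetric] sum_indicator_atoms mult.commute)
      show "0 \<le> D m x" unfolding D_def by (intro sum_nonneg) auto
    qed
    have Dlim: "(\<lambda>m. D m x) \<longlonglongrightarrow> 0" for x
    proof (rule LIMSEQ_I)
      fix \<eta> :: real assume \<eta>: "0 < \<eta>"
      have "isCont g x" using g(1) by (simp add: continuous_on_eq_continuous_at)
      then have "isCont (\<lambda>y. (cmod (g x - g y))\<^sup>2) x" by (intro continuous_intros)
      then have "((\<lambda>y. (cmod (g x - g y))\<^sup>2) \<longlongrightarrow> (cmod (g x - g x))\<^sup>2) (nhds x)"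
        unfolding isCont_def by (rule tendsto_at_iff_tendsto_nhds[of "\<lambda>y. (cmod (g x - g y))\<^sup>2", THEN iffD1])
      from order_tendstoD(2)[OF this, of "\<eta> / 2"] \<eta>
      have "\<forall>\<^sub>F y in nhds x. (cmod (g x - g y))\<^sup>2 < \<eta> / 2" by simp
      then obtain U where U: "open U" "x \<in> U" "\<And>y. y \<in> U \<Longrightarrow> (cmod (g x - g y))\<^sup>2 < \<eta> / 2"
        unfolding eventually_nhds by blast
      then obtain i where i: "x \<in> A i" "A i \<subseteq> U" using basis by blast
      have "D m x \<le> \<eta> / 2" if m: "Suc i \<le> m" for m
      proof -
        have "D m x \<le> (\<Sum>l | length l = m. indicator (atom R A l) x * (\<eta> / 2))"
          unfolding D_def
        proof (rule sum_mono)
          fix l :: "bool list" assume l: "l \<in> {l. length l = m}"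
          show "indicator (atom R A l) x * (cmod (g x - t l))\<^sup>2 \<le> indicator (atom R A l) x * (\<eta> / 2)"
          proof (cases "x \<in> atom R A l")
            case True
            then have "(SOME x. x \<in> atom R A l) \<in> atom R A l" by (rule someI)
            with True have "(SOME x. x \<in> atom R A l) \<in> A i" using atom_same_side[of x R A l _ i] i l m by auto
            then show ?thesis using U(3) i(2) True by (auto simp: t_def intro: less_imp_le)
          qed simp
        qed
        also have "\<dots> \<le> \<eta> / 2"
          using \<eta> by (simp only: sum_distrib_right[symmetric] sum_indicator_atoms) (simp add: indicator_def)
        finally show ?thesis .
      qed
      then show "\<exists>no. \<forall>n\<ge>no. norm (D n x - 0) < \<eta>"
        using D0 \<eta> by (intro exI[of _ "Suc i"]) (auto intro: le_less_trans[where y="\<eta>/2"])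
    qed
    have iR: "integrable lborel (\<lambda>x. (2 * B)\<^sup>2 * indicator R x)"
      using Rfin by (intro integrable_mult_right integrable_real_indicator) auto
    have "(\<lambda>m. \<integral>x. D m x \<partial>lborel) \<longlonglongrightarrow> (\<integral>x. 0 \<partial>(lborel :: 'a measure))"
      using Db D0 Dlim by (intro integral_dominated_convergence[where w="\<lambda>x. (2 * B)\<^sup>2 * indicator R x"] iR) auto
    then have "(\<lambda>m. \<integral>x. D m x \<partial>lborel) \<longlonglongrightarrow> 0" by simp
    then have "\<forall>\<^sub>F m in sequentially. (\<integral>x. D m x \<partial>lborel) < e / 8" using e by (intro order_tendstoD(2)) auto
    then obtain M where M: "\<And>m. m \<ge> M \<Longrightarrow> (\<integral>x. D m x \<partial>lborel) < e / 8"
      unfolding eventually_sequentially by blast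
    have "(\<integral>x. indicator R x * (cmod (q x))\<^sup>2 \<partial>lborel) - e < ?N m" if m: "m \<ge> M" for m
    proof -
      have iD: "integrable lborel (D m)"
        by (rule Bochner_Integration.integrable_bound[OF iR]) (use Db D0 in auto)
      have it: "integrable lborel (\<lambda>x. indicator (atom R A l) x * (cmod (q x - t l))\<^sup>2)" for l
        by (rule integrable_indicator_square_diff[OF atom_sets atom_finite q q2])
      have "(\<Sum>l | length l = m. (\<integral>x. indicator (atom R A l) x * (cmod (q x - t l))\<^sup>2 \<partial>lborel))
         = (\<integral>x. (\<Sum>l | length l = m. indicator (atom R A l) x * (cmod (q x - t l))\<^sup>2) \<partial>lborel)"
        by (rule Bochner_Integration.integral_sum[symmetric]) (rule it)
      also have "\<dots> \<le> (\<integral>x. 4 * ((cmod (q x - g x))\<^sup>2 + D m x) \<partial>lborel)"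
      proof (rule integral_mono)
        show "integrable lborel (\<lambda>x. \<Sum>l | length l = m. indicator (atom R A l) x * (cmod (q x - t l))\<^sup>2)"
          by (intro Bochner_Integration.integrable_sum it)
        show "integrable lborel (\<lambda>x. 4 * ((cmod (q x - g x))\<^sup>2 + D m x))"
          by (intro integrable_mult_right Bochner_Integration.integrable_add qg iD)
        fix x
        have "(\<Sum>l | length l = m. indicator (atom R A l) x * (cmod (q x - t l))\<^sup>2)
          \<le> (\<Sum>l | length l = m. indicator (atom R A l) x * (4 * ((cmod (q x - g x))\<^sup>2 + (cmod (g x - t l))\<^sup>2)))"
          using power_norm_diff_le[of "q x" _ 2 "g x"] by (intro sum_mono mult_left_mono) auto
        also have "\<dots> = 4 * (cmod (q x - g x))\<^sup>2 * (\<Sum>l | length l = m. indicator (atom R A l) x) + 4 * D m x"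
          unfolding D_def by (simp add: sum_distrib_left sum.distrib algebra_simps)
        also have "\<dots> \<le> 4 * ((cmod (q x - g x))\<^sup>2 + D m x)"
          unfolding sum_indicator_atoms by (simp add: indicator_def)
        finally show "(\<Sum>l | length l = m. indicator (atom R A l) x * (cmod (q x - t l))\<^sup>2) \<le> 4 * ((cmod (q x - g x))\<^sup>2 + D m x)" .
      qed
      also have "\<dots> = 4 * ((\<integral>x. (cmod (q x - g x))\<^sup>2 \<partial>lborel) + (\<integral>x. D m x \<partial>lborel))"
        using qg iD by simp
      also have "\<dots> < e" using d' M[OF m] by simp
      finally have "(\<Sum>l | length l = m. (\<integral>x. indicator (atom R A l) x * (cmod (q x - t l))\<^sup>2 \<partial>lborel)) < e" .
      moreover have "(\<integral>x. indicator R x * (cmod (q x))\<^sup>2 \<partial>lborel) - (\<Sum>l | length l = m. (\<integral>x. indicator (atom R A l) x * (cmod (q x - t l))\<^sup>2 \<partial>lborel)) \<le> ?N m"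
        unfolding part[of m, symmetric] sum_subtractf[symmetric]
        by (intro sum_mono mean_square_lower[OF atom_sets atom_finite q q2])
      ultimately show ?thesis by linarith
    qed
    then show ?thesis by blast
  qed
  show ?thesis
  proof (rule LIMSEQ_I)
    fix e :: real assume "0 < e"
    from low[OF this] obtain M where M: "\<And>m. m \<ge> M \<Longrightarrow> (\<integral>x. indicator R x * (cmod (q x))\<^sup>2 \<partial>lborel) - e < ?N m" by blast
    have "norm (?N m - (\<integral>x. indicator R x * (cmod (q x))\<^sup>2 \<partial>lborel)) < e" if "m \<ge> M" for m
      using M[OF that] up[of m] by (simp only: real_norm_def abs_less_iff) linarith
    then show "\<exists>M. \<forall>m\<ge>M. norm (?N m - (\<integral>x. indicator R x * (cmod (q x))\<^sup>2 \<partial>lborel)) < e" by blast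
  qed
qed

end
end

text \<open>The normalised indicator of \<open>R\<close> together with the Haar functions of the
  atoms cut out by a countable basis of the topology. Degenerate members are zero functions, which
  do no harm to Parseval's identity.\<close>

lemma parseval_family_exists:
  fixes R :: "'a::euclidean_space set"
  assumes R: "R \<in> sets borel" and Rfin: "emeasure lborel R < \<infinity>"
  obtains c :: "nat \<Rightarrow> 'a \<Rightarrow> real" where
    "\<And>k. c k \<in> borel_measurable borel" "\<And>k. \<exists>B. \<forall>x. \<bar>c k x\<bar> \<le> B"
    "\<And>q :: 'a \<Rightarrow> complex. q \<in> borel_measurable borel \<Longrightarrow> integrable lborel (\<lambda>x. (cmod (q x))\<^sup>2) \<Longrightarrow>
       (\<And>x. x \<notin> R \<Longrightarrow> q x = 0) \<Longrightarrow>
       (\<Sum>k. ennreal ((cmod (\<integral>x. q x * c k x \<partial>lborel))\<^sup>2)) = (\<integral>\<^sup>+x. ennreal ((cmod (q x))\<^sup>2) \<partial>lborel)"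
proof -
  obtain \<B> :: "'a set set" where \<B>: "countable \<B>" "topological_basis \<B>" using ex_countable_basis by blast
  have ne: "\<B> \<noteq> {}" using topological_basisE[OF \<B>(2) open_UNIV, of undefined] by auto
  define A where "A = from_nat_into \<B>"
  have rA: "range A = \<B>" unfolding A_def by (rule range_from_nat_into[OF ne \<B>(1)])
  have A: "A i \<in> sets borel" for i using topological_basis_open[OF \<B>(2)] rA by (auto intro!: borel_open)
  have basis: "\<exists>i. x \<in> A i \<and> A i \<subseteq> U" if "open U" "x \<in> U" for x U
    using topological_basisE[OF \<B>(2) that] rA by (metis rangeE)
  define f where "f = from_nat_into (UNIV :: bool list set)"
  have f: "bij f"
    unfolding f_def by (rule bij_betw_from_nat_into) (simp_all add: infinite_UNIV_listI)
  \<comment> \<open>Index \<open>0\<close> carries the mean over \<open>R\<close>, from which the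
    telescoping starts; the successors run through all Haar functions.\<close>
  define c where "c k = (case k of 0 \<Rightarrow> (\<lambda>x. indicator R x / sqrt (measure lborel R)) | Suc j \<Rightarrow> haar R A (f j))" for k
  show thesis
  proof (rule that[of c])
    show "c k \<in> borel_measurable borel" for k
      using R haar_measurable[OF R Rfin A] by (cases k) (auto simp: c_def)
    show "\<exists>B. \<forall>x. \<bar>c k x\<bar> \<le> B" for k
    proof (cases k)
      case 0
      have "\<bar>c k x\<bar> \<le> 1 / sqrt (measure lborel R)" for x by (auto simp: c_def 0 indicator_def)
      then show ?thesis by blast
    next
      case (Suc j)
      then show ?thesis using haar_bounded[OF R Rfin A] by (simp add: c_def)
    qed
    fix q :: "'a \<Rightarrow> complex" assume q: "q \<in> borel_measurable borel" and q2: "integrable lborel (\<lambda>x. (cmod (q x))\<^sup>2)"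
      and q0: "\<And>x. x \<notin> R \<Longrightarrow> q x = 0"
    define F where "F l = (cmod (\<integral>x. q x * haar R A l x \<partial>lborel))\<^sup>2" for l
    define n0 where "n0 = (cmod (\<integral>x. indicator R x *\<^sub>R q x \<partial>lborel))\<^sup>2 / measure lborel R"
    have Rq: "indicator R x *\<^sub>R q x = q x" "indicator R x * (cmod (q x))\<^sup>2 = (cmod (q x))\<^sup>2" for x
      using q0[of x] by (auto simp: indicator_def)
    have c0: "(cmod (\<integral>x. q x * c 0 x \<partial>lborel))\<^sup>2 = n0"
    proof -
      have "q x * c 0 x = (indicator R x *\<^sub>R q x) / sqrt (measure lborel R)" for x
        by (simp add: c_def scaleR_conv_of_real)
      then have "(\<integral>x. q x * c 0 x \<partial>lborel) = (\<integral>x. indicator R x *\<^sub>R q x \<partial>lborel) / sqrt (measure lborel R)"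
        by (simp only: integral_divide_zero)
      then show ?thesis by (simp add: n0_def norm_divide power_divide)
    qed
    have fin': "finite {l :: bool list. length l < k}" for k
      by (rule finite_subset[OF _ finite_lists_length_le[of "UNIV :: bool set" k]]) auto
    have lim: "(\<lambda>m. n0 + (\<Sum>l | length l < m. F l)) \<longlonglongrightarrow> (\<integral>x. (cmod (q x))\<^sup>2 \<partial>lborel)"
      using haar_means_tendsto[OF R Rfin A q q2 basis]
      unfolding haar_partial_sums[OF R Rfin A q q2] F_def n0_def Rq by simp
    \<comment> \<open>The terms are non-negative, so the enumeration by \<open>f\<close> may be
      exchanged for exhaustion by the length of the list, where the telescoped partial sums are
      known.\<close>
    have "(\<Sum>j. ennreal (F (f j))) = (\<integral>\<^sup>+j. ennreal (F (f j)) \<partial>count_space UNIV)"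
      by (rule nn_integral_count_space_nat[symmetric])
    also have "\<dots> = (\<integral>\<^sup>+l. ennreal (F l) \<partial>count_space UNIV)"
      using f by (rule nn_integral_bij_count_space)
    also have "\<dots> = (\<integral>\<^sup>+l. (SUP m. ennreal (F l) * indicator {l. length l < m} l) \<partial>count_space UNIV)"
    proof (rule nn_integral_cong)
      fix l :: "bool list"
      have "ennreal (F l) \<le> (SUP m. ennreal (F l) * indicator {l. length l < m} l)"
        by (rule SUP_upper2[of "Suc (length l)"]) auto
      moreover have "(SUP m. ennreal (F l) * indicator {l. length l < m} l) \<le> ennreal (F l)"
        by (rule SUP_least) (auto simp: indicator_def)
      ultimately show "ennreal (F l) = (SUP m. ennreal (F l) * indicator {l. length l < m} l)" by (rule antisym)
    qed
    also have "\<dots> = (SUP m. \<integral>\<^sup>+l. ennreal (F l) * indicator {l. length l < m} l \<partial>count_space UNIV)"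
      by (rule nn_integral_monotone_convergence_SUP) (auto simp: incseq_def le_fun_def indicator_def)
    also have "\<dots> = (SUP m. ennreal (\<Sum>l | length l < m. F l))"
      by (intro SUP_cong refl)
         (simp add: nn_integral_count_space_indicator[symmetric] nn_integral_count_space_finite fin' F_def sum_ennreal)
    finally have "ennreal n0 + (\<Sum>j. ennreal (F (f j))) = (SUP m. ennreal (n0 + (\<Sum>l | length l < m. F l)))"
      by (simp add: ennreal_SUP_add_right n0_def F_def sum_nonneg flip: ennreal_plus)
    also have "\<dots> = ennreal (\<integral>x. (cmod (q x))\<^sup>2 \<partial>lborel)"
    proof (rule LIMSEQ_unique)
      show "(\<lambda>m. ennreal (n0 + (\<Sum>l | length l < m. F l))) \<longlonglongrightarrow> (SUP m. ennreal (n0 + (\<Sum>l | length l < m. F l)))"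
        by (rule LIMSEQ_SUP) (auto simp: incseq_def F_def intro!: ennreal_leI sum_mono2 fin')
      show "(\<lambda>m. ennreal (n0 + (\<Sum>l | length l < m. F l))) \<longlonglongrightarrow> ennreal (\<integral>x. (cmod (q x))\<^sup>2 \<partial>lborel)"
        by (intro tendsto_ennrealI lim)
    qed
    also have "\<dots> = (\<integral>\<^sup>+x. ennreal ((cmod (q x))\<^sup>2) \<partial>lborel)"
      using q2 by (simp add: nn_integral_eq_integral)
    finally have "ennreal n0 + (\<Sum>j. ennreal (F (f j))) = (\<integral>\<^sup>+x. ennreal ((cmod (q x))\<^sup>2) \<partial>lborel)" .
    moreover have "(\<Sum>k. ennreal ((cmod (\<integral>x. q x * c k x \<partial>lborel))\<^sup>2)) = ennreal n0 + (\<Sum>j. ennreal (F (f j)))"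
    proof -
      have cS: "ennreal ((cmod (\<integral>x. q x * c (Suc j) x \<partial>lborel))\<^sup>2) = ennreal (F (f j))" for j
        by (simp add: c_def F_def)
      define G where "G k = ennreal ((cmod (\<integral>x. q x * c k x \<partial>lborel))\<^sup>2)" for k
      have "(\<Sum>k. G k) = (\<Sum>j. G (j + 1)) + (\<Sum>k<1. G k)"
        by (rule suminf_offset) simp
      moreover have "G 0 = ennreal n0" unfolding G_def c0 ..
      moreover have "G (j + 1) = ennreal (F (f j))" for j unfolding G_def Suc_eq_plus1[symmetric] cS ..
      ultimately show ?thesis unfolding G_def[symmetric] by (simp add: add.commute)
    qed
    ultimately show "(\<Sum>k. ennreal ((cmod (\<integral>x. q x * c k x \<partial>lborel))\<^sup>2)) = (\<integral>\<^sup>+x. ennreal ((cmod (q x))\<^sup>2) \<partial>lborel)"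
      by simp
  qed
qed

section \<open>Change of variables over arbitrary finite index types\<close>

text \<open>The library proves the change of variables formula for index types of class \<open>wellorder\<close> only;
  \<open>wo\<close> is a well-ordered copy of an arbitrary finite index type, along which the formula is transported.\<close>

typedef 'n wo = "UNIV :: 'n set" by simp

lemma bij_Rep_wo: "bij Rep_wo"
  by (metis Abs_wo_inverse Rep_wo_inverse UNIV_I bij_betw_byWitness subset_UNIV image_subset_iff bijI' )

instance wo :: (finite) finite
proof
  show "finite (UNIV :: 'a wo set)"
  proof -
    have "(UNIV :: 'a wo set) = Abs_wo ` UNIV"
      by (metis Abs_wo_cases UNIV_eq_I image_eqI)
    then show ?thesis by (metis finite finite_imageI)
  qed
qed

definition wo_index :: "'n::finite wo \<Rightarrow> nat" where "wo_index = (SOME f. inj f)"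

lemma inj_wo_index: "inj wo_index"
proof -
  have "\<exists>f :: 'a wo \<Rightarrow> nat. inj f"
    using finite_imp_inj_to_nat_seg[OF finite_class.finite_UNIV] by blast
  then show ?thesis unfolding wo_index_def by (rule someI_ex)
qed

instantiation wo :: (finite) wellorder
begin
definition "x \<le> y \<longleftrightarrow> wo_index x \<le> wo_index y"
definition "x < y \<longleftrightarrow> wo_index x < wo_index y"
instance
proof
  fix x y :: "'a wo"
  show "x \<le> y \<Longrightarrow> y \<le> x \<Longrightarrow> x = y" using inj_wo_index by (auto simp: less_eq_wo_def dest: injD)
  fix P :: "'a wo \<Rightarrow> bool" and a :: "'a wo" assume step: "\<And>x. (\<And>y. y < x \<Longrightarrow> P y) \<Longrightarrow> P x"
  show "P a" by (induction "wo_index a" arbitrary: a rule: less_induct) (metis step less_wo_def)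
qed (auto simp: less_eq_wo_def less_wo_def)
end

section \<open>Determinants and volumes under renaming of coordinates\<close>

text \<open>Conjugation by a bijection maps transpositions to transpositions, so induction over
  products of transpositions applies.\<close>

lemma sign_conjugate:
  fixes \<phi> :: "'n::finite \<Rightarrow> 'm::finite"
  assumes \<phi>: "bij \<phi>" and p: "p permutes UNIV"
  shows "sign (\<phi> \<circ> p \<circ> inv \<phi>) = sign p"
  using p finite_class.finite_UNIV
proof (induction rule: permutes_induct)
  case id
  have "\<phi> \<circ> id \<circ> inv \<phi> = id" using \<phi> by (auto simp: bij_def surj_iff)
  then show ?case by simp
next
  case (swap a b p)
  have perm: "permutation q" if "q permutes UNIV" for q :: "'x::finite \<Rightarrow> 'x"
    using that by (auto simp: permutation_permutes)
  have inj: "inv \<phi> (\<phi> x) = x" for x using \<phi> by (simp add: bij_is_inj)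
  have surj: "\<phi> (inv \<phi> x) = x" for x using \<phi> by (simp add: bij_is_surj surj_f_inv_f)
  have c: "\<phi> \<circ> (Transposition.transpose a b \<circ> p) \<circ> inv \<phi> = Transposition.transpose (\<phi> a) (\<phi> b) \<circ> (\<phi> \<circ> p \<circ> inv \<phi>)"
    using inj surj \<phi> by (auto simp: fun_eq_iff Transposition.transpose_def bij_def dest: injD)
  have "bij (\<phi> \<circ> p \<circ> inv \<phi>)"
    using \<phi> permutes_bij[OF \<open>p permutes UNIV\<close>] by (intro bij_comp bij_imp_bij_inv)
  then have "permutation (\<phi> \<circ> p \<circ> inv \<phi>)" by (simp add: permutation)
  moreover have "a = b \<longleftrightarrow> \<phi> a = \<phi> b" using \<phi> by (auto simp: bij_def dest: injD)
  ultimately show ?case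
    unfolding c sign_compose[OF permutation_swap_id \<open>permutation (\<phi> \<circ> p \<circ> inv \<phi>)\<close>]
      sign_compose[OF permutation_swap_id perm[OF \<open>p permutes UNIV\<close>]] sign_swap_id
    by (simp only: swap.IH)
qed

text \<open>Conjugating permutations by \<open>\<psi>\<close> matches the terms of the two Leibniz
  sums.\<close>

lemma det_reindex:
  fixes A :: "real^'n^'n" and \<psi> :: "'m::finite \<Rightarrow> 'n::finite"
  assumes \<psi>: "bij \<psi>"
  shows "det ((\<chi> i j. A $ \<psi> i $ \<psi> j) :: real^'m^'m) = det A"
proof -
  let ?\<phi> = "inv \<psi>"
  have \<phi>: "bij ?\<phi>" using \<psi> by (rule bij_imp_bij_inv)
  have inj: "?\<phi> (\<psi> x) = x" for x using \<psi> by (simp add: bij_is_inj)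
  have surj: "\<psi> (?\<phi> x) = x" for x using \<psi> by (simp add: bij_is_surj surj_f_inv_f)
  have invinv: "inv ?\<phi> = \<psi>" using \<psi> by (rule inv_inv_eq)
  have pb: "p permutes UNIV \<longleftrightarrow> bij p" for p :: "'x \<Rightarrow> 'x" by (simp add: permutes_def bij_iff)
  have b: "bij_betw (\<lambda>p. ?\<phi> \<circ> p \<circ> \<psi>) {p. p permutes UNIV} {p. p permutes UNIV}"
  proof (rule bij_betwI[where g="\<lambda>p. \<psi> \<circ> p \<circ> ?\<phi>"])
    show "(\<lambda>p. ?\<phi> \<circ> p \<circ> \<psi>) \<in> {p. p permutes UNIV} \<rightarrow> {p. p permutes UNIV}"
      using \<phi> \<psi> by (auto simp: pb intro!: bij_comp)
    show "(\<lambda>p. \<psi> \<circ> p \<circ> ?\<phi>) \<in> {p. p permutes UNIV} \<rightarrow> {p. p permutes UNIV}"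
      using \<phi> \<psi> by (auto simp: pb intro!: bij_comp)
  qed (auto simp: fun_eq_iff inj surj)
  have "det ((\<chi> i j. A $ \<psi> i $ \<psi> j) :: real^'m^'m) = (\<Sum>p | p permutes UNIV. of_int (sign p) * (\<Prod>i\<in>UNIV. A $ \<psi> i $ \<psi> (p i)))"
    unfolding det_def by simp
  also have "\<dots> = (\<Sum>p | p permutes UNIV. of_int (sign (?\<phi> \<circ> p \<circ> \<psi>)) * (\<Prod>i\<in>UNIV. A $ \<psi> i $ \<psi> ((?\<phi> \<circ> p \<circ> \<psi>) i)))"
    by (rule sum.reindex_bij_betw[OF b, symmetric])
  also have "\<dots> = (\<Sum>p | p permutes UNIV. of_int (sign p) * (\<Prod>i\<in>UNIV. A $ i $ p i))"
  proof (rule sum.cong[OF refl])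
    fix p :: "'n \<Rightarrow> 'n" assume "p \<in> {p. p permutes UNIV}"
    then have "sign (?\<phi> \<circ> p \<circ> \<psi>) = sign p" using sign_conjugate[OF \<phi>, of p] by (simp add: invinv)
    moreover have "(\<Prod>i\<in>UNIV. A $ \<psi> i $ \<psi> ((?\<phi> \<circ> p \<circ> \<psi>) i)) = (\<Prod>i\<in>UNIV. A $ i $ p i)"
      using prod.reindex_bij_betw[OF \<psi>, of "\<lambda>i. A $ i $ p i"] by (simp add: surj)
    ultimately show "of_int (sign (?\<phi> \<circ> p \<circ> \<psi>)) * (\<Prod>i\<in>UNIV. A $ \<psi> i $ \<psi> ((?\<phi> \<circ> p \<circ> \<psi>) i)) = of_int (sign p) * (\<Prod>i\<in>UNIV. A $ i $ p i)"
      by simp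
  qed
  finally show ?thesis unfolding det_def .
qed

definition to_wo :: "real^'n \<Rightarrow> real^('n::finite wo)" where "to_wo x = (\<chi> i. x $ Rep_wo i)"
definition of_wo :: "real^('n::finite wo) \<Rightarrow> real^'n" where "of_wo x = (\<chi> i. x $ Abs_wo i)"

lemma to_wo_of_wo[simp]: "to_wo (of_wo x) = x" and of_wo_to_wo[simp]: "of_wo (to_wo y) = y"
  by (simp_all add: to_wo_def of_wo_def Rep_wo_inverse Abs_wo_inverse vec_eq_iff)

lemma linear_to_wo: "linear to_wo" and linear_of_wo: "linear of_wo"
  by (auto intro!: linearI simp: to_wo_def of_wo_def vec_eq_iff)

lemma measurable_wo[measurable]: "to_wo \<in> borel_measurable borel" "of_wo \<in> borel_measurable borel"
  using linear_continuous_on[OF linear_conv_bounded_linear[THEN iffD1, OF linear_to_wo], of UNIV]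
    linear_continuous_on[OF linear_conv_bounded_linear[THEN iffD1, OF linear_of_wo], of UNIV]
  by (auto intro: borel_measurable_continuous_onI)

lemma to_wo_image: "to_wo ` E = of_wo -` E" by (auto simp: image_iff) (metis to_wo_of_wo)

text \<open>Renaming coordinates maps boxes to boxes with the same side lengths, and boxes determine
  Lebesgue measure.\<close>

lemma distr_of_wo: "distr lborel borel (of_wo :: real^('n::finite wo) \<Rightarrow> real^'n) = lborel"
proof (rule lborel_eqI[symmetric])
  fix l u :: "real^'n" assume lu: "\<And>b. b \<in> Basis \<Longrightarrow> l \<bullet> b \<le> u \<bullet> b"
  have lu': "l $ i \<le> u $ i" for i using lu[of "axis i 1"] by (simp add: inner_axis axis_in_Basis_iff)
  have "of_wo -` box l u = box (to_wo l) (to_wo u)"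
    by (rule set_eqI) (simp add: mem_box_cart to_wo_def of_wo_def, metis Rep_wo_inverse Abs_wo_inverse UNIV_I)
  then have "emeasure (distr lborel borel of_wo) (box l u) = emeasure lborel (box (to_wo l) (to_wo u))"
    by (simp add: emeasure_distr)
  also have "\<dots> = (\<Prod>b\<in>Basis. (to_wo u - to_wo l) \<bullet> b)"
    using lu' by (intro emeasure_lborel_box) (auto simp: Basis_vec_def inner_axis to_wo_def)
  also have "(\<Prod>b\<in>Basis. (to_wo u - to_wo l) \<bullet> b) = (\<Prod>i\<in>UNIV. u $ Rep_wo i - l $ Rep_wo i)"
    unfolding Basis_vec_def by (subst prod.UNION_disjoint) (auto simp: inner_axis to_wo_def axis_eq_axis)
  also have "\<dots> = (\<Prod>i\<in>UNIV. u $ i - l $ i)"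
    using prod.reindex_bij_betw[OF bij_Rep_wo, of "\<lambda>i. u $ i - l $ i"] by simp
  also have "\<dots> = (\<Prod>b\<in>Basis. (u - l) \<bullet> b)"
    unfolding Basis_vec_def by (subst prod.UNION_disjoint) (auto simp: inner_axis axis_eq_axis)
  finally show "emeasure (distr lborel borel of_wo) (box l u) = (\<Prod>b\<in>Basis. (u - l) \<bullet> b)" .
qed simp

lemma emeasure_to_wo: "E \<in> sets borel \<Longrightarrow> emeasure lborel (to_wo ` E) = emeasure lborel E"
  unfolding to_wo_image by (subst (2) distr_of_wo[symmetric]) (simp add: emeasure_distr)

lemma nn_integral_of_wo:
  fixes f :: "real^'n::finite \<Rightarrow> ennreal"
  shows "f \<in> borel_measurable borel \<Longrightarrow> (\<integral>\<^sup>+x. f (of_wo x) \<partial>lborel) = (\<integral>\<^sup>+x. f x \<partial>lborel)"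
  by (subst (2) distr_of_wo[symmetric]) (simp add: nn_integral_distr)

lemma matrix_wo_conjugate: "linear g \<Longrightarrow> det (matrix (\<lambda>y. to_wo (g (of_wo y)))) = det (matrix g)"
proof -
  assume "linear g"
  have "of_wo (axis j 1) = axis (Rep_wo j) (1::real)" for j :: "'a wo"
    by (auto simp: of_wo_def axis_def vec_eq_iff Abs_wo_inverse Rep_wo_inverse)
  then have "matrix (\<lambda>y. to_wo (g (of_wo y))) = (\<chi> i j. matrix g $ Rep_wo i $ Rep_wo j)"
    by (simp add: matrix_def to_wo_def)
  then show ?thesis using det_reindex[OF bij_Rep_wo, of "matrix g"] by simp
qed

section \<open>Measures of differentiable images\<close>

text \<open>The basic change of variables formula concerns finite integrals, so \<open>S\<close> is
  exhausted by the sets \<open>T n\<close>, on which both the point and the Jacobian are bounded.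
  The images come out of that formula as Lebesgue measurable sets, whence \<open>lebesgue\<close> on
  the left.\<close>

lemma emeasure_differentiable_image_wo:
  fixes g :: "real^'n::{finite,wellorder} \<Rightarrow> real^'n::_"
  assumes S: "S \<in> sets borel"
    and der: "\<And>x. x \<in> S \<Longrightarrow> (g has_derivative g' x) (at x within S)"
    and inj: "inj_on g S"
    and D[measurable]: "(\<lambda>x. \<bar>det (matrix (g' x))\<bar> * indicator S x) \<in> borel_measurable borel"
  shows "emeasure lebesgue (g ` S) = (\<integral>\<^sup>+x. ennreal (\<bar>det (matrix (g' x))\<bar> * indicator S x) \<partial>lborel)"
proof -
  define d where "d x = \<bar>det (matrix (g' x))\<bar> * indicator S x" for x
  have [measurable]: "d \<in> borel_measurable borel" using D by (simp add: d_def[abs_def])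
  have d0: "0 \<le> d x" for x by (simp add: d_def)
  define T where "T n = {x \<in> S. norm x \<le> real n \<and> d x \<le> real n}" for n
  have [measurable]: "T n \<in> sets borel" for n using S unfolding T_def by measurable
  have TS: "T n \<subseteq> S" for n by (auto simp: T_def)
  have main: "g ` T n \<in> sets lebesgue \<and> emeasure lebesgue (g ` T n) = (\<integral>\<^sup>+x. ennreal (d x * indicator (T n) x) \<partial>lborel)" for n
  proof -
    have "(\<integral>\<^sup>+x. ennreal (d x * indicator (T n) x) \<partial>lborel) \<le> (\<integral>\<^sup>+x. ennreal (real n) * indicator (cball (0 :: real^'n::_) (real n)) x \<partial>lborel)"
      by (intro nn_integral_mono) (auto simp: T_def indicator_def intro!: ennreal_leI)
    also have "\<dots> < \<infinity>"
      by (subst nn_integral_cmult_indicator) (simp_all add: ennreal_mult_less_top emeasure_bounded_finite[OF bounded_cball, simplified])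
    finally have fin: "(\<integral>\<^sup>+x. ennreal (d x * indicator (T n) x) \<partial>lborel) < \<infinity>" .
    then obtain m where m: "0 \<le> m" "(\<integral>\<^sup>+x. ennreal (d x * indicator (T n) x) \<partial>lborel) = ennreal m"
      by (cases "(\<integral>\<^sup>+x. ennreal (d x * indicator (T n) x) \<partial>lborel)") auto
    have "((\<lambda>x. d x * indicator (T n) x) has_integral m) UNIV"
      by (rule nn_integral_has_integral[OF _ _ m(2,1)[THEN conjI, THEN conjunct1]]) (auto simp: d0)
    then have "((\<lambda>x. if x \<in> T n then \<bar>det (matrix (g' x))\<bar> else 0) has_integral m) UNIV"
      by (rule has_integral_eq[rotated]) (use TS in \<open>auto simp: d_def indicator_def\<close>)
    then have "((\<lambda>x. \<bar>det (matrix (g' x))\<bar>) has_integral m) (T n)" by (simp only: has_integral_restrict_UNIV)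
    moreover have "\<And>x. x \<in> T n \<Longrightarrow> (g has_derivative g' x) (at x within T n)"
      using der TS has_derivative_subset by blast
    moreover have "inj_on g (T n)" using inj TS inj_on_subset by blast
    moreover have "T n \<in> sets lebesgue" by (simp add: sets_completionI_sets)
    ultimately have "g ` T n \<in> lmeasurable \<and> measure lebesgue (g ` T n) = m"
      using has_measure_differentiable_image[of "T n" g g' m] by blast
    then show ?thesis using m by (auto simp: emeasure_eq_measure2)
  qed
  have inc: "incseq T" unfolding T_def incseq_def by (auto intro: order_trans of_nat_mono)
  have un: "(\<Union>n. T n) = S"
  proof
    show "S \<subseteq> (\<Union>n. T n)"
    proof
      fix x assume "x \<in> S"
      moreover obtain n :: nat where "max (norm x) (d x) \<le> real n" using real_arch_simple by blast
      ultimately show "x \<in> (\<Union>n. T n)" by (auto simp: T_def)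
    qed
  qed (use TS in auto)
  have "emeasure lebesgue (g ` S) = emeasure lebesgue (\<Union>n. g ` T n)" by (simp add: un[symmetric] image_UN)
  also have "\<dots> = (SUP n. emeasure lebesgue (g ` T n))"
    by (rule SUP_emeasure_incseq[symmetric]) (use main inc in \<open>auto simp: incseq_def image_mono\<close>)
  also have "\<dots> = (SUP n. \<integral>\<^sup>+x. ennreal (d x * indicator (T n) x) \<partial>lborel)" using main by simp
  also have "\<dots> = (\<integral>\<^sup>+x. (SUP n. ennreal (d x * indicator (T n) x)) \<partial>lborel)"
    by (rule nn_integral_monotone_convergence_SUP[symmetric])
       (use inc d0 in \<open>auto simp: incseq_def le_fun_def indicator_def intro!: ennreal_leI\<close>)
  also have "\<dots> = (\<integral>\<^sup>+x. ennreal (d x) \<partial>lborel)"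
  proof (rule nn_integral_cong)
    fix x
    show "(SUP n. ennreal (d x * indicator (T n) x)) = ennreal (d x)"
    proof (rule antisym)
      show "(SUP n. ennreal (d x * indicator (T n) x)) \<le> ennreal (d x)"
        using d0 by (intro SUP_least ennreal_leI) (auto simp: indicator_def)
      show "ennreal (d x) \<le> (SUP n. ennreal (d x * indicator (T n) x))"
      proof (cases "x \<in> S")
        case True
        then obtain n where "x \<in> T n" using un by auto
        then show ?thesis by (intro SUP_upper2[of n]) auto
      qed (simp add: d_def)
    qed
  qed
  finally show ?thesis by (simp add: d_def)
qed

lemma emeasure_differentiable_image:
  fixes g :: "real^'n::finite \<Rightarrow> real^'n"
  assumes S[measurable]: "S \<in> sets borel" and gS: "g ` S \<in> sets borel"
    and der: "\<And>x. x \<in> S \<Longrightarrow> (g has_derivative g' x) (at x within S)"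
    and inj: "inj_on g S"
    and D[measurable]: "(\<lambda>x. \<bar>det (matrix (g' x))\<bar> * indicator S x) \<in> borel_measurable borel"
  shows "emeasure lborel (g ` S) = (\<integral>\<^sup>+x. ennreal (\<bar>det (matrix (g' x))\<bar> * indicator S x) \<partial>lborel)"
proof -
  define k where "k y = to_wo (g (of_wo y))" for y
  define k' where "k' y = (\<lambda>v. to_wo (g' (of_wo y) (of_wo v)))" for y
  have [measurable]: "to_wo ` S \<in> sets borel" unfolding to_wo_image using measurable_sets[OF measurable_wo(2) S] by simp
  have bl: "bounded_linear to_wo" "bounded_linear of_wo"
    using linear_to_wo linear_of_wo by (auto simp: linear_conv_bounded_linear)
  have kS: "k ` to_wo ` S = to_wo ` g ` S" by (auto simp: k_def image_iff)
  have detk: "\<bar>det (matrix (k' y))\<bar> * indicator (to_wo ` S) y = \<bar>det (matrix (g' (of_wo y)))\<bar> * indicator S (of_wo y)" for y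
  proof (cases "of_wo y \<in> S")
    case True
    then have "linear (g' (of_wo y))" using der has_derivative_linear by blast
    then show ?thesis using True matrix_wo_conjugate[of "g' (of_wo y)"] by (simp add: k'_def to_wo_image indicator_def)
  qed (simp add: to_wo_image indicator_def)
  have "emeasure lebesgue (k ` to_wo ` S) = (\<integral>\<^sup>+y. ennreal (\<bar>det (matrix (k' y))\<bar> * indicator (to_wo ` S) y) \<partial>lborel)"
  proof (rule emeasure_differentiable_image_wo)
    show "(k has_derivative k' y) (at y within to_wo ` S)" if "y \<in> to_wo ` S" for y
    proof -
      have y: "of_wo y \<in> S" using that by (simp add: to_wo_image)
      have 1: "(of_wo has_derivative of_wo) (at y within to_wo ` S)"
        by (rule bounded_linear_imp_has_derivative[OF bl(2)])
      have "of_wo ` to_wo ` S = S" by (auto simp: image_iff)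
      with der[OF y] have "(g has_derivative g' (of_wo y)) (at (of_wo y) within of_wo ` to_wo ` S)" by simp
      from has_derivative_in_compose[OF 1 this]
      have "((\<lambda>x. g (of_wo x)) has_derivative (\<lambda>x. g' (of_wo y) (of_wo x))) (at y within to_wo ` S)" .
      from bounded_linear.has_derivative[OF bl(1) this] show ?thesis by (simp add: k_def[abs_def] k'_def)
    qed
    show "inj_on k (to_wo ` S)"
    proof (rule inj_onI)
      fix x y assume x: "x \<in> to_wo ` S" "y \<in> to_wo ` S" and "k x = k y"
      then have "g (of_wo x) = g (of_wo y)" by (metis k_def of_wo_to_wo)
      then have "of_wo x = of_wo y" using x inj by (auto simp: to_wo_image dest: inj_onD)
      then show "x = y" by (metis to_wo_of_wo)
    qed
    show "(\<lambda>y. \<bar>det (matrix (k' y))\<bar> * indicator (to_wo ` S) y) \<in> borel_measurable borel"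
      unfolding detk using measurable_compose[OF measurable_wo(2) D] .
  qed measurable
  also have "\<dots> = (\<integral>\<^sup>+x. ennreal (\<bar>det (matrix (g' x))\<bar> * indicator S x) \<partial>lborel)"
    unfolding detk by (rule nn_integral_of_wo) measurable
  also have "emeasure lebesgue (k ` to_wo ` S) = emeasure lborel (g ` S)"
    unfolding kS using gS measurable_sets[OF measurable_wo(2) gS]
    by (subst emeasure_to_wo[OF gS, symmetric]) (simp add: to_wo_image)
  finally show ?thesis .
qed

lemma emeasure_linear_image:
  fixes A :: "real^'n::finite \<Rightarrow> real^'n"
  assumes A: "linear A" and det: "det (matrix A) \<noteq> 0" and E[measurable]: "E \<in> sets borel"
  shows "emeasure lborel (A ` E) = ennreal \<bar>det (matrix A)\<bar> * emeasure lborel E"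
proof -
  have "inj A" using A det by (simp add: det_nz_iff_inj)
  then obtain B where B: "linear B" "B \<circ> A = id" using linear_injective_left_inverse[OF A] by blast
  then have "A \<circ> B = id" using linear_inverse_left[OF A B(1)] by simp
  have "A ` E = B -` E" using B(2) \<open>A \<circ> B = id\<close> by (auto simp: fun_eq_iff image_iff) metis
  moreover have "B \<in> borel_measurable borel"
    using B(1) by (intro borel_measurable_continuous_onI linear_continuous_on) (simp add: linear_conv_bounded_linear)
  ultimately have AE: "A ` E \<in> sets borel" using measurable_sets[of B borel borel E] E by simp
  have "emeasure lborel (A ` E) = (\<integral>\<^sup>+x. ennreal (\<bar>det (matrix A)\<bar> * indicator E x) \<partial>lborel)"
    using A \<open>inj A\<close> E
    by (intro emeasure_differentiable_image[OF E AE, where g'="\<lambda>_. A"] bounded_linear_imp_has_derivative)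
       (auto simp: linear_conv_bounded_linear intro: inj_on_subset)
  also have "\<dots> = (\<integral>\<^sup>+x. ennreal \<bar>det (matrix A)\<bar> * indicator E x \<partial>lborel)"
    by (intro nn_integral_cong) (auto simp: indicator_def)
  also have "\<dots> = ennreal \<bar>det (matrix A)\<bar> * emeasure lborel E"
    by (rule nn_integral_cmult_indicator) simp
  finally show ?thesis .
qed

lemma nn_integral_linear_substitution:
  fixes A :: "real^'n::finite \<Rightarrow> real^'n"
  assumes A: "linear A" and det: "det (matrix A) \<noteq> 0" and f[measurable]: "f \<in> borel_measurable borel"
  shows "(\<integral>\<^sup>+x. f x \<partial>lborel) = ennreal \<bar>det (matrix A)\<bar> * (\<integral>\<^sup>+x. f (A x) \<partial>lborel)"
proof -
  have Am[measurable]: "A \<in> borel_measurable borel"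
    using A by (intro borel_measurable_continuous_onI linear_continuous_on) (simp add: linear_conv_bounded_linear)
  have bij: "bij A" using A det by (metis det_nz_iff_inj linear_injective_imp_surjective bij_def)
  have "lborel = density (distr lborel borel A) (\<lambda>_. ennreal \<bar>det (matrix A)\<bar>)"
  proof (rule measure_eqI)
    fix E :: "(real^'n) set" assume "E \<in> sets lborel"
    then have E[measurable]: "E \<in> sets borel" by simp
    have "A -` E \<in> sets borel" using measurable_sets[OF Am E] by simp
    have "emeasure lborel E = emeasure lborel (A ` (A -` E))"
      using bij by (simp add: bij_is_surj surj_image_vimage_eq)
    also have "\<dots> = ennreal \<bar>det (matrix A)\<bar> * emeasure lborel (A -` E)"
      by (rule emeasure_linear_image[OF A det]) fact
    also have "\<dots> = emeasure (density (distr lborel borel A) (\<lambda>_. ennreal \<bar>det (matrix A)\<bar>)) E"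
      by (simp add: emeasure_density nn_integral_cmult_indicator emeasure_distr)
    finally show "emeasure lborel E = emeasure (density (distr lborel borel A) (\<lambda>_. ennreal \<bar>det (matrix A)\<bar>)) E" .
  qed simp
  then have "(\<integral>\<^sup>+x. f x \<partial>lborel) = (\<integral>\<^sup>+x. f x \<partial>density (distr lborel borel A) (\<lambda>_. ennreal \<bar>det (matrix A)\<bar>))"
    by simp
  also have "\<dots> = ennreal \<bar>det (matrix A)\<bar> * (\<integral>\<^sup>+x. f (A x) \<partial>lborel)"
    by (simp add: nn_integral_density nn_integral_distr nn_integral_cmult)
  finally show ?thesis .
qed

section \<open>Parseval frames along a submersion\<close>

lemma emeasure_unit_cube: "emeasure lborel (cbox 0 1 :: (real^'n::finite) set) = 1"
proof -
  have "emeasure lborel (cbox 0 1 :: (real^'n) set) = (\<Prod>b\<in>Basis. ((1 :: real^'n) - 0) \<bullet> b)"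
    by (rule emeasure_lborel_cbox) (auto simp: Basis_vec_def inner_axis)
  also have "(\<Prod>b\<in>Basis. ((1 :: real^'n) - 0) \<bullet> b) = 1"
    by (intro prod.neutral) (auto simp: Basis_vec_def inner_axis)
  finally show ?thesis by simp
qed

text \<open>Substituting \<open>y = g s\<close> turns the Fourier integral along \<open>g\<close>
  into an ordinary one, for \<open>u / \<bar>det\<bar>\<close> transported by the inverse of
  \<open>g\<close>. In the squared norm the Jacobian appears squared in the denominator and once
  from the substitution, so one factor remains. Invariance of domain makes the image of
  \<open>V\<close> open with continuous inverse.\<close>

lemma plancherel_along_injection:
  fixes g :: "real^'n::finite \<Rightarrow> real^'n" and u :: "real^'n \<Rightarrow> complex"
  assumes V: "open V" and g: "continuous_on UNIV g"
    and der: "\<And>x. x \<in> V \<Longrightarrow> (g has_derivative g' x) (at x)" and inj: "inj_on g V"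
    and det: "\<And>x. x \<in> V \<Longrightarrow> det (matrix (g' x)) \<noteq> 0"
    and D[measurable]: "(\<lambda>x. \<bar>det (matrix (g' x))\<bar> * indicator V x) \<in> borel_measurable borel"
    and u: "integrable lborel u" and u0: "\<And>x. x \<notin> V \<Longrightarrow> u x = 0"
  shows "(\<integral>\<^sup>+a. ennreal ((cmod (\<integral>s. u s * cis (2 * pi * (g s \<bullet> a)) \<partial>lborel))\<^sup>2) \<partial>lborel)
    = (\<integral>\<^sup>+s. ennreal ((cmod (u s))\<^sup>2 / \<bar>det (matrix (g' s))\<bar>) \<partial>lborel)"
proof -
  define d where "d x = \<bar>det (matrix (g' x))\<bar> * indicator V x" for x
  have [measurable]: "d \<in> borel_measurable borel" using D by (simp add: d_def[abs_def])
  have d0: "0 \<le> d x" for x by (simp add: d_def)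
  have dpos: "0 < d x" if "x \<in> V" for x using det[OF that] that by (simp add: d_def)
  have [measurable]: "u \<in> borel_measurable borel" using u by auto
  have [measurable]: "g \<in> borel_measurable borel" using g by (rule borel_measurable_continuous_onI)
  have [measurable]: "V \<in> sets borel" using V by simp
  have gV: "continuous_on V g" using g continuous_on_subset by blast
  obtain k where k: "homeomorphism V (g ` V) g k"
    by (rule invariance_of_domain_homeomorphism[OF V gV _ inj]) simp
  have kg: "k (g x) = x" if "x \<in> V" for x using k that by (auto simp: homeomorphism_def)
  have openW: "open (g ` V)" by (rule invariance_of_domain_gen[OF V gV inj]) simp
  then have [measurable]: "g ` V \<in> sets borel" by simp
  \<comment> \<open>The inverse of \<open>g\<close>, extended by \<open>0\<close> off the image so
    as to be a Borel map on the whole space.\<close>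
  define k' where "k' y = indicator (g ` V) y *\<^sub>R k y" for y
  have [measurable]: "k' \<in> borel_measurable borel"
    unfolding k'_def[abs_def] using k by (intro borel_measurable_continuous_on_indicator) (auto simp: homeomorphism_def)
  have k'g: "k' (g x) = x" if "x \<in> V" for x using kg[OF that] that by (simp add: k'_def)
  define v where "v y = indicator (g ` V) y *\<^sub>R (u (k' y) / complex_of_real (d (k' y)))" for y
  have [measurable]: "v \<in> borel_measurable borel" unfolding v_def[abs_def] by measurable
  have vg: "v (g x) = u x / complex_of_real (d x)" if "x \<in> V" for x using k'g[OF that] that by (simp add: v_def)
  have dv: "complex_of_real (d x) * v (g x) = u x" for x
  proof (cases "x \<in> V")
    case True then show ?thesis using vg[OF True] dpos[OF True] by simp
  next
    case False then show ?thesis using u0 by (simp add: d_def)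
  qed
  define M where "M = density lborel (\<lambda>x. ennreal (d x))"
  have [simp]: "sets M = sets borel" "space M = UNIV" by (simp_all add: M_def)
  \<comment> \<open>Weighting by the Jacobian and pushing forward gives Lebesgue measure on the
    image; this one identity transports both the coefficients and the norm.\<close>
  have distr: "distr M borel g = density lborel (indicator (g ` V))"
  proof (rule measure_eqI)
    fix E assume "E \<in> sets (distr M borel g)"
    then have [measurable]: "E \<in> sets borel" by simp
    have gE: "g -` E \<in> sets borel" using measurable_sets[of g borel borel E] by simp
    have im: "g ` (V \<inter> g -` E) = g ` V \<inter> E" by auto
    have "emeasure (distr M borel g) E = emeasure M (g -` E)"
      by (subst emeasure_distr) (auto simp: measurable_cong_sets[OF \<open>sets M = sets borel\<close> refl])
    also have "\<dots> = (\<integral>\<^sup>+x. ennreal (\<bar>det (matrix (g' x))\<bar> * indicator (V \<inter> g -` E) x) \<partial>lborel)"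
    proof -
      have "emeasure M (g -` E) = (\<integral>\<^sup>+x. ennreal (d x) * indicator (g -` E) x \<partial>lborel)"
        unfolding M_def by (rule emeasure_density) (use gE in auto)
      also have "\<dots> = (\<integral>\<^sup>+x. ennreal (\<bar>det (matrix (g' x))\<bar> * indicator (V \<inter> g -` E) x) \<partial>lborel)"
        by (intro nn_integral_cong) (auto simp: d_def indicator_def)
      finally show ?thesis .
    qed
    also have "\<dots> = emeasure lborel (g ` (V \<inter> g -` E))"
    proof (rule emeasure_differentiable_image[symmetric])
      show "V \<inter> g -` E \<in> sets borel" using gE by auto
      show "g ` (V \<inter> g -` E) \<in> sets borel" unfolding im by auto
      show "(g has_derivative g' x) (at x within V \<inter> g -` E)" if "x \<in> V \<inter> g -` E" for x
        using der that has_derivative_at_withinI by blast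
      show "inj_on g (V \<inter> g -` E)" using inj by (rule inj_on_subset) auto
      have "(\<lambda>x. (\<bar>det (matrix (g' x))\<bar> * indicator V x) * indicator (g -` E) x) \<in> borel_measurable borel"
        by (rule borel_measurable_times[OF D]) (use gE in auto)
      moreover have "(\<bar>det (matrix (g' x))\<bar> * indicator V x) * indicator (g -` E) x = \<bar>det (matrix (g' x))\<bar> * indicator (V \<inter> g -` E) x" for x
        by (auto simp: indicator_def)
      ultimately show "(\<lambda>x. \<bar>det (matrix (g' x))\<bar> * indicator (V \<inter> g -` E) x) \<in> borel_measurable borel" by simp
    qed
    also have "\<dots> = emeasure (density lborel (indicator (g ` V))) E"
      unfolding im by (subst emeasure_density) (auto simp: nn_integral_indicator[symmetric] indicator_inter_arith[symmetric] simp del: nn_integral_indicator intro!: nn_integral_cong split: split_indicator)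
    finally show "emeasure (distr M borel g) E = emeasure (density lborel (indicator (g ` V))) E" .
  qed simp
  have gM[measurable]: "g \<in> measurable M borel" by (auto simp: measurable_cong_sets[OF \<open>sets M = sets borel\<close> refl])
  have nn: "(\<integral>\<^sup>+y. F y * indicator (g ` V) y \<partial>lborel) = (\<integral>\<^sup>+x. ennreal (d x) * F (g x) \<partial>lborel)"
    if [measurable]: "F \<in> borel_measurable borel" for F
  proof -
    have "(\<integral>\<^sup>+y. F y * indicator (g ` V) y \<partial>lborel) = (\<integral>\<^sup>+y. F y \<partial>density lborel (indicator (g ` V)))"
      by (subst nn_integral_density) (auto simp: mult.commute)
    also have "\<dots> = (\<integral>\<^sup>+x. F (g x) \<partial>M)" unfolding distr[symmetric] by (rule nn_integral_distr[OF gM]) auto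
    also have "\<dots> = (\<integral>\<^sup>+x. ennreal (d x) * F (g x) \<partial>lborel)" unfolding M_def by (rule nn_integral_density) auto
    finally show ?thesis .
  qed
  have vW: "v y = 0" if "y \<notin> g ` V" for y using that by (simp add: v_def)
  have "(\<integral>\<^sup>+y. ennreal (cmod (v y)) \<partial>lborel) = (\<integral>\<^sup>+y. ennreal (cmod (v y)) * indicator (g ` V) y \<partial>lborel)"
    using vW by (intro nn_integral_cong) (auto simp: indicator_def)
  also have "\<dots> = (\<integral>\<^sup>+x. ennreal (d x) * ennreal (cmod (v (g x))) \<partial>lborel)" by (rule nn) measurable
  also have "\<dots> = (\<integral>\<^sup>+x. ennreal (cmod (u x)) \<partial>lborel)"
    unfolding dv[symmetric] by (intro nn_integral_cong) (simp add: norm_mult d0 ennreal_mult)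
  also have "\<dots> < \<infinity>" using u by (simp add: integrable_iff_bounded)
  finally have v: "integrable lborel v" by (simp add: integrable_iff_bounded)
  have coef: "(\<integral>s. u s * cis (2 * pi * (g s \<bullet> a)) \<partial>lborel) = (\<integral>y. v y * cis (2 * pi * (y \<bullet> a)) \<partial>lborel)" for a
  proof -
    have "(\<integral>s. u s * cis (2 * pi * (g s \<bullet> a)) \<partial>lborel) = (\<integral>s. d s *\<^sub>R (v (g s) * cis (2 * pi * (g s \<bullet> a))) \<partial>lborel)"
      by (subst dv[symmetric]) (simp add: scaleR_conv_of_real mult.assoc)
    also have "\<dots> = (\<integral>s. v (g s) * cis (2 * pi * (g s \<bullet> a)) \<partial>M)"
      unfolding M_def by (rule integral_density[symmetric]) (auto simp: d0)
    also have "\<dots> = (\<integral>y. v y * cis (2 * pi * (y \<bullet> a)) \<partial>distr M borel g)"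
      by (rule integral_distr[OF gM, symmetric]) measurable
    also have "\<dots> = (\<integral>y. indicator (g ` V) y *\<^sub>R (v y * cis (2 * pi * (y \<bullet> a))) \<partial>lborel)"
    proof -
      have "density lborel (indicator (g ` V)) = density lborel (\<lambda>y. ennreal (indicator (g ` V) y))"
        by (intro arg_cong[where f="density lborel"]) (auto simp: fun_eq_iff indicator_def)
      then show ?thesis unfolding distr by (simp add: integral_density)
    qed
    also have "\<dots> = (\<integral>y. v y * cis (2 * pi * (y \<bullet> a)) \<partial>lborel)"
      using vW by (intro Bochner_Integration.integral_cong) (auto simp: indicator_def)
    finally show ?thesis .
  qed
  have "(\<integral>\<^sup>+y. ennreal ((cmod (v y))\<^sup>2) \<partial>lborel) = (\<integral>\<^sup>+y. ennreal ((cmod (v y))\<^sup>2) * indicator (g ` V) y \<partial>lborel)"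
    using vW by (intro nn_integral_cong) (auto simp: indicator_def)
  also have "\<dots> = (\<integral>\<^sup>+x. ennreal (d x) * ennreal ((cmod (v (g x)))\<^sup>2) \<partial>lborel)" by (rule nn) measurable
  also have "\<dots> = (\<integral>\<^sup>+s. ennreal ((cmod (u s))\<^sup>2 / \<bar>det (matrix (g' s))\<bar>) \<partial>lborel)"
  proof (rule nn_integral_cong)
    fix x
    show "ennreal (d x) * ennreal ((cmod (v (g x)))\<^sup>2) = ennreal ((cmod (u x))\<^sup>2 / \<bar>det (matrix (g' x))\<bar>)"
    proof (cases "x \<in> V")
      case True
      have cm: "cmod (v (g x)) = cmod (u x) / d x"
        unfolding vg[OF True] norm_divide using d0 by simp
      have "d x * (cmod (v (g x)))\<^sup>2 = (cmod (u x))\<^sup>2 / d x"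
        unfolding cm using dpos[OF True] by (simp add: power2_eq_square)
      moreover have "d x = \<bar>det (matrix (g' x))\<bar>" using True by (simp add: d_def)
      ultimately have "d x * (cmod (v (g x)))\<^sup>2 = (cmod (u x))\<^sup>2 / \<bar>det (matrix (g' x))\<bar>" by simp
      then show ?thesis using d0[of x] by (simp add: ennreal_mult[symmetric])
    next
      case False
      then show ?thesis using u0 by (simp add: d_def)
    qed
  qed
  finally show ?thesis unfolding coef plancherel_L1[OF v] .
qed

section \<open>Slices through a patch of regular points\<close>

text \<open>\<open>S\<close> approximately inverts the derivative on the right throughout the ball,
  not only at its centre. Hence for every \<open>x\<close> the slice
  \<open>s \<mapsto> x + S s\<close>, always in the same directions, is mapped injectively by
  \<open>\<Phi>\<close> as long as it stays in the ball.\<close>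

locale submersion_patch =
  fixes \<Phi> :: "real^'d::finite \<Rightarrow> real^'n::finite" and \<Phi>' :: "real^'d \<Rightarrow> ((real^'d) \<Rightarrow>\<^sub>L (real^'n))"
    and S :: "(real^'n) \<Rightarrow>\<^sub>L (real^'d)" and x0 :: "real^'d" and r :: real
  assumes deriv: "\<And>x. (\<Phi> has_derivative blinfun_apply (\<Phi>' x)) (at x)"
    and cont': "continuous_on UNIV \<Phi>'"
    and near_id: "\<And>x. x \<in> ball x0 r \<Longrightarrow> norm ((\<Phi>' x o\<^sub>L S) - id_blinfun) \<le> 1/2"
begin

text \<open>The Jacobian of the slice map \<open>s \<mapsto> \<Phi> (x + S s)\<close> at
  \<open>s = 0\<close>.\<close>

definition "jac x = \<bar>det (matrix (\<lambda>v. blinfun_apply (\<Phi>' x) (blinfun_apply S v)))\<bar>"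

lemma contPhi: "continuous_on UNIV \<Phi>"
  by (metis deriv has_derivative_continuous continuous_at_imp_continuous_on)

lemma measPhi[measurable]: "\<Phi> \<in> borel_measurable borel"
  using contPhi by (rule borel_measurable_continuous_onI)

lemma contS: "continuous_on UNIV (blinfun_apply S)"
  by (intro continuous_intros)

lemma measS[measurable]: "blinfun_apply S \<in> borel_measurable borel"
  using contS by (rule borel_measurable_continuous_onI)

lemma jac_cont: "continuous_on UNIV jac"
  unfolding jac_def[abs_def] det_def matrix_def
  by (simp, intro continuous_intros cont')

lemma jac_meas[measurable]: "jac \<in> borel_measurable borel"
  using jac_cont by (rule borel_measurable_continuous_onI)

lemma near_id_apply: "x \<in> ball x0 r \<Longrightarrow> norm (\<Phi>' x (S v) - v) \<le> norm v / 2"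
proof -
  assume "x \<in> ball x0 r"
  then have "norm (((\<Phi>' x o\<^sub>L S) - id_blinfun) v) \<le> 1/2 * norm v"
    using norm_blinfun[of "(\<Phi>' x o\<^sub>L S) - id_blinfun" v] near_id[of x] by (meson mult_right_mono norm_ge_zero order_trans)
  then show ?thesis by (simp add: minus_blinfun.rep_eq)
qed

lemma linear_comp: "linear (\<lambda>v. \<Phi>' x (S v))"
  by (intro linearI) (simp_all add: blinfun.add_right blinfun.scaleR_right)

lemma jac_pos: "x \<in> ball x0 r \<Longrightarrow> 0 < jac x"
proof -
  assume x: "x \<in> ball x0 r"
  have "inj (\<lambda>v. \<Phi>' x (S v))"
  proof (subst linear_injective_0[OF linear_comp], intro allI impI)
    fix v assume "\<Phi>' x (S v) = 0"
    then show "v = 0" using near_id_apply[OF x, of v] by simp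
  qed
  then have "det (matrix (\<lambda>v. \<Phi>' x (S v))) \<noteq> 0" using det_nz_iff_inj[OF linear_comp] by blast
  then show ?thesis by (simp add: jac_def)
qed

lemma jac_nonneg: "0 \<le> jac x" by (simp add: jac_def)

definition "slice x = {s. x + S s \<in> ball x0 r}"

lemma slice_eq: "slice x = (\<lambda>s. x + S s) -` ball x0 r" by (auto simp: slice_def)

lemma open_slice: "open (slice x)"
  unfolding slice_eq by (rule open_vimage) (auto intro!: continuous_intros)

lemma convex_slice: "convex (slice x)"
proof (rule convexI)
  fix s t :: "real^'n" and u v :: real
  assume st: "s \<in> slice x" "t \<in> slice x" and uv: "0 \<le> u" "0 \<le> v" "u + v = 1"
  have "u *\<^sub>R (x + S s) + v *\<^sub>R (x + S t) \<in> ball x0 r"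
    using st uv convexD[OF convex_ball] by (auto simp: slice_def)
  moreover have "u *\<^sub>R (x + S s) + v *\<^sub>R (x + S t) = x + S (u *\<^sub>R s + v *\<^sub>R t)"
    using uv by (simp add: blinfun.add_right blinfun.scaleR_right algebra_simps) (metis scaleR_add_left scaleR_one)
  ultimately show "u *\<^sub>R s + v *\<^sub>R t \<in> slice x" by (simp add: slice_def)
qed

lemma slice_deriv: "((\<lambda>s. \<Phi> (x + S s)) has_derivative (\<lambda>v. \<Phi>' (x + S s) (S v))) (at s)"
proof -
  have "((\<lambda>s. x + S s) has_derivative (\<lambda>v. S v)) (at s)"
    by (auto intro!: derivative_eq_intros bounded_linear_imp_has_derivative blinfun.bounded_linear_right)
  from has_derivative_compose[OF this deriv] show ?thesis .
qed

text \<open>On the convex slice \<open>s \<mapsto> \<Phi> (x + S s) - s\<close> is Lipschitz with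
  constant \<open>1/2\<close>, so equal values of \<open>\<Phi>\<close> force equal
  parameters.\<close>

lemma slice_inj: "inj_on (\<lambda>s. \<Phi> (x + S s)) (slice x)"
proof (rule inj_onI)
  fix s t assume st: "s \<in> slice x" "t \<in> slice x" and eq: "\<Phi> (x + S s) = \<Phi> (x + S t)"
  have "norm ((\<Phi> (x + S s) - s) - (\<Phi> (x + S t) - t)) \<le> 1/2 * norm (s - t)"
  proof (rule differentiable_bound[OF convex_slice _ _ st])
    show "((\<lambda>s. \<Phi> (x + S s) - s) has_derivative (\<lambda>v. \<Phi>' (x + S s) (S v) - v)) (at s within slice x)" if "s \<in> slice x" for s
      by (rule has_derivative_diff[OF has_derivative_at_withinI[OF slice_deriv] has_derivative_ident])
    show "onorm (\<lambda>v. \<Phi>' (x + S s) (S v) - v) \<le> 1/2" if "s \<in> slice x" for s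
      using near_id_apply[of "x + S s"] that by (intro onorm_bound) (auto simp: slice_def)
  qed
  with eq have "norm (s - t) \<le> 1/2 * norm (s - t)" by (simp add: norm_minus_commute)
  then show "s = t" by simp
qed

lemma plancherel_slice:
  assumes u: "integrable lborel u" and u0: "\<And>s. x + S s \<notin> ball x0 r \<Longrightarrow> u s = 0"
  shows "(\<integral>\<^sup>+a. ennreal ((cmod (\<integral>s. u s * cis (2 * pi * (\<Phi> (x + S s) \<bullet> a)) \<partial>lborel))\<^sup>2) \<partial>lborel)
    = (\<integral>\<^sup>+s. ennreal ((cmod (u s))\<^sup>2 / jac (x + S s)) \<partial>lborel)"
  unfolding jac_def
proof (rule plancherel_along_injection[OF open_slice[of x] _ slice_deriv slice_inj _ _ u])
  show "continuous_on UNIV (\<lambda>s. \<Phi> (x + S s))"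
    by (rule continuous_on_compose2[OF contPhi]) (auto intro!: continuous_intros)
  show "det (matrix (\<lambda>v. \<Phi>' (x + S s) (S v))) \<noteq> 0" if "s \<in> slice x" for s
    using jac_pos[of "x + S s"] that by (auto simp: jac_def slice_def)
  have [measurable]: "slice x \<in> sets borel" using open_slice by simp
  have "(\<lambda>s. jac (x + S s) * indicator (slice x) s) \<in> borel_measurable borel" by measurable
  then show "(\<lambda>s. \<bar>det (matrix (\<lambda>v. \<Phi>' (x + S s) (S v)))\<bar> * indicator (slice x) s) \<in> borel_measurable borel"
    by (simp add: jac_def)
  show "u s = 0" if "s \<notin> slice x" for s using u0 that by (simp add: slice_def)
qed

abbreviation "unit_cube \<equiv> (cbox 0 1 :: (real^'n) set)"

text \<open>Each shift by \<open>S s\<close> preserves Lebesgue measure and the cube of parameters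
  has measure \<open>1\<close>, so every point counts once although slices through different
  \<open>x\<close> overlap. This takes the place of coordinates along and across the fibres.\<close>

lemma average_over_slices:
  fixes f :: "real^'d \<Rightarrow> ennreal"
  assumes [measurable]: "f \<in> borel_measurable borel"
  shows "(\<integral>\<^sup>+x. (\<integral>\<^sup>+s. f (x + S s) * indicator unit_cube s \<partial>lborel) \<partial>lborel) = (\<integral>\<^sup>+x. f x \<partial>lborel)"
proof -
  have "(\<integral>\<^sup>+x. (\<integral>\<^sup>+s. f (x + S s) * indicator unit_cube s \<partial>lborel) \<partial>lborel) = (\<integral>\<^sup>+s. (\<integral>\<^sup>+x. f (x + S s) * indicator unit_cube s \<partial>lborel) \<partial>lborel)"
    by (rule lborel_pair.Fubini') measurable
  also have "\<dots> = (\<integral>\<^sup>+s. (\<integral>\<^sup>+x. f x \<partial>lborel) * indicator unit_cube s \<partial>lborel)"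
    by (intro nn_integral_cong) (simp add: nn_integral_multc lborel_nn_integral_translation)
  also have "\<dots> = (\<integral>\<^sup>+x. f x \<partial>lborel)"
    by (subst nn_integral_cmult_indicator) (simp_all add: emeasure_unit_cube)
  finally show ?thesis .
qed

text \<open>On each slice the change of variables equates the integral of the Jacobian over the
  preimage with the measure of a subset of \<open>N\<close>. The Jacobian is positive, so almost no
  parameter lies in the preimage; averaging over the slices does the rest.\<close>

lemma vimage_null:
  assumes N: "N \<in> null_sets lborel"
  shows "ball x0 r \<inter> \<Phi> -` N \<in> null_sets lborel"
proof -
  have Nb[measurable]: "N \<in> sets borel" using N by auto
  have "\<Phi> -` N \<in> sets borel" using measurable_sets[OF measPhi Nb] by simp
  then have W[measurable]: "ball x0 r \<inter> \<Phi> -` N \<in> sets borel" by auto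
  have "(\<integral>\<^sup>+s. indicator (ball x0 r \<inter> \<Phi> -` N) (x + S s) * indicator unit_cube s \<partial>lborel) = 0" for x
  proof -
    let ?g = "\<lambda>s. \<Phi> (x + S s)"
    define T where "T = {s. x + S s \<in> ball x0 r \<inter> \<Phi> -` N}"
    have [measurable]: "T \<in> sets borel"
    proof -
      have "(\<lambda>s. x + S s) \<in> borel_measurable borel" by measurable
      from measurable_sets[OF this W] show ?thesis by (simp add: T_def vimage_def)
    qed
    have Ts: "T \<subseteq> slice x" by (auto simp: T_def slice_def)
    have "?g ` T \<subseteq> N" by (auto simp: T_def)
    have "open (?g ` slice x)"
    proof (rule invariance_of_domain_gen[OF open_slice _ slice_inj])
      show "continuous_on (slice x) ?g"
        by (rule continuous_on_compose2[OF contPhi]) (auto intro!: continuous_intros)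
    qed simp
    moreover have "?g ` T = ?g ` slice x \<inter> N" by (auto simp: T_def slice_def image_iff)
    ultimately have gT: "?g ` T \<in> sets borel" by auto
    have meas: "(\<lambda>s. jac (x + S s) * indicator T s) \<in> borel_measurable borel" by measurable
    have "emeasure lborel (?g ` T) = (\<integral>\<^sup>+s. ennreal (\<bar>det (matrix (\<lambda>v. \<Phi>' (x + S s) (S v)))\<bar> * indicator T s) \<partial>lborel)"
    proof (rule emeasure_differentiable_image[OF \<open>T \<in> sets borel\<close> gT])
      show "(?g has_derivative (\<lambda>v. \<Phi>' (x + S s) (S v))) (at s within T)" for s
        by (rule has_derivative_at_withinI[OF slice_deriv])
      show "inj_on ?g T" using slice_inj Ts by (rule inj_on_subset)
      show "(\<lambda>s. \<bar>det (matrix (\<lambda>v. \<Phi>' (x + S s) (S v)))\<bar> * indicator T s) \<in> borel_measurable borel"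
        using meas by (simp add: jac_def)
    qed
    moreover have "emeasure lborel (?g ` T) = 0"
      using N \<open>?g ` T \<subseteq> N\<close> emeasure_mono[of "?g ` T" N lborel] by (auto simp: null_sets_def)
    ultimately have "(\<integral>\<^sup>+s. ennreal (jac (x + S s) * indicator T s) \<partial>lborel) = 0" by (simp add: jac_def)
    then have "AE s in lborel. ennreal (jac (x + S s) * indicator T s) = 0"
      using meas by (subst (asm) nn_integral_0_iff_AE) auto
    then have "AE s in lborel. indicator (ball x0 r \<inter> \<Phi> -` N) (x + S s) * indicator unit_cube s = (0::ennreal)"
    proof eventually_elim
      fix s assume s: "ennreal (jac (x + S s) * indicator T s) = 0"
      then have "s \<notin> T" using jac_pos[of "x + S s"] by (auto simp: T_def)
      then show "indicator (ball x0 r \<inter> \<Phi> -` N) (x + S s) * indicator unit_cube s = (0::ennreal)"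
        by (auto simp: T_def)
    qed
    then show ?thesis by (subst nn_integral_0_iff_AE) auto
  qed
  then have "(\<integral>\<^sup>+x. indicator (ball x0 r \<inter> \<Phi> -` N) x \<partial>lborel) = 0"
    by (subst average_over_slices[symmetric]) auto
  then show ?thesis using W by (auto simp: null_sets_def)
qed

text \<open>With \<open>c\<^sub>k\<close> a Parseval family on a bounded region, averaging along the slices \<open>x + S s\<close> turns the
  coefficient of \<open>F\<close> into the \<open>c\<^sub>k\<close>-coefficient of a function of \<open>x\<close> that is, for fixed \<open>x\<close>, a Fourier
  integral along the local diffeomorphism \<open>s \<mapsto> \<Phi> (x + S s)\<close>. No disintegration along the fibres
  of \<open>\<Phi>\<close> is needed.\<close>

lemma local_parseval_frame:
  assumes P[measurable]: "P \<in> sets borel" and PB: "P \<subseteq> ball x0 r"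
  shows "\<exists>e :: nat \<Rightarrow> real^'d \<Rightarrow> real. (\<forall>k. e k \<in> borel_measurable borel) \<and> (\<forall>k. \<exists>C. \<forall>x. \<bar>e k x\<bar> \<le> C) \<and>
    (\<forall>k x. x \<notin> P \<longrightarrow> e k x = 0) \<and>
    (\<forall>F. F \<in> borel_measurable borel \<longrightarrow> integrable lborel (\<lambda>x. (cmod (F x))\<^sup>2) \<longrightarrow>
      (\<Sum>k. \<integral>\<^sup>+a. ennreal ((cmod (\<integral>x. F x * complex_of_real (e k x) * cis (2 * pi * (\<Phi> x \<bullet> a)) \<partial>lborel))\<^sup>2) \<partial>lborel)
       = (\<integral>\<^sup>+x. ennreal ((cmod (F x))\<^sup>2) * indicator P x \<partial>lborel))"
proof -
  let ?Q = unit_cube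
  obtain K where K: "\<And>s. s \<in> ?Q \<Longrightarrow> norm (S s) \<le> K"
  proof -
    have "bounded (blinfun_apply S ` ?Q)"
      by (intro bounded_linear_image bounded_cbox blinfun.bounded_linear_right)
    then show ?thesis using that unfolding bounded_iff by blast
  qed
  \<comment> \<open>Every \<open>x\<close> whose slice over the unit cube meets the patch lies in
    this enlarged ball, so the functions \<open>q a\<close> below vanish off
    \<open>R\<close>.\<close>
  define R where "R = cball x0 (r + K)"
  have R: "R \<in> sets borel" "emeasure lborel R < \<infinity>"
    unfolding R_def by (auto intro: emeasure_bounded_finite[simplified])
  have inR: "x \<in> R" if "x + S s \<in> ball x0 r" "s \<in> ?Q" for x s
  proof -
    have "dist x0 x \<le> dist x0 (x + S s) + norm (S s)"
      using dist_triangle[of x0 x "x + S s"] by (simp add: dist_norm)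
    with K[OF that(2)] that(1) show ?thesis by (simp add: R_def)
  qed
  have "\<exists>c :: nat \<Rightarrow> real^'d \<Rightarrow> real. (\<forall>k. c k \<in> borel_measurable borel) \<and> (\<forall>k. \<exists>B. \<forall>x. \<bar>c k x\<bar> \<le> B) \<and>
     (\<forall>q :: real^'d \<Rightarrow> complex. q \<in> borel_measurable borel \<longrightarrow> integrable lborel (\<lambda>x. (cmod (q x))\<^sup>2) \<longrightarrow>
       (\<forall>x. x \<notin> R \<longrightarrow> q x = 0) \<longrightarrow>
       (\<Sum>k. ennreal ((cmod (\<integral>x. q x * complex_of_real (c k x) \<partial>lborel))\<^sup>2)) = (\<integral>\<^sup>+x. ennreal ((cmod (q x))\<^sup>2) \<partial>lborel))"
    by (rule parseval_family_exists[OF R]) blast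
  then obtain c :: "nat \<Rightarrow> real^'d \<Rightarrow> real" where
    c[measurable]: "\<And>k. c k \<in> borel_measurable borel" and cb: "\<And>k. \<exists>B. \<forall>x. \<bar>c k x\<bar> \<le> B"
    and cP: "\<And>q :: real^'d \<Rightarrow> complex. q \<in> borel_measurable borel \<Longrightarrow> integrable lborel (\<lambda>x. (cmod (q x))\<^sup>2) \<Longrightarrow>
       (\<And>x. x \<notin> R \<Longrightarrow> q x = 0) \<Longrightarrow>
       (\<Sum>k. ennreal ((cmod (\<integral>x. q x * c k x \<partial>lborel))\<^sup>2)) = (\<integral>\<^sup>+x. ennreal ((cmod (q x))\<^sup>2) \<partial>lborel)"
    by blast
  obtain B where B: "\<And>k x. \<bar>c k x\<bar> \<le> B k" using cb by metis
  have B0: "0 \<le> B k" for k using B[of k 0] by linarith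
  obtain J where J: "\<And>x. x \<in> P \<Longrightarrow> sqrt (jac x) \<le> J"
  proof -
    have "compact ((\<lambda>x. sqrt (jac x)) ` cball x0 r)"
      by (intro compact_continuous_image continuous_on_real_sqrt continuous_on_subset[OF jac_cont]) auto
    then have "bounded ((\<lambda>x. sqrt (jac x)) ` cball x0 r)" by (rule compact_imp_bounded)
    then obtain J where "\<forall>y \<in> (\<lambda>x. sqrt (jac x)) ` cball x0 r. norm y \<le> J" unfolding bounded_iff by blast
    moreover have "P \<subseteq> cball x0 r" using PB by auto
    ultimately show ?thesis using that[of J] by force
  qed
  \<comment> \<open>Plancherel along a slice divides by the Jacobian; its square root, put into the
    frame functions, cancels this. It is bounded because \<open>jac\<close> is continuous on the
    closed ball.\<close>
  define w where "w x = indicator P x * sqrt (jac x)" for x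
  have [measurable]: "w \<in> borel_measurable borel" unfolding w_def[abs_def] by measurable
  have w0: "0 \<le> w x" and wJ: "w x \<le> \<bar>J\<bar>" for x
    using J[of x] by (auto simp: w_def indicator_def jac_nonneg)
  have wP: "w x = 0" if "x \<notin> P" for x using that by (simp add: w_def)
  \<comment> \<open>Averaging \<open>c k\<close> over the shifts by \<open>S s\<close> is adjoint to
    the slice average that defines \<open>q\<close> below; \<open>coef\<close> passes from one to
    the other.\<close>
  define e where "e k x = w x * (\<integral>s. indicator ?Q s * c k (x - S s) \<partial>lborel)" for k x
  have iQ: "integrable lborel (\<lambda>s. indicator ?Q s * c k (x - S s))" for k x
  proof (rule Bochner_Integration.integrable_bound)
    show "integrable lborel (\<lambda>s. B k * indicator ?Q s)"
      by (intro integrable_mult_right integrable_real_indicator) (auto simp: emeasure_unit_cube)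
    show "AE s in lborel. norm (indicator ?Q s * c k (x - S s)) \<le> norm (B k * indicator ?Q s)"
      using B B0 by (auto simp: indicator_def)
  qed measurable
  have avg: "\<bar>\<integral>s. indicator ?Q s * c k (x - S s) \<partial>lborel\<bar> \<le> B k" for k x
  proof -
    have "\<bar>\<integral>s. indicator ?Q s * c k (x - S s) \<partial>lborel\<bar> \<le> (\<integral>s. \<bar>indicator ?Q s * c k (x - S s)\<bar> \<partial>lborel)"
      by (rule integral_abs_bound)
    also have "\<dots> \<le> (\<integral>s. B k * indicator ?Q s \<partial>lborel)"
      using B iQ by (intro integral_mono integrable_abs integrable_mult_right integrable_real_indicator)
        (auto simp: indicator_def emeasure_unit_cube)
    also have "\<dots> = B k" by (simp add: measure_def emeasure_unit_cube del: content_cbox)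
    finally show ?thesis .
  qed
  show ?thesis
  proof (intro exI[of _ e] conjI allI impI)
    show "e k \<in> borel_measurable borel" for k unfolding e_def[abs_def] by measurable
    show "\<exists>C. \<forall>x. \<bar>e k x\<bar> \<le> C" for k
    proof -
      have "\<bar>e k x\<bar> \<le> \<bar>J\<bar> * B k" for x
        unfolding e_def abs_mult using wJ w0 avg by (intro mult_mono) auto
      then show ?thesis by blast
    qed
    show "e k x = 0" if "x \<notin> P" for k x using wP[OF that] by (simp add: e_def)
    fix F :: "real^'d \<Rightarrow> complex" assume F[measurable]: "F \<in> borel_measurable borel"
      and F2: "integrable lborel (\<lambda>x. (cmod (F x))\<^sup>2)"
    define f where "f x = F x * complex_of_real (w x)" for x
    have [measurable]: "f \<in> borel_measurable borel" unfolding f_def[abs_def] by measurable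
    have f2: "integrable lborel (\<lambda>x. (cmod (f x))\<^sup>2)"
    proof (rule Bochner_Integration.integrable_bound[OF integrable_mult_right[OF F2, of "J\<^sup>2"]])
      have "(cmod (f x))\<^sup>2 \<le> J\<^sup>2 * (cmod (F x))\<^sup>2" for x
      proof -
        have "(w x)\<^sup>2 \<le> J\<^sup>2" using w0[of x] wJ[of x] by (simp add: abs_le_square_iff[symmetric])
        from mult_right_mono[OF this, of "(cmod (F x))\<^sup>2"] show ?thesis
          by (simp add: f_def norm_mult power_mult_distrib mult.commute)
      qed
      then show "AE x in lborel. norm ((cmod (f x))\<^sup>2) \<le> norm (J\<^sup>2 * (cmod (F x))\<^sup>2)" by simp
    qed measurable
    have fP: "f x = 0" if "x \<notin> P" for x using wP[OF that] by (simp add: f_def)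
    have f1: "integrable lborel f"
    proof -
      have "emeasure lborel P < \<infinity>"
        using bounded_subset[OF bounded_ball PB] emeasure_bounded_finite by blast
      from integrable_indicator_of_square[OF P this \<open>f \<in> _\<close> f2]
      have "integrable lborel (\<lambda>x. indicator P x *\<^sub>R f x)" .
      moreover have "indicator P x *\<^sub>R f x = f x" for x using fP by (auto simp: indicator_def)
      ultimately show ?thesis by simp
    qed
    define H where "H a x s = f (x + S s) * cis (2 * pi * (\<Phi> (x + S s) \<bullet> a)) * complex_of_real (indicator ?Q s)" for a x s
    define q where "q a x = (\<integral>s. H a x s \<partial>lborel)" for a x
    have [measurable]: "case_prod q \<in> borel_measurable (borel \<Otimes>\<^sub>M borel)"
      unfolding q_def[abs_def] H_def by measurable
    have [measurable]: "q a \<in> borel_measurable borel" for a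
      unfolding q_def[abs_def] H_def by measurable
    have qR: "q a x = 0" if "x \<notin> R" for a x
    proof -
      have "H a x s = 0" for s
      proof (cases "s \<in> ?Q")
        case True
        then have "x + S s \<notin> P" using inR[of x s] that PB by auto
        then show ?thesis by (simp add: H_def fP)
      qed (simp add: H_def)
      then show ?thesis by (simp add: q_def)
    qed
    have coef: "(\<integral>x. F x * complex_of_real (e k x) * cis (2 * pi * (\<Phi> x \<bullet> a)) \<partial>lborel) = (\<integral>x. q a x * c k x \<partial>lborel)" for k a
    proof -
      define T where "T s x = f x * cis (2 * pi * (\<Phi> x \<bullet> a)) * complex_of_real (indicator ?Q s * c k (x - S s))" for s x
      have Ti: "integrable (lborel \<Otimes>\<^sub>M lborel) (\<lambda>(s, x). T s x)"
      proof (rule lborel_pair.Fubini_integrable)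
        have "AE s in lborel. integrable lborel (\<lambda>x. T s x)"
        proof (rule AE_I2)
          fix s
          show "integrable lborel (\<lambda>x. T s x)"
          proof (rule Bochner_Integration.integrable_bound[OF integrable_mult_right[OF integrable_norm[OF f1], of "B k"]])
            have "norm (T s x) \<le> B k * cmod (f x)" for x
              using B[of k "x - S s"] B0[of k] mult_left_mono[OF B[of k "x - S s"], of "cmod (f x)"] by (auto simp: T_def norm_mult indicator_def mult.commute)
            moreover have "B k * cmod (f x) \<le> norm (B k * norm (f x))" for x by simp
            ultimately show "AE x in lborel. norm (T s x) \<le> norm (B k * norm (f x))"
              by (intro AE_I2) (rule order_trans)
          qed (simp add: T_def)
        qed
        then show "AE x in lborel. integrable lborel (\<lambda>y. case (x, y) of (s, x) \<Rightarrow> T s x)" by simp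
        show "integrable lborel (\<lambda>x. \<integral>y. norm (case (x, y) of (s, x) \<Rightarrow> T s x) \<partial>lborel)"
        proof (rule Bochner_Integration.integrable_bound)
          show "integrable lborel (\<lambda>s. (B k * (\<integral>x. cmod (f x) \<partial>lborel)) * indicator ?Q s)"
            by (intro integrable_mult_right integrable_real_indicator) (auto simp: emeasure_unit_cube)
          have "(\<integral>y. norm (T s y) \<partial>lborel) \<le> (B k * (\<integral>x. cmod (f x) \<partial>lborel)) * indicator ?Q s" for s
          proof (cases "s \<in> ?Q")
            case True
            have "(\<integral>y. norm (T s y) \<partial>lborel) \<le> (\<integral>y. B k * cmod (f y) \<partial>lborel)"
            proof (rule integral_mono')
              show "integrable lborel (\<lambda>y. B k * cmod (f y))" using f1 by (intro integrable_mult_right integrable_norm)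
              show "norm (T s y) \<le> B k * cmod (f y)" for y
                using True mult_left_mono[OF B[of k "y - S s"], of "cmod (f y)"] by (simp add: T_def norm_mult mult.commute)
              show "0 \<le> B k * cmod (f y)" for y using B0 by simp
            qed
            then show ?thesis using True by simp
          qed (simp add: T_def)
          then show "AE s in lborel. norm (\<integral>y. norm (case (s, y) of (s, x) \<Rightarrow> T s x) \<partial>lborel) \<le> norm ((B k * (\<integral>x. cmod (f x) \<partial>lborel)) * indicator ?Q s)"
            using B0 by (auto intro!: AE_I2 simp: abs_mult indicator_def)
        qed (simp add: T_def)
      qed (simp add: T_def)
      have "(\<integral>x. F x * complex_of_real (e k x) * cis (2 * pi * (\<Phi> x \<bullet> a)) \<partial>lborel) = (\<integral>x. (\<integral>s. T s x \<partial>lborel) \<partial>lborel)"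
      proof (rule Bochner_Integration.integral_cong[OF refl])
        fix x
        have "(\<integral>s. T s x \<partial>lborel) = f x * cis (2 * pi * (\<Phi> x \<bullet> a)) * complex_of_real (\<integral>s. indicator ?Q s * c k (x - S s) \<partial>lborel)"
          unfolding T_def by (simp only: integral_mult_right_zero integral_complex_of_real)
        then show "F x * complex_of_real (e k x) * cis (2 * pi * (\<Phi> x \<bullet> a)) = (\<integral>s. T s x \<partial>lborel)"
          by (simp add: f_def e_def)
      qed
      also have "\<dots> = (\<integral>s. (\<integral>x. T s x \<partial>lborel) \<partial>lborel)"
        using lborel_pair.Fubini_integral[OF Ti] .
      \<comment> \<open>The shift \<open>x \<mapsto> S s + x\<close> moves the average from the
        frame function onto \<open>F\<close>.\<close>
      also have "\<dots> = (\<integral>s. (\<integral>x. H a x s * c k x \<partial>lborel) \<partial>lborel)"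
      proof (rule Bochner_Integration.integral_cong[OF refl])
        fix s
        have "(\<integral>x. T s x \<partial>lborel) = complex_of_real (1 ^ DIM(real^'d)) * (\<integral>x. T s (S s + 1 *\<^sub>R x) \<partial>lborel)"
          by (rule lborel_integral_affine) (simp_all add: T_def)
        also have "\<dots> = (\<integral>x. H a x s * c k x \<partial>lborel)"
          by (simp add: T_def H_def add.commute mult_ac)
        finally show "(\<integral>x. T s x \<partial>lborel) = (\<integral>x. H a x s * c k x \<partial>lborel)" .
      qed
      also have "\<dots> = (\<integral>x. (\<integral>s. H a x s * c k x \<partial>lborel) \<partial>lborel)"
      proof (rule lborel_pair.Fubini_integral)
        have "integrable (lborel \<Otimes>\<^sub>M lborel) (\<lambda>(s, x). T s (S s + x))"
        proof -
          have mT: "(\<lambda>(s, x). T s x) \<in> borel_measurable (lborel \<Otimes>\<^sub>M lborel)" unfolding T_def by measurable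
          have mT': "(\<lambda>(s, x). T s (S s + x)) \<in> borel_measurable (lborel \<Otimes>\<^sub>M lborel)" unfolding T_def by measurable
          have "(\<integral>\<^sup>+z. ennreal (norm (case z of (s, x) \<Rightarrow> T s (S s + x))) \<partial>(lborel \<Otimes>\<^sub>M lborel)) = (\<integral>\<^sup>+s. \<integral>\<^sup>+x. ennreal (norm (T s (S s + x))) \<partial>lborel \<partial>lborel)"
            using mT' by (subst lborel.nn_integral_fst[symmetric]) auto
          also have "\<dots> = (\<integral>\<^sup>+s. \<integral>\<^sup>+x. ennreal (norm (T s x)) \<partial>lborel \<partial>lborel)"
          proof (rule nn_integral_cong)
            fix s
            have "(\<lambda>x. ennreal (norm (T s x))) \<in> borel_measurable borel" unfolding T_def by measurable
            from lborel_nn_integral_translation[OF this, of "S s"]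
            show "(\<integral>\<^sup>+x. ennreal (norm (T s (S s + x))) \<partial>lborel) = (\<integral>\<^sup>+x. ennreal (norm (T s x)) \<partial>lborel)" by (simp add: add.commute)
          qed
          also have "\<dots> = (\<integral>\<^sup>+z. ennreal (norm (case z of (s, x) \<Rightarrow> T s x)) \<partial>(lborel \<Otimes>\<^sub>M lborel))"
            using mT by (subst lborel.nn_integral_fst[symmetric]) auto
          also have "\<dots> < \<infinity>" using Ti by (simp add: integrable_iff_bounded)
          finally show ?thesis using mT' by (simp add: integrable_iff_bounded)
        qed
        moreover have "T s (S s + x) = H a x s * c k x" for s x
          by (simp add: T_def H_def add.commute mult_ac)
        ultimately have "integrable (lborel \<Otimes>\<^sub>M lborel) (\<lambda>(s, x). H a x s * c k x)" by simp
        from lborel_pair.integrable_product_swap[OF this]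
        show "integrable (lborel \<Otimes>\<^sub>M lborel) (\<lambda>(x, s). H a x s * c k x)" by (simp add: case_prod_beta')
      qed
      also have "\<dots> = (\<integral>x. q a x * c k x \<partial>lborel)"
        unfolding q_def by (simp only: integral_mult_left_zero)
      finally show ?thesis .
    qed
    have q2: "integrable lborel (\<lambda>x. (cmod (q a x))\<^sup>2)" for a
    proof -
      have "ennreal ((cmod (q a x))\<^sup>2) \<le> (\<integral>\<^sup>+s. ennreal ((cmod (f (x + S s)))\<^sup>2) * indicator ?Q s \<partial>lborel)" for x
      proof -
        have "ennreal (cmod (q a x)) \<le> (\<integral>\<^sup>+s. ennreal (cmod (H a x s)) \<partial>lborel)"
          unfolding q_def by (rule integral_norm_bound_nn)
        also have "\<dots> = (\<integral>\<^sup>+s. (ennreal (cmod (f (x + S s))) * indicator ?Q s) * indicator ?Q s \<partial>lborel)"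
          by (intro nn_integral_cong) (auto simp: H_def norm_mult indicator_def)
        finally have "(ennreal (cmod (q a x)))\<^sup>2 \<le> (\<integral>\<^sup>+s. (ennreal (cmod (f (x + S s))) * indicator ?Q s) * indicator ?Q s \<partial>lborel)\<^sup>2"
          by (rule power_mono) simp
        also have "\<dots> \<le> (\<integral>\<^sup>+s. (ennreal (cmod (f (x + S s))) * indicator ?Q s)\<^sup>2 \<partial>lborel) * (\<integral>\<^sup>+s. (indicator ?Q s)\<^sup>2 \<partial>lborel)"
          by (rule Cauchy_Schwarz_nn_integral) measurable
        also have "(\<integral>\<^sup>+s. (indicator ?Q s)\<^sup>2 \<partial>lborel) = (\<integral>\<^sup>+s. indicator ?Q s \<partial>lborel)"
          by (intro nn_integral_cong) (auto simp: indicator_def)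
        also have "\<dots> = 1" by (simp add: emeasure_unit_cube)
        also have "(\<integral>\<^sup>+s. (ennreal (cmod (f (x + S s))) * indicator ?Q s)\<^sup>2 \<partial>lborel) = (\<integral>\<^sup>+s. ennreal ((cmod (f (x + S s)))\<^sup>2) * indicator ?Q s \<partial>lborel)"
          by (intro nn_integral_cong) (auto simp: indicator_def ennreal_power)
        finally show ?thesis by (simp add: ennreal_power)
      qed
      then have "(\<integral>\<^sup>+x. ennreal ((cmod (q a x))\<^sup>2) \<partial>lborel) \<le> (\<integral>\<^sup>+x. (\<integral>\<^sup>+s. ennreal ((cmod (f (x + S s)))\<^sup>2) * indicator ?Q s \<partial>lborel) \<partial>lborel)"
        by (intro nn_integral_mono)
      also have "\<dots> = (\<integral>\<^sup>+x. ennreal ((cmod (f x))\<^sup>2) \<partial>lborel)"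
        by (rule average_over_slices) measurable
      also have "\<dots> < \<infinity>" using f2 by (simp add: integrable_iff_bounded)
      finally show ?thesis by (simp add: integrable_iff_bounded)
    qed
    have "(\<Sum>k. \<integral>\<^sup>+a. ennreal ((cmod (\<integral>x. F x * complex_of_real (e k x) * cis (2 * pi * (\<Phi> x \<bullet> a)) \<partial>lborel))\<^sup>2) \<partial>lborel)
       = (\<Sum>k. \<integral>\<^sup>+a. ennreal ((cmod (\<integral>x. q a x * c k x \<partial>lborel))\<^sup>2) \<partial>lborel)"
      unfolding coef ..
    also have "\<dots> = (\<integral>\<^sup>+a. (\<Sum>k. ennreal ((cmod (\<integral>x. q a x * c k x \<partial>lborel))\<^sup>2)) \<partial>lborel)"
      by (rule nn_integral_suminf[symmetric]) measurable
    also have "\<dots> = (\<integral>\<^sup>+a. \<integral>\<^sup>+x. ennreal ((cmod (q a x))\<^sup>2) \<partial>lborel \<partial>lborel)"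
      by (intro nn_integral_cong cP q2 qR) measurable
    also have "\<dots> = (\<integral>\<^sup>+x. \<integral>\<^sup>+a. ennreal ((cmod (q a x))\<^sup>2) \<partial>lborel \<partial>lborel)"
      by (rule lborel_pair.Fubini') measurable
    also have "\<dots> = (\<integral>\<^sup>+x. (\<integral>\<^sup>+s. (ennreal ((cmod (F (x + S s)))\<^sup>2) * indicator P (x + S s)) * indicator ?Q s \<partial>lborel) \<partial>lborel)"
    proof (rule nn_integral_cong_AE)
      \<comment> \<open>Plancherel on a slice asks for an integrable function there. Since
        \<open>f\<close> is integrable, its restrictions to the slices are so for almost every
        \<open>x\<close>.\<close>
      have "(\<integral>\<^sup>+x. (\<integral>\<^sup>+s. ennreal (cmod (f (x + S s))) * indicator ?Q s \<partial>lborel) \<partial>lborel) = (\<integral>\<^sup>+x. ennreal (cmod (f x)) \<partial>lborel)"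
        by (rule average_over_slices) measurable
      also have "\<dots> \<noteq> \<infinity>" using f1 by (simp add: integrable_iff_bounded)
      finally have "AE x in lborel. (\<integral>\<^sup>+s. ennreal (cmod (f (x + S s))) * indicator ?Q s \<partial>lborel) \<noteq> \<infinity>"
        by (intro nn_integral_PInf_AE) measurable
      then show "AE x in lborel. (\<integral>\<^sup>+a. ennreal ((cmod (q a x))\<^sup>2) \<partial>lborel) = (\<integral>\<^sup>+s. (ennreal ((cmod (F (x + S s)))\<^sup>2) * indicator P (x + S s)) * indicator ?Q s \<partial>lborel)"
      proof eventually_elim
        fix x assume fin: "(\<integral>\<^sup>+s. ennreal (cmod (f (x + S s))) * indicator ?Q s \<partial>lborel) \<noteq> \<infinity>"
        define u where "u s = f (x + S s) * complex_of_real (indicator ?Q s)" for s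
        have [measurable]: "u \<in> borel_measurable borel" unfolding u_def[abs_def] by measurable
        have "(\<integral>\<^sup>+s. ennreal (cmod (u s)) \<partial>lborel) = (\<integral>\<^sup>+s. ennreal (cmod (f (x + S s))) * indicator ?Q s \<partial>lborel)"
          by (intro nn_integral_cong) (auto simp: u_def norm_mult indicator_def)
        with fin have u: "integrable lborel u" by (simp add: integrable_iff_bounded less_top)
        have u0: "u s = 0" if "x + S s \<notin> ball x0 r" for s
        proof -
          have "x + S s \<notin> P" using PB that by blast
          then show ?thesis by (simp add: u_def fP)
        qed
        have "q a x = (\<integral>s. u s * cis (2 * pi * (\<Phi> (x + S s) \<bullet> a)) \<partial>lborel)" for a
          unfolding q_def H_def u_def by (simp add: mult_ac)
        then have "(\<integral>\<^sup>+a. ennreal ((cmod (q a x))\<^sup>2) \<partial>lborel) = (\<integral>\<^sup>+s. ennreal ((cmod (u s))\<^sup>2 / jac (x + S s)) \<partial>lborel)"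
          using plancherel_slice[OF u u0] by simp
        also have "\<dots> = (\<integral>\<^sup>+s. (ennreal ((cmod (F (x + S s)))\<^sup>2) * indicator P (x + S s)) * indicator ?Q s \<partial>lborel)"
        proof (rule nn_integral_cong)
          fix s
          show "ennreal ((cmod (u s))\<^sup>2 / jac (x + S s)) = (ennreal ((cmod (F (x + S s)))\<^sup>2) * indicator P (x + S s)) * indicator ?Q s"
          proof (cases "x + S s \<in> P")
            case True
            then have "0 < jac (x + S s)" using jac_pos PB by auto
            then show ?thesis using True
              by (auto simp: u_def f_def w_def norm_mult power_mult_distrib indicator_def jac_nonneg)
          qed (simp add: u_def fP)
        qed
        finally show "(\<integral>\<^sup>+a. ennreal ((cmod (q a x))\<^sup>2) \<partial>lborel) = (\<integral>\<^sup>+s. (ennreal ((cmod (F (x + S s)))\<^sup>2) * indicator P (x + S s)) * indicator ?Q s \<partial>lborel)" .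
      qed
    qed
    also have "\<dots> = (\<integral>\<^sup>+x. ennreal ((cmod (F x))\<^sup>2) * indicator P x \<partial>lborel)"
      by (rule average_over_slices) measurable
    finally show "(\<Sum>k. \<integral>\<^sup>+a. ennreal ((cmod (\<integral>x. F x * complex_of_real (e k x) * cis (2 * pi * (\<Phi> x \<bullet> a)) \<partial>lborel))\<^sup>2) \<partial>lborel)
       = (\<integral>\<^sup>+x. ennreal ((cmod (F x))\<^sup>2) * indicator P x \<partial>lborel)" .
  qed
qed

end

section \<open>Patches covering the regular points\<close>

text \<open>Full rank gives the derivative at \<open>x0\<close> a linear right inverse
  \<open>S\<close>; the distance of \<open>\<Phi>' x o\<^sub>L S\<close> from the identity is
  continuous in \<open>x\<close> and vanishes at \<open>x0\<close>.\<close>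

lemma regular_point_patch:
  fixes \<Phi> :: "real^'d::finite \<Rightarrow> real^'n::finite" and \<Phi>' :: "real^'d \<Rightarrow> ((real^'d) \<Rightarrow>\<^sub>L (real^'n))"
  assumes deriv: "\<And>x. (\<Phi> has_derivative blinfun_apply (\<Phi>' x)) (at x)"
    and cont': "continuous_on UNIV \<Phi>'"
    and reg: "rank (matrix (blinfun_apply (\<Phi>' x0))) = CARD('n)"
  shows "\<exists>S r. 0 < r \<and> submersion_patch \<Phi> \<Phi>' S x0 r"
proof -
  have lin: "linear (blinfun_apply (\<Phi>' x0))"
    by (intro linearI) (simp_all add: blinfun.add_right blinfun.scaleR_right)
  have "surj ((*v) (matrix (blinfun_apply (\<Phi>' x0))))" using reg by (simp add: full_rank_surjective)
  then have "surj (blinfun_apply (\<Phi>' x0))" using matrix_vector_mul[of "blinfun_apply (\<Phi>' x0)"] lin linear_matrix_vector_mul_eq[of "blinfun_apply (\<Phi>' x0)"] by simp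
  then obtain g where g: "linear g" "blinfun_apply (\<Phi>' x0) \<circ> g = id"
    using linear_surjective_right_inverse[OF lin] by blast
  define S where "S = Blinfun g"
  have S: "blinfun_apply S = g"
    unfolding S_def using g(1) by (intro bounded_linear_Blinfun_apply) (simp add: linear_conv_bounded_linear)
  have id: "\<Phi>' x0 o\<^sub>L S = id_blinfun"
    using g(2) by (intro blinfun_eqI) (simp add: S fun_eq_iff)
  have "continuous_on UNIV (\<lambda>x. norm ((\<Phi>' x o\<^sub>L S) - id_blinfun))"
    by (intro continuous_intros bounded_bilinear.continuous_on[OF bounded_bilinear_blinfun_compose] cont')
  then have "isCont (\<lambda>x. norm ((\<Phi>' x o\<^sub>L S) - id_blinfun)) x0" by (simp add: continuous_on_eq_continuous_at)
  then obtain r where r: "0 < r" "\<And>x. dist x x0 < r \<Longrightarrow> dist (norm ((\<Phi>' x o\<^sub>L S) - id_blinfun)) (norm ((\<Phi>' x0 o\<^sub>L S) - id_blinfun)) < 1/2"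
    unfolding continuous_at_eps_delta by (metis half_gt_zero_iff zero_less_one)
  have "submersion_patch \<Phi> \<Phi>' S x0 r"
  proof
    fix x assume "x \<in> ball x0 r"
    then show "norm ((\<Phi>' x o\<^sub>L S) - id_blinfun) \<le> 1/2"
      using r(2)[of x] by (simp add: id dist_commute)
  qed (use deriv cont' in auto)
  with r(1) show ?thesis by blast
qed

lemma countable_patches:
  fixes \<Phi> :: "real^'d::finite \<Rightarrow> real^'n::finite" and \<Phi>' :: "real^'d \<Rightarrow> ((real^'d) \<Rightarrow>\<^sub>L (real^'n))"
  assumes deriv: "\<And>x. (\<Phi> has_derivative blinfun_apply (\<Phi>' x)) (at x)"
    and cont': "continuous_on UNIV \<Phi>'"
    and reg: "\<And>x. x \<in> X \<Longrightarrow> rank (matrix (blinfun_apply (\<Phi>' x))) = CARD('n)"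
    and X: "X \<noteq> {}"
  obtains S c r where "\<And>i::nat. submersion_patch \<Phi> \<Phi>' (S i) (c i) (r i)" "X \<subseteq> (\<Union>i. ball (c i) (r i))"
proof -
  define \<F> where "\<F> = {ball c r | S c r. 0 < r \<and> submersion_patch \<Phi> \<Phi>' S c r}"
  have "open B" if "B \<in> \<F>" for B using that by (auto simp: \<F>_def)
  then obtain \<F>' where F: "\<F>' \<subseteq> \<F>" "countable \<F>'" "\<Union>\<F>' = \<Union>\<F>" using Lindelof by metis
  have XF: "X \<subseteq> \<Union>\<F>"
  proof
    fix x assume "x \<in> X"
    then obtain S r where "0 < r" "submersion_patch \<Phi> \<Phi>' S x r"
      using regular_point_patch[OF deriv cont' reg] by blast
    then have "ball x r \<in> \<F>" "x \<in> ball x r" by (auto simp: \<F>_def)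
    then show "x \<in> \<Union>\<F>" by blast
  qed
  then have ne: "\<F>' \<noteq> {}" using X F(3) by auto
  have "\<forall>i. \<exists>S c r. submersion_patch \<Phi> \<Phi>' S c r \<and> from_nat_into \<F>' i = ball c r"
    using from_nat_into[OF ne] F(1) unfolding \<F>_def by blast
  then obtain S c r where *: "\<And>i. submersion_patch \<Phi> \<Phi>' (S i) (c i) (r i)" "\<And>i. from_nat_into \<F>' i = ball (c i) (r i)"
    by metis
  have U: "\<Union>\<F>' = (\<Union>i. ball (c i) (r i))"
    by (subst range_from_nat_into[OF ne F(2), symmetric]) (simp add: *(2))
  show ?thesis by (rule that[of S c r]) (use *(1) XF F(3) U in auto)
qed

lemma vimage_null_of_submersion:
  fixes \<Phi> :: "real^'d::finite \<Rightarrow> real^'n::finite" and \<Phi>' :: "real^'d \<Rightarrow> ((real^'d) \<Rightarrow>\<^sub>L (real^'n))"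
  assumes deriv: "\<And>x. (\<Phi> has_derivative blinfun_apply (\<Phi>' x)) (at x)"
    and cont': "continuous_on UNIV \<Phi>'"
    and reg: "\<And>x. x \<in> X \<Longrightarrow> rank (matrix (blinfun_apply (\<Phi>' x))) = CARD('n)"
    and N: "N \<in> null_sets lborel"
  shows "AE x in lborel. x \<in> X \<longrightarrow> \<Phi> x \<notin> N"
proof (cases "X = {}")
  case False
  obtain S c r where p: "\<And>i::nat. submersion_patch \<Phi> \<Phi>' (S i) (c i) (r i)" and cov: "X \<subseteq> (\<Union>i. ball (c i) (r i))"
    by (rule countable_patches[of \<Phi> \<Phi>' X, OF deriv cont' _ False]) (simp add: reg, rule that)
  have "AE x in lborel. x \<notin> ball (c i) (r i) \<inter> \<Phi> -` N" for i
    by (rule AE_not_in) (rule submersion_patch.vimage_null[OF p N])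
  then have "AE x in lborel. \<forall>i. x \<notin> ball (c i) (r i) \<inter> \<Phi> -` N" unfolding AE_all_countable by blast
  then show ?thesis
  proof eventually_elim
    fix x assume "\<forall>i. x \<notin> ball (c i) (r i) \<inter> \<Phi> -` N"
    then show "x \<in> X \<longrightarrow> \<Phi> x \<notin> N" using cov by blast
  qed
qed simp

text \<open>Cutting the covering balls down to disjoint Borel pieces of \<open>X\<close> lets the
  local frames, each supported in its piece, be listed together: the local norms add up to the norm
  over \<open>X\<close>.\<close>

lemma parseval_frame_along_submersion:
  fixes \<Phi> :: "real^'d::finite \<Rightarrow> real^'n::finite" and \<Phi>' :: "real^'d \<Rightarrow> ((real^'d) \<Rightarrow>\<^sub>L (real^'n))"
  assumes deriv: "\<And>x. (\<Phi> has_derivative blinfun_apply (\<Phi>' x)) (at x)"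
    and cont': "continuous_on UNIV \<Phi>'"
    and reg: "\<And>x. x \<in> X \<Longrightarrow> rank (matrix (blinfun_apply (\<Phi>' x))) = CARD('n)"
    and X[measurable]: "X \<in> sets borel" and Xne: "X \<noteq> {}"
  shows "\<exists>E :: nat \<Rightarrow> real^'d \<Rightarrow> real. (\<forall>k. E k \<in> borel_measurable borel) \<and> (\<forall>k. \<exists>C. \<forall>x. \<bar>E k x\<bar> \<le> C) \<and>
    (\<forall>k. bounded {x. E k x \<noteq> 0}) \<and> (\<forall>k. {x. E k x \<noteq> 0} \<subseteq> X) \<and>
    (\<forall>F. F \<in> borel_measurable borel \<longrightarrow> integrable lborel (\<lambda>x. (cmod (F x))\<^sup>2) \<longrightarrow>
      (\<Sum>k. \<integral>\<^sup>+a. ennreal ((cmod (\<integral>x. F x * complex_of_real (E k x) * cis (2 * pi * (\<Phi> x \<bullet> a)) \<partial>lborel))\<^sup>2) \<partial>lborel)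
       = (\<integral>\<^sup>+x. ennreal ((cmod (F x))\<^sup>2) * indicator X x \<partial>lborel))"
proof -
  obtain S c r where p: "\<And>i::nat. submersion_patch \<Phi> \<Phi>' (S i) (c i) (r i)" and cov: "X \<subseteq> (\<Union>i. ball (c i) (r i))"
    by (rule countable_patches[of \<Phi> \<Phi>' X, OF deriv cont' _ Xne]) (simp add: reg, rule that)
  define P where "P i = disjointed (\<lambda>i. ball (c i) (r i)) i \<inter> X" for i
  define D where "D = disjointed (\<lambda>i. ball (c i) (r i))"
  have PD: "P i = D i \<inter> X" for i by (simp add: P_def D_def)
  have "D i \<in> sets borel" for i
    unfolding D_def disjointed_def by (intro sets.Diff sets.finite_UN) auto
  then have P[measurable]: "P i \<in> sets borel" for i
    unfolding PD by auto
  have PB: "P i \<subseteq> ball (c i) (r i)" for i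
    unfolding P_def using disjointed_subset[of "\<lambda>i. ball (c i) (r i)" i] by (rule le_infI1)
  have PX: "P i \<subseteq> X" for i by (auto simp: P_def)
  have "disjoint_family D" unfolding D_def by (rule disjoint_family_disjointed)
  then have disj: "disjoint_family P" unfolding disjoint_family_on_def PD by blast
  have "(\<Union>i. D i) = (\<Union>i. ball (c i) (r i))" unfolding D_def by (rule UN_disjointed_eq)
  moreover have "(\<Union>i. P i) = (\<Union>i. D i) \<inter> X" unfolding PD by auto
  ultimately have un: "(\<Union>i. P i) = X" using cov by (simp add: Int_absorb1)
  let ?coef = "\<lambda>F e a. \<integral>x. F x * complex_of_real (e x) * cis (2 * pi * (\<Phi> x \<bullet> a)) \<partial>lborel"
  define good where "good i e \<longleftrightarrow> (\<forall>k. e k \<in> borel_measurable borel) \<and> (\<forall>k. \<exists>C. \<forall>x. \<bar>e k x\<bar> \<le> C) \<and>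
    (\<forall>k x. x \<notin> P i \<longrightarrow> e k x = 0) \<and>
    (\<forall>F. F \<in> borel_measurable borel \<longrightarrow> integrable lborel (\<lambda>x. (cmod (F x))\<^sup>2) \<longrightarrow>
      (\<Sum>k. \<integral>\<^sup>+a. ennreal ((cmod (?coef F (e k) a))\<^sup>2) \<partial>lborel)
       = (\<integral>\<^sup>+x. ennreal ((cmod (F x))\<^sup>2) * indicator (P i) x \<partial>lborel))" for i and e :: "nat \<Rightarrow> real^'d \<Rightarrow> real"
  have "\<exists>e. good i e" for i
    unfolding good_def by (rule submersion_patch.local_parseval_frame[OF p P PB])
  then obtain e where ge: "\<And>i. good i (e i)" by metis
  have e: "e i k \<in> borel_measurable borel" "\<exists>C. \<forall>x. \<bar>e i k x\<bar> \<le> C" "x \<notin> P i \<Longrightarrow> e i k x = 0" for i k x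
    using ge[of i] unfolding good_def by simp_all
  have eP: "F \<in> borel_measurable borel \<Longrightarrow> integrable lborel (\<lambda>x. (cmod (F x))\<^sup>2) \<Longrightarrow>
      (\<Sum>k. \<integral>\<^sup>+a. ennreal ((cmod (?coef F (e i k) a))\<^sup>2) \<partial>lborel)
       = (\<integral>\<^sup>+x. ennreal ((cmod (F x))\<^sup>2) * indicator (P i) x \<partial>lborel)" for i F
    using ge[of i] unfolding good_def by simp
  define E where "E m = (case prod_decode m of (i, k) \<Rightarrow> e i k)" for m
  show ?thesis
  proof (intro exI[of _ E] conjI allI impI)
    fix m
    show "E m \<in> borel_measurable borel" using e(1) by (simp add: E_def split: prod.split)
    show "\<exists>C. \<forall>x. \<bar>E m x\<bar> \<le> C" using e(2) by (simp add: E_def split: prod.split)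
    obtain i k where ik: "prod_decode m = (i, k)" by fastforce
    have "{x. E m x \<noteq> 0} \<subseteq> P i" using e(3) by (auto simp: E_def ik)
    then show "bounded {x. E m x \<noteq> 0}" "{x. E m x \<noteq> 0} \<subseteq> X"
      using PB[of i] PX[of i] by (auto intro: bounded_subset[OF bounded_ball])
  next
    fix F :: "real^'d \<Rightarrow> complex" assume F[measurable]: "F \<in> borel_measurable borel" and F2: "integrable lborel (\<lambda>x. (cmod (F x))\<^sup>2)"
    have "(\<Sum>m. \<integral>\<^sup>+a. ennreal ((cmod (?coef F (E m) a))\<^sup>2) \<partial>lborel) = (\<Sum>m. (\<lambda>(i, k). \<integral>\<^sup>+a. ennreal ((cmod (?coef F (e i k) a))\<^sup>2) \<partial>lborel) (prod_decode m))"
      by (intro suminf_cong) (simp add: E_def split: prod.split)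
    also have "\<dots> = (\<Sum>i. \<integral>\<^sup>+x. ennreal ((cmod (F x))\<^sup>2) * indicator (P i) x \<partial>lborel)"
      by (rule suminf_ennreal_2dimen) (simp add: eP[OF F F2])
    also have "\<dots> = (\<integral>\<^sup>+x. (\<Sum>i. ennreal ((cmod (F x))\<^sup>2) * indicator (P i) x) \<partial>lborel)"
      by (rule nn_integral_suminf[symmetric]) measurable
    also have "\<dots> = (\<integral>\<^sup>+x. ennreal ((cmod (F x))\<^sup>2) * indicator X x \<partial>lborel)"
      using suminf_indicator[OF disj] by (simp add: un)
    finally show "(\<Sum>m. \<integral>\<^sup>+a. ennreal ((cmod (?coef F (E m) a))\<^sup>2) \<partial>lborel) = (\<integral>\<^sup>+x. ennreal ((cmod (F x))\<^sup>2) * indicator X x \<partial>lborel)" .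
  qed
qed

section \<open>Push-forward densities and additivity over disjoint sets\<close>

context
  fixes \<Phi> :: "'a::euclidean_space \<Rightarrow> 'b::euclidean_space"
  assumes \<Phi>[measurable]: "\<Phi> \<in> borel_measurable borel"
    and ac: "\<And>N. N \<in> null_sets lborel \<Longrightarrow> AE x in lborel. \<Phi> x \<notin> N"
begin

text \<open>By \<open>ac\<close> the push-forward of \<open>u dx\<close> under \<open>\<Phi>\<close>
  is absolutely continuous, and \<open>v\<close> is its Radon-Nikodym derivative. The finite total
  mass makes it finite almost everywhere, so it can be taken real.\<close>

lemma pushforward_density_nonneg:
  fixes u :: "'a \<Rightarrow> real"
  assumes u: "integrable lborel u" and u0: "\<And>x. 0 \<le> u x"
  shows "\<exists>v :: 'b \<Rightarrow> real. integrable lborel v \<and> (\<forall>\<psi> :: 'b \<Rightarrow> complex. \<psi> \<in> borel_measurable borel \<longrightarrow> (\<exists>B. \<forall>y. cmod (\<psi> y) \<le> B) \<longrightarrow>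
    (\<integral>x. complex_of_real (u x) * \<psi> (\<Phi> x) \<partial>lborel) = (\<integral>y. complex_of_real (v y) * \<psi> y \<partial>lborel))"
proof -
  have [measurable]: "u \<in> borel_measurable borel" using u by auto
  define L where "L = density lborel (\<lambda>x. ennreal (u x))"
  have [simp]: "sets L = sets borel" by (simp add: L_def)
  have \<Phi>L[measurable]: "\<Phi> \<in> measurable L borel" by (simp add: measurable_cong_sets[OF \<open>sets L = sets borel\<close> refl])
  define M where "M = distr L borel \<Phi>"
  have [simp]: "sets M = sets borel" "space M = UNIV" by (simp_all add: M_def)
  have ac': "absolutely_continuous lborel M"
    unfolding absolutely_continuous_def
  proof
    fix N :: "'b set" assume N: "N \<in> null_sets lborel"
    then have [measurable]: "N \<in> sets borel" by auto
    have "emeasure M N = (\<integral>\<^sup>+x. ennreal (u x) * indicator (\<Phi> -` N) x \<partial>lborel)"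
    proof -
      have "\<Phi> -` N \<in> sets borel" using measurable_sets[OF \<Phi> \<open>N \<in> sets borel\<close>] by simp
      then show ?thesis unfolding M_def by (subst emeasure_distr) (auto simp: L_def emeasure_density)
    qed
    also have "\<dots> = (\<integral>\<^sup>+_. 0 \<partial>(lborel :: 'a measure))"
      using ac[OF N] by (intro nn_integral_cong_AE) (auto elim!: eventually_mono)
    finally show "N \<in> null_sets M" by (auto simp: null_sets_def)
  qed
  define f where "f = RN_deriv lborel M"
  have [measurable]: "f \<in> borel_measurable borel" unfolding f_def using borel_measurable_RN_deriv[of lborel M] by simp
  have dens: "density lborel f = M" unfolding f_def by (rule sigma_finite_measure.density_RN_deriv[OF sigma_finite_lborel ac']) simp
  have "(\<integral>\<^sup>+y. f y \<partial>lborel) = emeasure M UNIV"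
    unfolding dens[symmetric] by (subst emeasure_density) auto
  also have "\<dots> = (\<integral>\<^sup>+x. ennreal (u x) \<partial>lborel)"
    unfolding M_def by (subst emeasure_distr) (auto simp: L_def emeasure_density)
  also have "\<dots> < \<infinity>" using u u0 by (simp add: nn_integral_eq_integral)
  finally have fin: "(\<integral>\<^sup>+y. f y \<partial>lborel) < \<infinity>" .
  then have "AE y in lborel. f y \<noteq> \<infinity>" by (intro nn_integral_PInf_AE) auto
  then have ae: "AE y in lborel. f y = ennreal (enn2real (f y))" by (auto elim!: eventually_mono simp: less_top)
  define v where "v y = enn2real (f y)" for y
  have [measurable]: "v \<in> borel_measurable borel" unfolding v_def[abs_def] by measurable
  have v0: "0 \<le> v y" for y by (simp add: v_def)
  have densv: "density lborel (\<lambda>y. ennreal (v y)) = M"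
    unfolding dens[symmetric] by (rule density_cong) (use ae in \<open>auto simp: v_def elim!: eventually_mono\<close>)
  have "(\<integral>\<^sup>+y. ennreal (v y) \<partial>lborel) = (\<integral>\<^sup>+y. f y \<partial>lborel)"
    using ae by (intro nn_integral_cong_AE) (auto simp: v_def elim!: eventually_mono)
  with fin have v: "integrable lborel v" using v0 by (intro integrableI_bounded) auto
  have "(\<integral>x. complex_of_real (u x) * \<psi> (\<Phi> x) \<partial>lborel) = (\<integral>y. complex_of_real (v y) * \<psi> y \<partial>lborel)"
    if [measurable]: "\<psi> \<in> borel_measurable borel" for \<psi> :: "'b \<Rightarrow> complex"
  proof -
    have "(\<integral>x. complex_of_real (u x) * \<psi> (\<Phi> x) \<partial>lborel) = (\<integral>x. \<psi> (\<Phi> x) \<partial>L)"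
      unfolding L_def using u0 by (subst integral_density) (auto simp: scaleR_conv_of_real)
    also have "\<dots> = (\<integral>y. \<psi> y \<partial>M)"
      unfolding M_def by (rule integral_distr[OF \<Phi>L, symmetric]) measurable
    also have "\<dots> = (\<integral>y. complex_of_real (v y) * \<psi> y \<partial>lborel)"
      unfolding densv[symmetric] using v0 by (subst integral_density) (auto simp: scaleR_conv_of_real)
    finally show ?thesis .
  qed
  then show ?thesis using v by blast
qed

lemma integrable_times_bounded:
  fixes w \<psi> :: "'c \<Rightarrow> complex"
  assumes w: "integrable M w" and \<psi>: "\<psi> \<in> borel_measurable M" "\<And>y. cmod (\<psi> y) \<le> B"
  shows "integrable M (\<lambda>y. w y * \<psi> y)"
proof (rule Bochner_Integration.integrable_bound[OF integrable_mult_right[OF integrable_norm[OF w], of B]])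
  have "cmod (w y * \<psi> y) \<le> norm (B * cmod (w y))" for y
  proof -
    have "cmod (w y * \<psi> y) \<le> cmod (w y) * B" unfolding norm_mult by (intro mult_left_mono \<psi>) auto
    also have "\<dots> \<le> norm (B * cmod (w y))" by (simp add: mult.commute)
    finally show ?thesis .
  qed
  then show "AE y in M. norm (w y * \<psi> y) \<le> norm (B * norm (w y))" by simp
  show "(\<lambda>y. w y * \<psi> y) \<in> borel_measurable M" using w \<psi>(1) by auto
qed

lemma pushforward_density:
  fixes u :: "'a \<Rightarrow> complex"
  assumes u: "integrable lborel u"
  shows "\<exists>v :: 'b \<Rightarrow> complex. integrable lborel v \<and> (\<forall>\<psi> :: 'b \<Rightarrow> complex. \<psi> \<in> borel_measurable borel \<longrightarrow> (\<exists>B. \<forall>y. cmod (\<psi> y) \<le> B) \<longrightarrow>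
    (\<integral>x. u x * \<psi> (\<Phi> x) \<partial>lborel) = (\<integral>y. v y * \<psi> y \<partial>lborel))"
proof -
  \<comment> \<open>The non-negative case is applied four times: \<open>p\<close> lists the positive
    and negative parts of the real and imaginary parts, and \<open>s\<close> below their
    coefficients.\<close>
  define p where "p = (\<lambda>i::nat. case i of 0 \<Rightarrow> (\<lambda>x. max 0 (Re (u x))) | Suc 0 \<Rightarrow> (\<lambda>x. max 0 (- Re (u x)))
    | Suc (Suc 0) \<Rightarrow> (\<lambda>x. max 0 (Im (u x))) | _ \<Rightarrow> (\<lambda>x. max 0 (- Im (u x))))"
  have pint: "integrable lborel (p i)" for i
    using u by (auto simp: p_def split: nat.split intro!: integrable_max)
  have p0: "0 \<le> p i x" for i x by (auto simp: p_def split: nat.split)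
  obtain v where v: "\<And>i. integrable lborel (v i :: 'b \<Rightarrow> real)"
    and vp: "\<And>i \<psi>. \<psi> \<in> borel_measurable borel \<Longrightarrow> \<exists>B. \<forall>y. cmod (\<psi> y) \<le> B \<Longrightarrow>
      (\<integral>x. complex_of_real (p i x) * \<psi> (\<Phi> x) \<partial>lborel) = (\<integral>y. complex_of_real (v i y) * \<psi> y \<partial>lborel)"
    using pushforward_density_nonneg[OF pint p0] by metis
  define s where "s i = (if i = 0 then 1 else if i = 1 then -1 else if i = 2 then \<i> else - \<i>)" for i :: nat
  have us: "u x = (\<Sum>i<4. s i * complex_of_real (p i x))" for x
    by (simp add: s_def p_def numeral_eq_Suc complex_eq_iff max_def)
  define w where "w y = (\<Sum>i<4. s i * complex_of_real (v i y))" for y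
  have w: "integrable lborel w" unfolding w_def[abs_def]
    by (intro Bochner_Integration.integrable_sum integrable_mult_right integrable_of_real v)
  have "(\<integral>x. u x * \<psi> (\<Phi> x) \<partial>lborel) = (\<integral>y. w y * \<psi> y \<partial>lborel)"
    if \<psi>[measurable]: "\<psi> \<in> borel_measurable borel" and B: "\<forall>y. cmod (\<psi> y) \<le> B" for \<psi> B
  proof -
    have B': "\<exists>B. \<forall>y. cmod (\<psi> y) \<le> B" using B by blast
    have 1: "integrable lborel (\<lambda>x. complex_of_real (p i x) * \<psi> (\<Phi> x))" for i
      by (rule integrable_times_bounded[where B=B]) (use pint B in auto)
    have 2: "integrable lborel (\<lambda>y. complex_of_real (v i y) * \<psi> y)" for i
      by (rule integrable_times_bounded[where B=B]) (use v B in auto)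
    have "(\<integral>x. u x * \<psi> (\<Phi> x) \<partial>lborel) = (\<integral>x. (\<Sum>i<4. s i * (complex_of_real (p i x) * \<psi> (\<Phi> x))) \<partial>lborel)"
      unfolding us by (simp add: sum_distrib_right mult.assoc)
    also have "\<dots> = (\<Sum>i<4. s i * (\<integral>x. complex_of_real (p i x) * \<psi> (\<Phi> x) \<partial>lborel))"
      by (subst Bochner_Integration.integral_sum) (intro integrable_mult_right 1, simp only: integral_mult_right_zero)
    also have "\<dots> = (\<Sum>i<4. s i * (\<integral>y. complex_of_real (v i y) * \<psi> y \<partial>lborel))"
      by (simp only: vp[OF \<psi> B'])
    also have "\<dots> = (\<integral>y. (\<Sum>i<4. s i * (complex_of_real (v i y) * \<psi> y)) \<partial>lborel)"
      by (subst Bochner_Integration.integral_sum) (intro integrable_mult_right 2, simp only: integral_mult_right_zero)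
    also have "\<dots> = (\<integral>y. w y * \<psi> y \<partial>lborel)"
      unfolding w_def by (simp add: sum_distrib_right mult.assoc)
    finally show ?thesis .
  qed
  then show ?thesis using w by blast
qed

text \<open>The density \<open>v\<close> belongs to \<open>u\<close> alone, and inserting
  \<open>indicator (E k) (\<Phi> x)\<close> merely restricts it to \<open>E k\<close>. Plancherel
  for the restrictions turns the claim into countable additivity of the integral of
  \<open>\<bar>v\<bar>\<close> squared.\<close>

lemma plancherel_disjoint_images:
  fixes u :: "'a \<Rightarrow> complex" and E :: "nat \<Rightarrow> 'b set"
  assumes u: "integrable lborel u" and E[measurable]: "\<And>k. E k \<in> sets borel" and disj: "disjoint_family E"
    and u0: "\<And>x. \<Phi> x \<notin> (\<Union>k. E k) \<Longrightarrow> u x = 0"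
  shows "(\<integral>\<^sup>+a. ennreal ((cmod (\<integral>x. u x * cis (2 * pi * (\<Phi> x \<bullet> a)) \<partial>lborel))\<^sup>2) \<partial>lborel)
    = (\<Sum>k. \<integral>\<^sup>+a. ennreal ((cmod (\<integral>x. (u x * complex_of_real (indicator (E k) (\<Phi> x))) * cis (2 * pi * (\<Phi> x \<bullet> a)) \<partial>lborel))\<^sup>2) \<partial>lborel)"
proof -
  obtain v where v: "integrable lborel v" and vp: "\<And>\<psi> :: 'b \<Rightarrow> complex. \<psi> \<in> borel_measurable borel \<Longrightarrow> \<exists>B. \<forall>y. cmod (\<psi> y) \<le> B \<Longrightarrow>
    (\<integral>x. u x * \<psi> (\<Phi> x) \<partial>lborel) = (\<integral>y. v y * \<psi> y \<partial>lborel)"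
    using pushforward_density[OF u] by blast
  have [measurable]: "v \<in> borel_measurable borel" using v by auto
  have main: "(\<integral>\<^sup>+a. ennreal ((cmod (\<integral>x. (u x * complex_of_real (indicator A (\<Phi> x))) * cis (2 * pi * (\<Phi> x \<bullet> a)) \<partial>lborel))\<^sup>2) \<partial>lborel)
     = (\<integral>\<^sup>+y. ennreal ((cmod (v y))\<^sup>2) * indicator A y \<partial>lborel)" if [measurable]: "A \<in> sets borel" for A
  proof -
    have "(\<integral>x. (u x * complex_of_real (indicator A (\<Phi> x))) * cis (2 * pi * (\<Phi> x \<bullet> a)) \<partial>lborel)
      = (\<integral>y. (v y * complex_of_real (indicator A y)) * cis (2 * pi * (y \<bullet> a)) \<partial>lborel)" for a
    proof -
      have "(\<integral>x. u x * (\<lambda>y. complex_of_real (indicator A y) * cis (2 * pi * (y \<bullet> a))) (\<Phi> x) \<partial>lborel)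
        = (\<integral>y. v y * (\<lambda>y. complex_of_real (indicator A y) * cis (2 * pi * (y \<bullet> a))) y \<partial>lborel)"
        by (rule vp) (measurable, auto simp: norm_mult indicator_def intro!: exI[of _ 1])
      then show ?thesis by (simp add: mult.assoc)
    qed
    moreover have "integrable lborel (\<lambda>y. v y * complex_of_real (indicator A y))"
      by (rule integrable_times_bounded[OF v, where B=1]) (auto simp: indicator_def)
    ultimately have "(\<integral>\<^sup>+a. ennreal ((cmod (\<integral>x. (u x * complex_of_real (indicator A (\<Phi> x))) * cis (2 * pi * (\<Phi> x \<bullet> a)) \<partial>lborel))\<^sup>2) \<partial>lborel)
      = (\<integral>\<^sup>+y. ennreal ((cmod (v y * complex_of_real (indicator A y)))\<^sup>2) \<partial>lborel)"
      using plancherel_L1 by simp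
    also have "\<dots> = (\<integral>\<^sup>+y. ennreal ((cmod (v y))\<^sup>2) * indicator A y \<partial>lborel)"
      by (intro nn_integral_cong) (auto simp: indicator_def)
    finally show ?thesis .
  qed
  have "u x * complex_of_real (indicator (\<Union>k. E k) (\<Phi> x)) = u x" for x
    using u0[of x] by (auto simp: indicator_def)
  with main[of "\<Union>k. E k"] have "(\<integral>\<^sup>+a. ennreal ((cmod (\<integral>x. u x * cis (2 * pi * (\<Phi> x \<bullet> a)) \<partial>lborel))\<^sup>2) \<partial>lborel)
      = (\<integral>\<^sup>+y. ennreal ((cmod (v y))\<^sup>2) * indicator (\<Union>k. E k) y \<partial>lborel)"
    by simp
  also have "\<dots> = (\<integral>\<^sup>+y. (\<Sum>k. ennreal ((cmod (v y))\<^sup>2) * indicator (E k) y) \<partial>lborel)"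
    using suminf_indicator[OF disj] by simp
  also have "\<dots> = (\<Sum>k. \<integral>\<^sup>+y. ennreal ((cmod (v y))\<^sup>2) * indicator (E k) y \<partial>lborel)"
    by (rule nn_integral_suminf) measurable
  finally show ?thesis by (simp add: main)
qed

end

section \<open>The modulus of a left Haar measure\<close>

locale haar_group =
  fixes mul :: "'h::{t2_space, second_countable_topology} \<Rightarrow> 'h \<Rightarrow> 'h"
    and e :: 'h and hinv :: "'h \<Rightarrow> 'h" and dh :: "'h measure"
  assumes group: "lcsc_group mul e hinv" and haar: "left_haar_measure mul dh"
begin

lemma assoc: "mul (mul x y) z = mul x (mul y z)"
  and unit[simp]: "mul e x = x" "mul x e = x"
  and inv[simp]: "mul (hinv x) x = e" "mul x (hinv x) = e"
  and cont_mul: "continuous_on UNIV (\<lambda>p. mul (fst p) (snd p))"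
  and cont_inv: "continuous_on UNIV hinv"
  and loc_compact: "locally_compact_space (euclidean :: 'h topology)"
  using group by (auto simp: lcsc_group_def)

lemma inv_cancel[simp]: "mul (hinv x) (mul x y) = y" "mul x (mul (hinv x) y) = y"
  by (simp_all add: assoc[symmetric])

lemma inv_cancel_right[simp]: "mul (mul y (hinv x)) x = y" "mul (mul y x) (hinv x) = y"
  by (simp_all add: assoc)

lemma inv_unique: "mul x y = e \<Longrightarrow> y = hinv x"
  by (metis inv_cancel(1) unit(2))

lemma inv_inv[simp]: "hinv (hinv x) = x"
  using inv_unique[of "hinv x" x] by simp

lemma inv_mul: "hinv (mul x y) = mul (hinv y) (hinv x)"
  by (rule inv_unique[symmetric]) (simp add: assoc)

lemma inv_e[simp]: "hinv e = e" using inv_unique[of e e] by simp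

lemma cont_mul2[continuous_intros]: "continuous_on S f \<Longrightarrow> continuous_on S g \<Longrightarrow> continuous_on S (\<lambda>x. mul (f x) (g x))"
  using continuous_on_compose2[OF cont_mul, of S "\<lambda>x. (f x, g x)"] by (simp add: continuous_on_Pair)

lemma cont_inv2[continuous_intros]: "continuous_on S f \<Longrightarrow> continuous_on S (\<lambda>x. hinv (f x))"
  by (rule continuous_on_compose2[OF cont_inv]) auto

lemma mul_meas[measurable (raw)]:
  "f \<in> borel_measurable M \<Longrightarrow> g \<in> borel_measurable M \<Longrightarrow> (\<lambda>x. mul (f x) (g x)) \<in> borel_measurable M"
  by (rule borel_measurable_continuous_Pair[OF _ _ cont_mul])

lemma inv_meas[measurable (raw)]:
  "f \<in> borel_measurable M \<Longrightarrow> (\<lambda>x. hinv (f x)) \<in> borel_measurable M"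
  by (rule borel_measurable_continuous_on[OF cont_inv])

lemma sets_dh[simp, measurable_cong]: "sets dh = sets borel"
  using haar by (simp add: left_haar_measure_def)

lemma space_dh[simp]: "space dh = UNIV"
  using sets_eq_imp_space_eq[OF sets_dh] by simp

lemma dh_compact: "compact K \<Longrightarrow> emeasure dh K < \<infinity>"
  and dh_open: "open U \<Longrightarrow> U \<noteq> {} \<Longrightarrow> 0 < emeasure dh U"
  using haar by (auto simp: left_haar_measure_def)

text \<open>Covering by interiors lets every compact set be caught inside a single
  \<open>K i\<close>. The interior of \<open>K 0\<close> later serves as a reference set of positive
  finite Haar measure.\<close>

lemma compact_exhaustion:
  obtains K :: "nat \<Rightarrow> 'h set" where "\<And>i. compact (K i)" "\<And>i. K i \<subseteq> K (Suc i)"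
    "(\<Union>i. interior (K i)) = UNIV" "\<And>C. compact C \<Longrightarrow> \<exists>i. C \<subseteq> interior (K i)"
    "e \<in> K 0" "interior (K 0) \<noteq> {}"
proof -
  have ex: "\<exists>U V. open U \<and> compact V \<and> x \<in> U \<and> U \<subseteq> V" for x :: 'h
  proof -
    have "\<forall>x\<in>topspace (euclidean :: 'h topology). \<exists>U K. openin euclidean U \<and> compactin euclidean K \<and> x \<in> U \<and> U \<subseteq> K"
      using loc_compact by (simp only: locally_compact_space_def)
    then show ?thesis by (simp only: topspace_euclidean open_openin[symmetric] compactin_euclidean_iff UNIV_I ball_UNIV)
  qed
  define \<F> where "\<F> = {interior V | V :: 'h set. compact V}"
  have "open S" if "S \<in> \<F>" for S using that by (auto simp: \<F>_def)
  then obtain \<F>' where F: "\<F>' \<subseteq> \<F>" "countable \<F>'" "\<Union>\<F>' = \<Union>\<F>" using Lindelof by metis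
  have UF: "\<Union>\<F> = UNIV"
  proof -
    have "x \<in> \<Union>\<F>" for x
    proof -
      obtain U V where "open U" "compact V" "x \<in> U" "U \<subseteq> V" using ex[of x] by (elim exE conjE) (rule that)
      then have "x \<in> interior V" "interior V \<in> \<F>" by (auto simp: \<F>_def interior_def)
      then show ?thesis by blast
    qed
    then show ?thesis by blast
  qed
  then have ne: "\<F>' \<noteq> {}" using F(3) by auto
  have "\<forall>i. \<exists>V. compact V \<and> from_nat_into \<F>' i = interior V"
    using from_nat_into[OF ne] F(1) unfolding \<F>_def by blast
  then obtain V where V: "\<And>i. compact (V i)" "\<And>i. from_nat_into \<F>' i = interior (V i)" by metis
  have UV: "(\<Union>i. interior (V i)) = UNIV"
  proof -
    have "\<Union>\<F>' = (\<Union>i. interior (V i))"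
      by (subst range_from_nat_into[OF ne F(2), symmetric]) (simp add: V(2))
    then show ?thesis using F(3) UF by simp
  qed
  obtain U0 V0 where UV0: "open U0" "compact V0" "e \<in> U0" "U0 \<subseteq> V0" using ex[of e] by (elim exE conjE) (rule that)
  define K where "K i = V0 \<union> (\<Union>j\<le>i. V j)" for i
  have cK: "compact (K i)" for i unfolding K_def using UV0(2) V(1) by (intro compact_Un compact_UN) auto
  have mono: "K i \<subseteq> K j" if "i \<le> j" for i j using that by (auto simp: K_def)
  have Ui: "(\<Union>i. interior (K i)) = UNIV"
  proof -
    have "interior (V i) \<subseteq> interior (K i)" for i by (intro interior_mono) (auto simp: K_def)
    then have "(\<Union>i. interior (V i)) \<subseteq> (\<Union>i. interior (K i))" by (intro UN_mono subset_refl)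
    then show ?thesis using UV by (simp add: top.extremum_unique)
  qed
  have sub: "\<exists>i. C \<subseteq> interior (K i)" if c: "compact C" for C
  proof -
    have "C \<subseteq> (\<Union>i\<in>UNIV. interior (K i))" using Ui by simp
    then obtain I where I: "finite I" "C \<subseteq> (\<Union>i\<in>I. interior (K i))"
      using compactE_image[OF c, of UNIV "\<lambda>i. interior (K i)"] by (metis open_interior)
    have "interior (K i) \<subseteq> interior (K (Max I))" if "i \<in> I" for i
      using I(1) that by (intro interior_mono mono) auto
    then show ?thesis using I(2) by blast
  qed
  have "e \<in> interior (K 0)" using UV0 by (auto simp: K_def interior_def)
  then have "e \<in> K 0" "interior (K 0) \<noteq> {}" using interior_subset[of "K 0"] by auto
  moreover have "K i \<subseteq> K (Suc i)" for i by (rule mono) simp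
  ultimately show ?thesis using that[OF cK _ Ui sub] by auto
qed

lemma sigma_finite_dh: "sigma_finite_measure dh"
proof -
  obtain K :: "nat \<Rightarrow> 'h set" where K: "\<And>i. compact (K i)" "\<And>i. K i \<subseteq> K (Suc i)"
    "(\<Union>i. interior (K i)) = UNIV" "\<And>C. compact C \<Longrightarrow> \<exists>i. C \<subseteq> interior (K i)" "e \<in> K 0" "interior (K 0) \<noteq> {}"
    by (rule compact_exhaustion) (rule that)
  have "(\<Union>i. interior (K i)) \<subseteq> (\<Union>i. K i)" by (intro UN_mono subset_refl interior_subset)
  then have U: "(\<Union>i. K i) = UNIV" unfolding K(3) by (rule top.extremum_uniqueI)
  show ?thesis
  proof (rule sigma_finite_measure.intro, intro exI[of _ "range K"] conjI ballI)
    show "range K \<subseteq> sets dh" using K(1) by (auto intro!: borel_closed compact_imp_closed)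
    show "emeasure dh A \<noteq> \<infinity>" if "A \<in> range K" for A using that dh_compact[OF K(1)] by (auto simp: less_top)
  qed (simp_all add: U)
qed

sublocale dh: sigma_finite_measure dh by (rule sigma_finite_dh)

sublocale dh2: pair_sigma_finite dh dh ..

lemma vimage_mul: "mul k -` E = mul (hinv k) ` E"
  by (auto simp: image_iff) (metis inv_cancel(1))

lemma emeasure_vimage_mul: "E \<in> sets borel \<Longrightarrow> emeasure dh (mul k -` E) = emeasure dh E"
  unfolding vimage_mul using haar by (simp add: left_haar_measure_def)

lemma distr_mul: "distr dh borel (mul k) = dh"
  by (rule measure_eqI) (auto simp: emeasure_distr emeasure_vimage_mul)

lemma nn_integral_left:
  assumes [measurable]: "f \<in> borel_measurable borel"
  shows "(\<integral>\<^sup>+h. f (mul k h) \<partial>dh) = (\<integral>\<^sup>+h. f h \<partial>dh)"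
  by (subst (2) distr_mul[of k, symmetric]) (simp add: nn_integral_distr)

section \<open>Right translates of Haar measure\<close>

text \<open>The measure of the right translate of \<open>A\<close> by the inverse of
  \<open>k\<close>; as a preimage the translate is visibly Borel.\<close>

definition rt :: "'h \<Rightarrow> 'h set \<Rightarrow> ennreal" where "rt k A = emeasure dh ((\<lambda>h. mul h k) -` A)"

lemma rt_nn: "A \<in> sets borel \<Longrightarrow> rt k A = (\<integral>\<^sup>+h. indicator A (mul h k) \<partial>dh)"
proof -
  assume A[measurable]: "A \<in> sets borel"
  have "(\<lambda>h. mul h k) -` A \<in> sets borel" using measurable_sets[of "\<lambda>h. mul h k" borel borel A] by simp
  then have "rt k A = (\<integral>\<^sup>+h. indicator ((\<lambda>h. mul h k) -` A) h \<partial>dh)" unfolding rt_def by simp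
  also have "\<dots> = (\<integral>\<^sup>+h. indicator A (mul h k) \<partial>dh)" by (intro nn_integral_cong) (auto simp: indicator_def)
  finally show ?thesis .
qed

lemma rt_meas: "A \<in> sets borel \<Longrightarrow> (\<lambda>k. rt k A) \<in> borel_measurable borel"
proof -
  assume A[measurable]: "A \<in> sets borel"
  have "(\<lambda>k. \<integral>\<^sup>+h. indicator A (mul h k) \<partial>dh) \<in> borel_measurable borel" by measurable
  then show ?thesis by (simp add: rt_nn[OF A])
qed

text \<open>Two substitutions by left invariance, one in each variable, decouple the double
  integral. Its dependence on \<open>A\<close> is then through \<open>emeasure dh A\<close> only, so
  \<open>rt x A\<close> and \<open>rt x C\<close> are proportional as densities in
  \<open>x\<close>.\<close>

lemma rt_fubini:
  assumes A[measurable]: "A \<in> sets borel" and B[measurable]: "B \<in> sets borel"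
  shows "(\<integral>\<^sup>+x. rt x A * indicator B x \<partial>dh) = emeasure dh A * emeasure dh (hinv -` B)"
proof -
  have iB: "hinv -` B \<in> sets borel" using measurable_sets[of hinv borel borel B] inv_meas[of "\<lambda>x. x" borel] by simp
  have "(\<integral>\<^sup>+x. rt x A * indicator B x \<partial>dh) = (\<integral>\<^sup>+x. \<integral>\<^sup>+y. indicator A (mul y x) * indicator B x \<partial>dh \<partial>dh)"
    by (intro nn_integral_cong) (simp add: rt_nn[OF A] nn_integral_multc)
  also have "\<dots> = (\<integral>\<^sup>+y. \<integral>\<^sup>+x. indicator A (mul y x) * indicator B x \<partial>dh \<partial>dh)"
    by (rule dh2.Fubini') measurable
  also have "\<dots> = (\<integral>\<^sup>+y. \<integral>\<^sup>+x. indicator A x * indicator B (mul (hinv y) x) \<partial>dh \<partial>dh)"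
  proof (rule nn_integral_cong)
    fix y
    have "(\<lambda>x. indicator A x * indicator B (mul (hinv y) x) :: ennreal) \<in> borel_measurable borel" by measurable
    from nn_integral_left[OF this, of y]
    show "(\<integral>\<^sup>+x. indicator A (mul y x) * indicator B x \<partial>dh) = (\<integral>\<^sup>+x. indicator A x * indicator B (mul (hinv y) x) \<partial>dh)" by simp
  qed
  also have "\<dots> = (\<integral>\<^sup>+x. \<integral>\<^sup>+y. indicator A x * indicator B (mul (hinv y) x) \<partial>dh \<partial>dh)"
    by (rule dh2.Fubini') measurable
  also have "\<dots> = (\<integral>\<^sup>+x. indicator A x * emeasure dh (hinv -` B) \<partial>dh)"
  proof (rule nn_integral_cong)
    fix x
    have "(\<lambda>y. indicator B (mul (hinv y) x) :: ennreal) \<in> borel_measurable borel" by measurable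
    from nn_integral_left[OF this, of x]
    have "(\<integral>\<^sup>+y. indicator B (mul (hinv y) x) \<partial>dh) = (\<integral>\<^sup>+y. indicator B (hinv y) \<partial>dh)"
      by (simp add: inv_mul assoc)
    also have "\<dots> = (\<integral>\<^sup>+y. indicator (hinv -` B) y \<partial>dh)" by (intro nn_integral_cong) (auto simp: indicator_def)
    also have "\<dots> = emeasure dh (hinv -` B)" using iB by simp
    finally show "(\<integral>\<^sup>+y. indicator A x * indicator B (mul (hinv y) x) \<partial>dh) = indicator A x * emeasure dh (hinv -` B)"
      by (simp add: nn_integral_cmult)
  qed
  also have "\<dots> = emeasure dh A * emeasure dh (hinv -` B)" by (simp add: nn_integral_multc)
  finally show ?thesis .
qed

lemma rt_mul: "rt (mul x y) A = rt x ((\<lambda>h. mul h y) -` A)"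
  unfolding rt_def vimage_def by (simp add: assoc)

text \<open>The right translates of \<open>dh\<close> are multiples of \<open>dh\<close>: by the identity above this holds for almost all
  translations, and a conull subgroup of \<open>H\<close> is all of \<open>H\<close>.\<close>

lemma right_translate_AE:
  assumes A[measurable]: "A \<in> sets borel" and C[measurable]: "C \<in> sets borel"
  shows "AE x in dh. emeasure dh C * rt x A = emeasure dh A * rt x C"
proof (rule dh.density_unique)
  note [measurable] = rt_meas[OF A] rt_meas[OF C]
  show "(\<lambda>x. emeasure dh C * rt x A) \<in> borel_measurable dh" "(\<lambda>x. emeasure dh A * rt x C) \<in> borel_measurable dh" by measurable
  show "density dh (\<lambda>x. emeasure dh C * rt x A) = density dh (\<lambda>x. emeasure dh A * rt x C)"
  proof (rule measure_eqI)
    fix B assume "B \<in> sets (density dh (\<lambda>x. emeasure dh C * rt x A))"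
    then have B[measurable]: "B \<in> sets borel" by simp
    have "emeasure (density dh (\<lambda>x. emeasure dh C * rt x A)) B = emeasure dh C * (\<integral>\<^sup>+x. rt x A * indicator B x \<partial>dh)"
      by (subst emeasure_density) (auto simp: mult.assoc nn_integral_cmult)
    also have "\<dots> = emeasure dh A * (\<integral>\<^sup>+x. rt x C * indicator B x \<partial>dh)"
      unfolding rt_fubini[OF A B] rt_fubini[OF C B] by (simp add: mult_ac)
    also have "\<dots> = emeasure (density dh (\<lambda>x. emeasure dh A * rt x C)) B"
      by (subst emeasure_density) (auto simp: mult.assoc nn_integral_cmult)
    finally show "emeasure (density dh (\<lambda>x. emeasure dh C * rt x A)) B = emeasure (density dh (\<lambda>x. emeasure dh A * rt x C)) B" .
  qed simp
qed

text \<open>\<open>D\<close> is the reciprocal of \<open>\<Delta>_H\<close> in the convention where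
  the translate \<open>A k\<close> has \<open>\<Delta>_H k\<close> times the measure of
  \<open>A\<close>. Boundedness on compact sets will bound \<open>\<delta>\<close> on the sets of
  returns.\<close>

lemma right_haar_modulus:
  shows "\<exists>D. (\<forall>k. 0 < D k) \<and> (\<forall>x y. D (mul x y) = D x * D y) \<and> (\<forall>C. compact C \<longrightarrow> (\<exists>b. \<forall>k\<in>C. D k \<le> b)) \<and>
    (\<forall>k A. A \<in> sets borel \<longrightarrow> rt k A = ennreal (D k) * emeasure dh A)"
proof -
  obtain K :: "nat \<Rightarrow> 'h set" where K: "\<And>i. compact (K i)" "\<And>i. K i \<subseteq> K (Suc i)"
    "(\<Union>i. interior (K i)) = UNIV" "\<And>C. compact C \<Longrightarrow> \<exists>i. C \<subseteq> interior (K i)" "e \<in> K 0" "interior (K 0) \<noteq> {}"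
    by (rule compact_exhaustion) (rule that)
  define A1 where "A1 = interior (K 0)"
  have A1[measurable]: "A1 \<in> sets borel" by (simp add: A1_def)
  have A1pos: "0 < emeasure dh A1" unfolding A1_def using K(6) by (intro dh_open) auto
  have KB: "K i \<in> sets borel" for i using K(1) by (intro borel_closed compact_imp_closed)
  have A1fin: "emeasure dh A1 < \<infinity>"
    using emeasure_mono[OF interior_subset, of "K 0" dh] KB dh_compact[OF K(1), of 0] by (auto simp: A1_def intro: le_less_trans)
  have img: "compact ((\<lambda>p. mul (fst p) (hinv (snd p))) ` (K 0 \<times> C))" if "compact C" for C
    by (intro compact_continuous_image compact_Times continuous_intros K(1) that)
  have vi: "(\<lambda>h. mul h k) -` K0 \<subseteq> (\<lambda>p. mul (fst p) (hinv (snd p))) ` (K0 \<times> C)" if "k \<in> C" for k K0 C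
  proof
    fix h assume "h \<in> (\<lambda>h. mul h k) -` K0"
    then have "(mul h k, k) \<in> K0 \<times> C" using that by auto
    then show "h \<in> (\<lambda>p. mul (fst p) (hinv (snd p))) ` (K0 \<times> C)" by (rule rev_image_eqI) simp
  qed
  have meas_vi: "(\<lambda>h. mul h k) -` A \<in> sets borel" if "A \<in> sets borel" for A k
    using measurable_sets[of "\<lambda>h. mul h k" borel borel A] that by simp
  have rtA1_fin: "rt k A1 < \<infinity>" for k
  proof -
    have sub: "(\<lambda>h. mul h k) -` A1 \<subseteq> (\<lambda>p. mul (fst p) (hinv (snd p))) ` (K 0 \<times> {k})"
      using vi[of k "{k}" "K 0"] interior_subset by (fastforce simp: A1_def)
    have c: "compact ((\<lambda>p. mul (fst p) (hinv (snd p))) ` (K 0 \<times> {k}))" by (rule img) simp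
    have "rt k A1 \<le> emeasure dh ((\<lambda>p. mul (fst p) (hinv (snd p))) ` (K 0 \<times> {k}))"
      unfolding rt_def by (rule emeasure_mono[OF sub]) (simp add: borel_closed compact_imp_closed c)
    also have "\<dots> < \<infinity>" using c by (rule dh_compact)
    finally show ?thesis .
  qed
  have rtA1_pos: "0 < rt k A1" for k
  proof -
    have "open ((\<lambda>h. mul h k) -` A1)"
      by (rule open_vimage) (auto simp: A1_def intro!: continuous_intros)
    moreover obtain a where "a \<in> A1" using K(6) by (auto simp: A1_def)
    then have "mul a (hinv k) \<in> (\<lambda>h. mul h k) -` A1" by simp
    then have "(\<lambda>h. mul h k) -` A1 \<noteq> {}" by blast
    ultimately show ?thesis unfolding rt_def by (intro dh_open) auto
  qed
  define b where "b = enn2real (emeasure dh A1)"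
  have b: "ennreal b = emeasure dh A1" "0 < b"
    using A1fin A1pos by (simp_all add: b_def enn2real_positive_iff)
  \<comment> \<open>The factor is read off on the reference set \<open>A1\<close>, which has
    positive finite measure, as do all its right translates.\<close>
  define D where "D k = enn2real (rt k A1) / b" for k
  have D: "ennreal (D k) * emeasure dh A1 = rt k A1" and Dpos: "0 < D k" for k
  proof -
    show "0 < D k" using b(2) rtA1_fin[of k] rtA1_pos[of k] by (simp add: D_def enn2real_positive_iff)
    have "ennreal (D k) * ennreal b = ennreal (D k * b)"
      using b(2) by (intro ennreal_mult[symmetric]) (simp_all add: D_def)
    also have "\<dots> = rt k A1" using b(2) rtA1_fin[of k] by (simp add: D_def)
    finally show "ennreal (D k) * emeasure dh A1 = rt k A1" unfolding b(1) .
  qed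
  have cancel: "x = y" if "emeasure dh A1 * x = emeasure dh A1 * y" for x y
    using that A1pos A1fin by (auto simp: ennreal_mult_cancel_left)
  define G where "G = {k. \<forall>A\<in>sets borel. rt k A = ennreal (D k) * emeasure dh A}"
  obtain \<B> :: "'h set set" where \<B>: "countable \<B>" "topological_basis \<B>" using ex_countable_basis by blast
  define \<B>' where "\<B>' = {B \<in> \<B>. \<exists>i. B \<subseteq> K i}"
  have B'c: "countable \<B>'" unfolding \<B>'_def using \<B>(1) by auto
  have B'b: "topological_basis \<B>'"
  proof (rule topological_basisI)
    show "open B" if "B \<in> \<B>'" for B using that topological_basis_open[OF \<B>(2)] by (auto simp: \<B>'_def)
    fix U x assume U: "open U" "x \<in> (U :: 'h set)"
    obtain i where i: "x \<in> interior (K i)" using K(3) by blast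
    obtain B where "B \<in> \<B>" "x \<in> B" "B \<subseteq> U \<inter> interior (K i)"
      using topological_basisE[OF \<B>(2), of "U \<inter> interior (K i)" x] U i by auto
    then show "\<exists>B'\<in>\<B>'. x \<in> B' \<and> B' \<subseteq> U"
      using interior_subset[of "K i"] by (intro bexI[of _ B]) (auto simp: \<B>'_def)
  qed
  \<comment> \<open>Proportionality for one set holds up to a null set of translations that depends
    on the set. Countably many sets of finite measure, stable under intersection and generating the
    Borel sets, allow one null set for all.\<close>
  define \<E> where "\<E> = Inter ` {F. finite F \<and> F \<subseteq> \<B>' \<and> F \<noteq> {}}"
  have Ec: "countable \<E>" unfolding \<E>_def
    by (rule countable_image, rule countable_subset[OF _ countable_Collect_finite_subset[OF B'c]]) auto
  have Bo: "open B" if "B \<in> \<B>'" for B using topological_basis_open[OF B'b that] .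
  have Eb: "E \<in> sets borel" if "E \<in> \<E>" for E
    using that Bo unfolding \<E>_def by (auto intro!: borel_open open_Inter)
  have BE: "\<B>' \<subseteq> \<E>" unfolding \<E>_def by (auto intro!: image_eqI[where x="{_}"])
  have Eint: "Int_stable \<E>"
  proof (rule Int_stableI)
    fix a b assume "a \<in> \<E>" "b \<in> \<E>"
    then obtain F F' where "finite F" "F \<subseteq> \<B>'" "F \<noteq> {}" "a = \<Inter>F" "finite F'" "F' \<subseteq> \<B>'" "b = \<Inter>F'"
      by (auto simp: \<E>_def)
    then show "a \<inter> b \<in> \<E>" unfolding \<E>_def by (intro image_eqI[where x="F \<union> F'"]) auto
  qed
  have sE: "sigma_sets UNIV \<E> = sets borel"
  proof
    have "sets borel = sigma_sets UNIV \<B>'" unfolding borel_eq_countable_basis[OF B'c B'b] by simp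
    also have "\<dots> \<subseteq> sigma_sets UNIV \<E>" using BE by (rule sigma_sets_mono')
    finally show "sets borel \<subseteq> sigma_sets UNIV \<E>" .
    show "sigma_sets UNIV \<E> \<subseteq> sets borel" using Eb sets.sigma_sets_subset[of \<E> borel] by auto
  qed
  have "AE x in dh. \<forall>E\<in>\<E>. emeasure dh A1 * rt x E = emeasure dh E * rt x A1"
    using right_translate_AE[OF Eb A1] Ec by (simp add: AE_ball_countable)
  moreover have inG: "x \<in> G" if x: "\<forall>E\<in>\<E>. emeasure dh A1 * rt x E = emeasure dh E * rt x A1" for x
  proof -
    have sc: "rt x E = ennreal (D x) * emeasure dh E" if E: "E \<in> \<E>" for E
    proof -
      have "emeasure dh A1 * rt x E = emeasure dh A1 * (ennreal (D x) * emeasure dh E)"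
        using x E by (simp add: D[symmetric] mult_ac)
      then show ?thesis by (rule cancel)
    qed
    have "distr dh borel (\<lambda>h. mul h x) = density dh (\<lambda>_. ennreal (D x))"
    proof (rule measure_eqI_generator_eq_countable[OF Eint, where \<Omega>=UNIV and A="\<B>'"])
      show "emeasure (distr dh borel (\<lambda>h. mul h x)) E = emeasure (density dh (\<lambda>_. ennreal (D x))) E" if "E \<in> \<E>" for E
        using sc[OF that] Eb[OF that] by (simp add: emeasure_distr rt_def emeasure_density nn_integral_cmult_indicator)
      show "\<Union>\<B>' = UNIV" using topological_basisE[OF B'b open_UNIV] by (metis UNIV_I UnionI UNIV_eq_I)
      fix a assume a: "a \<in> \<B>'"
      then obtain i where "a \<subseteq> K i" by (auto simp: \<B>'_def)
      then have "emeasure dh a < \<infinity>"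
        using emeasure_mono[of a "K i" dh] KB dh_compact[OF K(1), of i] by (auto intro: le_less_trans)
      moreover have "a \<in> \<E>" using a BE by auto
      ultimately show "emeasure (distr dh borel (\<lambda>h. mul h x)) a \<noteq> \<infinity>"
        using sc[of a] Eb[of a] by (auto simp: emeasure_distr rt_def ennreal_mult_eq_top_iff)
    qed (use BE B'c sE in auto)
    then have eq: "emeasure (distr dh borel (\<lambda>h. mul h x)) A = emeasure (density dh (\<lambda>_. ennreal (D x))) A" for A by simp
    have "rt x A = ennreal (D x) * emeasure dh A" if A: "A \<in> sets borel" for A
    proof -
      have "rt x A = emeasure (distr dh borel (\<lambda>h. mul h x)) A"
        unfolding rt_def using A by (subst emeasure_distr) auto
      also have "\<dots> = ennreal (D x) * emeasure dh A"
        unfolding eq using A by (subst emeasure_density) (auto simp: nn_integral_cmult_indicator)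
      finally show ?thesis .
    qed
    then show ?thesis unfolding G_def by blast
  qed
  ultimately have GAE: "AE x in dh. x \<in> G" by (auto elim: eventually_mono)
  have Gmul: "mul x y \<in> G" if "x \<in> G" "y \<in> G" for x y
  proof -
    have r: "rt (mul x y) A = ennreal (D x) * (ennreal (D y) * emeasure dh A)" if A: "A \<in> sets borel" for A
    proof -
      have "rt (mul x y) A = ennreal (D x) * emeasure dh ((\<lambda>h. mul h y) -` A)"
        unfolding rt_mul using \<open>x \<in> G\<close> meas_vi[OF A] by (simp add: G_def)
      also have "emeasure dh ((\<lambda>h. mul h y) -` A) = ennreal (D y) * emeasure dh A"
        using \<open>y \<in> G\<close> A by (simp add: G_def rt_def)
      finally show ?thesis .
    qed
    have "emeasure dh A1 * ennreal (D (mul x y)) = emeasure dh A1 * (ennreal (D x) * ennreal (D y))"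
      using r[OF A1] D[of "mul x y"] by (simp add: mult_ac)
    then have "ennreal (D (mul x y)) = ennreal (D x) * ennreal (D y)" by (rule cancel)
    with r show ?thesis by (simp add: G_def mult_ac)
  qed
  have Ginv: "hinv x \<in> G" if "x \<in> G" for x
  proof -
    have r: "emeasure dh A = ennreal (D x) * rt (hinv x) A" if A: "A \<in> sets borel" for A
    proof -
      have "emeasure dh A = rt (mul x (hinv x)) A" by (simp add: rt_def vimage_def)
      also have "\<dots> = ennreal (D x) * rt (hinv x) A"
        unfolding rt_mul using \<open>x \<in> G\<close> meas_vi[OF A] by (simp add: G_def rt_def)
      finally show ?thesis .
    qed
    have "rt (hinv x) A = ennreal (D (hinv x)) * emeasure dh A" if A: "A \<in> sets borel" for A
    proof -
      have "ennreal (D x) * ennreal (D (hinv x)) = 1"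
      proof -
        have "emeasure dh A1 * (ennreal (D x) * ennreal (D (hinv x))) = emeasure dh A1 * 1"
          using r[OF A1] D[of "hinv x"] by (simp add: mult_ac)
        then show ?thesis by (rule cancel)
      qed
      then have "rt (hinv x) A = (ennreal (D x) * ennreal (D (hinv x))) * rt (hinv x) A" by simp
      also have "\<dots> = ennreal (D (hinv x)) * (ennreal (D x) * rt (hinv x) A)" by (simp only: mult_ac)
      also have "\<dots> = ennreal (D (hinv x)) * emeasure dh A" using r[OF A] by simp
      finally show ?thesis .
    qed
    then show ?thesis by (simp add: G_def)
  qed
  \<comment> \<open>The exceptional null set and its translate cannot cover the group, so some
    \<open>x\<close> has both \<open>x\<close> and \<open>mul k x\<close> in the subgroup
    \<open>G\<close>, and \<open>k\<close> is their quotient.\<close>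
  have all: "k \<in> G" for k
  proof -
    from GAE obtain N where N: "N \<in> null_sets dh" "- G \<subseteq> N" unfolding eventually_ae_filter by (auto simp: Compl_eq)
    have Nb: "N \<in> sets borel" using N by auto
    have "mul k -` N \<in> null_sets dh"
      using emeasure_vimage_mul[OF Nb, of k] measurable_sets[of "mul k" borel borel N] N Nb by (auto simp: null_sets_def)
    with N(1) have "N \<union> mul k -` N \<in> null_sets dh" by (rule null_sets.Un)
    moreover have "emeasure dh UNIV > 0" by (intro dh_open) auto
    ultimately have "N \<union> mul k -` N \<noteq> UNIV" by (auto simp: null_sets_def)
    then obtain x where "x \<in> G" "mul k x \<in> G" using N(2) by blast
    then have "mul (mul k x) (hinv x) \<in> G" using Gmul Ginv by blast
    then show ?thesis by simp
  qed
  show ?thesis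
  proof (intro exI[of _ D] conjI allI impI)
    show "0 < D k" for k by (rule Dpos)
    show rtD: "rt k A = ennreal (D k) * emeasure dh A" if "A \<in> sets borel" for k A using all[of k] that by (simp add: G_def)
    show "D (mul x y) = D x * D y" for x y
    proof -
      have "rt (mul x y) A1 = ennreal (D x) * (ennreal (D y) * emeasure dh A1)"
        unfolding rt_mul using rtD[OF meas_vi[OF A1], of x y] rtD[OF A1, of y] by (simp add: rt_def)
      then have "emeasure dh A1 * ennreal (D (mul x y)) = emeasure dh A1 * ennreal (D x * D y)"
        using D[of "mul x y"] Dpos[of x] Dpos[of y] by (simp add: mult_ac ennreal_mult)
      then have "ennreal (D (mul x y)) = ennreal (D x * D y)" by (rule cancel)
      then show ?thesis using Dpos[of "mul x y"] Dpos[of x] Dpos[of y] by (simp add: less_imp_le)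
    qed
    fix C :: "'h set" assume C: "compact C"
    \<comment> \<open>A compact set that contains the translates of \<open>A1\<close> by the
      inverses of all \<open>k\<close> in \<open>C\<close> at once.\<close>
    let ?I = "(\<lambda>p. mul (fst p) (hinv (snd p))) ` (K 0 \<times> C)"
    have Ifin: "emeasure dh ?I < \<infinity>" using img[OF C] by (rule dh_compact)
    have "D k \<le> enn2real (emeasure dh ?I) / b" if k: "k \<in> C" for k
      unfolding D_def
    proof (intro divide_right_mono enn2real_mono)
      have "(\<lambda>h. mul h k) -` A1 \<subseteq> ?I" using vi[OF k, of "K 0"] interior_subset by (fastforce simp: A1_def)
      then show "rt k A1 \<le> emeasure dh ?I" unfolding rt_def
        by (rule emeasure_mono) (simp add: borel_closed compact_imp_closed img[OF C])
      show "emeasure dh ?I < top" using Ifin by simp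
    qed (use b in simp)
    then show "\<exists>b. \<forall>k\<in>C. D k \<le> b" by blast
  qed
qed

end

section \<open>Orbit integrals of the quasi-regular representation\<close>

locale quasi_regular_setting = haar_group mul e hinv dh
  for mul :: "'h::{t2_space, second_countable_topology} \<Rightarrow> 'h \<Rightarrow> 'h" and e hinv dh +
  fixes rep :: "'h \<Rightarrow> real^'n::finite \<Rightarrow> real^'n"
    and act :: "'h \<Rightarrow> real^'d::finite \<Rightarrow> real^'d"
    and \<beta> :: "'h \<Rightarrow> real"
    and \<Phi> :: "real^'d \<Rightarrow> real^'n"
  assumes rep_linear: "\<And>h. linear (rep h)"
    and rep_unit: "rep e = id"
    and rep_mul: "\<And>h k. rep (mul h k) = rep h \<circ> rep k"
    and rep_cont: "continuous_on UNIV (\<lambda>p. rep (fst p) (snd p))"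
    and act_unit: "act e = id"
    and act_mul: "\<And>h k. act (mul h k) = act h \<circ> act k"
    and act_cont: "continuous_on UNIV (\<lambda>p. act (fst p) (snd p))"
    and act_leb: "\<And>h E. E \<in> sets borel \<Longrightarrow>
                    emeasure lebesgue (act h ` E) = ennreal (\<beta> h) * emeasure lebesgue E"
    and Phi_cont: "continuous_on UNIV \<Phi>"
    and Phi_equiv: "\<And>h x. \<Phi> (act h x) = rep h (\<Phi> x)"
begin

sublocale lborel_dh: pair_sigma_finite "lborel :: (real^'n) measure" dh ..
sublocale dh_lborel: pair_sigma_finite dh "lborel :: (real^'d) measure" ..

lemma rep_cancel[simp]: "rep (hinv h) (rep h v) = v" "rep h (rep (hinv h) v) = v"
  using rep_mul[of "hinv h" h] rep_mul[of h "hinv h"] by (auto simp: rep_unit fun_eq_iff)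

lemma act_cancel[simp]: "act (hinv h) (act h v) = v" "act h (act (hinv h) v) = v"
  using act_mul[of "hinv h" h] act_mul[of h "hinv h"] by (auto simp: act_unit fun_eq_iff)

lemma rep_cont2[continuous_intros]: "continuous_on S f \<Longrightarrow> continuous_on S g \<Longrightarrow> continuous_on S (\<lambda>x. rep (f x) (g x))"
  using continuous_on_compose2[OF rep_cont, of S "\<lambda>x. (f x, g x)"] by (simp add: continuous_on_Pair)

lemma rep_meas[measurable (raw)]:
  "f \<in> borel_measurable M \<Longrightarrow> g \<in> borel_measurable M \<Longrightarrow> (\<lambda>x. rep (f x) (g x)) \<in> borel_measurable M"
  by (rule borel_measurable_continuous_Pair[OF _ _ rep_cont])

lemma act_meas[measurable (raw)]:
  "f \<in> borel_measurable M \<Longrightarrow> g \<in> borel_measurable M \<Longrightarrow> (\<lambda>x. act (f x) (g x)) \<in> borel_measurable M"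
  by (rule borel_measurable_continuous_Pair[OF _ _ act_cont])

lemma Phi_meas[measurable]: "\<Phi> \<in> borel_measurable borel"
  using Phi_cont by (rule borel_measurable_continuous_onI)

definition "al h = alpha hinv rep h"

lemma det_rep: "det (matrix (rep (hinv h))) * det (matrix (rep h)) = 1"
proof -
  have "matrix (rep (hinv h)) ** matrix (rep h) = matrix (rep (hinv h) \<circ> rep h)"
    by (rule matrix_compose[symmetric]) (rule rep_linear)+
  also have "rep (hinv h) \<circ> rep h = id" by auto
  finally have "matrix (rep (hinv h)) ** matrix (rep h) = mat 1" by (simp only: matrix_id_mat_1)
  then show ?thesis by (metis det_I det_mul)
qed

lemma al_pos: "0 < al h"
  using det_rep[of h] by (auto simp: al_def alpha_def)

lemma al_mul: "al (mul h k) = al h * al k"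
proof -
  have "matrix (rep (hinv (mul h k))) = matrix (rep (hinv k)) ** matrix (rep (hinv h))"
    unfolding inv_mul rep_mul by (rule matrix_compose) (rule rep_linear)+
  then show ?thesis by (simp add: al_def alpha_def det_mul abs_mult)
qed

lemma al_cont: "continuous_on UNIV al"
  unfolding al_def[abs_def] alpha_def det_def matrix_def
  by (simp, intro continuous_intros cont_inv)

lemma al_meas[measurable]: "al \<in> borel_measurable borel"
  using al_cont by (rule borel_measurable_continuous_onI)

lemma act_vimage: "act (hinv h) -` E = act h ` E"
  by (auto simp: image_iff) (metis act_cancel(2))

lemma emeasure_act: "E \<in> sets borel \<Longrightarrow> emeasure lborel (act (hinv h) -` E) = ennreal (\<beta> h) * emeasure lborel E"
proof -
  assume E: "E \<in> sets borel"
  have "act (hinv h) -` E \<in> sets borel" using measurable_sets[of "act (hinv h)" borel borel E] act_meas[of "\<lambda>_. hinv h" borel "\<lambda>x. x"] E by simp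
  then show ?thesis using act_leb[OF E, of h] E by (simp add: act_vimage)
qed

text \<open>A non-positive \<open>\<beta> h\<close> would count as \<open>0\<close> in
  \<open>ennreal\<close>, whereas the preimage of the whole space is the whole space.\<close>

lemma \<beta>_pos: "0 < \<beta> h"
proof (rule ccontr)
  assume "\<not> 0 < \<beta> h"
  then have "ennreal (\<beta> h) = 0" by (simp add: ennreal_neg)
  with emeasure_act[of UNIV h] show False by simp
qed

text \<open>\<open>\<beta>\<close> is known only through the scaling of measures; as a parameter
  integral over the unit cube it becomes a measurable function of \<open>h\<close>.\<close>

lemma \<beta>_eq: "ennreal (\<beta> h) = (\<integral>\<^sup>+x. indicator (cbox 0 1 :: (real^'d) set) (act (hinv h) x) \<partial>lborel)"
proof -
  have "act (hinv h) -` cbox 0 1 \<in> sets borel" using measurable_sets[of "act (hinv h)" borel borel "cbox 0 1"] act_meas[of "\<lambda>_. hinv h" borel "\<lambda>x. x"] by simp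
  then have "emeasure lborel (act (hinv h) -` cbox 0 1) = (\<integral>\<^sup>+x. indicator (act (hinv h) -` cbox 0 1) x \<partial>lborel)" by simp
  also have "\<dots> = (\<integral>\<^sup>+x. indicator (cbox 0 1 :: (real^'d) set) (act (hinv h) x) \<partial>lborel)"
    by (intro nn_integral_cong) (auto simp: indicator_def)
  finally show ?thesis using emeasure_act[of "cbox 0 1" h] by (simp add: emeasure_unit_cube)
qed

lemma \<beta>_meas[measurable]: "\<beta> \<in> borel_measurable borel"
proof -
  have "(\<lambda>h. \<integral>\<^sup>+x. indicator (cbox 0 1 :: (real^'d) set) (act (hinv h) x) \<partial>lborel) \<in> borel_measurable borel"
    by measurable
  then have "(\<lambda>h. enn2real (ennreal (\<beta> h))) \<in> borel_measurable borel" unfolding \<beta>_eq by measurable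
  then show ?thesis using \<beta>_pos by (simp add: less_imp_le)
qed

lemma distr_act: "distr lborel borel (act (hinv h)) = density lborel (\<lambda>_. ennreal (\<beta> h))"
  by (rule measure_eqI) (simp_all add: emeasure_distr emeasure_act emeasure_density nn_integral_cmult_indicator)

lemma nn_integral_act:
  assumes [measurable]: "F \<in> borel_measurable borel"
  shows "(\<integral>\<^sup>+x. F (act (hinv h) x) \<partial>lborel) = ennreal (\<beta> h) * (\<integral>\<^sup>+x. F x \<partial>lborel)"
proof -
  have "(\<integral>\<^sup>+x. F (act (hinv h) x) \<partial>lborel) = (\<integral>\<^sup>+x. F x \<partial>distr lborel borel (act (hinv h)))"
    by (rule nn_integral_distr[symmetric]) measurable
  then show ?thesis unfolding distr_act by (simp add: nn_integral_density nn_integral_cmult)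
qed

lemma integral_act:
  fixes F :: "real^'d \<Rightarrow> complex"
  assumes [measurable]: "F \<in> borel_measurable borel"
  shows "(\<integral>x. F (act (hinv h) x) \<partial>lborel) = complex_of_real (\<beta> h) * (\<integral>x. F x \<partial>lborel)"
proof -
  have "(\<integral>x. F (act (hinv h) x) \<partial>lborel) = (\<integral>x. F x \<partial>distr lborel borel (act (hinv h)))"
    by (rule integral_distr[symmetric]) measurable
  then show ?thesis unfolding distr_act using \<beta>_pos[of h] by (simp add: integral_density scaleR_conv_of_real less_imp_le)
qed

lemma \<beta>_mul: "\<beta> (mul h k) = \<beta> h * \<beta> k"
proof -
  let ?Q = "cbox 0 1 :: (real^'d) set"
  have k: "act (hinv k) -` ?Q \<in> sets borel" using measurable_sets[of "act (hinv k)" borel borel ?Q] act_meas[of "\<lambda>_. hinv k" borel "\<lambda>x. x"] by simp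
  have "act (hinv (mul h k)) -` ?Q = act (hinv h) -` (act (hinv k) -` ?Q)"
    unfolding inv_mul act_mul by auto
  then have "ennreal (\<beta> (mul h k)) = ennreal (\<beta> h) * ennreal (\<beta> k)"
    using emeasure_act[of ?Q "mul h k"] emeasure_act[OF k, of h] emeasure_act[of ?Q k] by (simp add: emeasure_unit_cube)
  then have "ennreal (\<beta> (mul h k)) = ennreal (\<beta> h * \<beta> k)"
    using \<beta>_pos by (simp add: ennreal_mult less_imp_le)
  then show ?thesis using \<beta>_pos by (simp add: less_imp_le)
qed

text \<open>The coefficient of \<open>f\<close> against the orbit vector without its factor
  \<open>\<beta> h powr (-1/2)\<close>, whose square reappears as \<open>1 / \<beta> h\<close> in
  \<open>I\<close>. Conjugation turns the phase of the representation into \<open>cis\<close> with a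
  positive sign.\<close>

definition "T f \<xi> h a = (\<integral>x. f x * cnj (\<xi> (act (hinv h) x)) * cis (2 * pi * (\<Phi> x \<bullet> a)) \<partial>lborel)"

definition "J f \<xi> h = (\<integral>\<^sup>+a. ennreal ((cmod (T f \<xi> h a))\<^sup>2) \<partial>lborel)"

definition "I f \<xi> = (\<integral>\<^sup>+h. ennreal (1 / (al h * \<beta> h)) * J f \<xi> h \<partial>dh)"

lemma T_meas:
  assumes [measurable]: "f \<in> borel_measurable borel" "\<xi> \<in> borel_measurable borel"
  shows "(\<lambda>p. T f \<xi> (snd p) (fst p)) \<in> borel_measurable (borel \<Otimes>\<^sub>M borel)"
  unfolding T_def by measurable

lemma J_meas:
  assumes [measurable]: "f \<in> borel_measurable borel" "\<xi> \<in> borel_measurable borel"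
  shows "J f \<xi> \<in> borel_measurable borel"
  unfolding J_def[abs_def] T_def by measurable

lemma L2_inner_Urep:
  assumes [measurable]: "f \<in> borel_measurable borel" "\<xi> \<in> borel_measurable borel"
  shows "L2_inner f (Urep hinv act \<beta> \<Phi> (a, h) \<xi>) = complex_of_real (\<beta> h powr (-1/2)) * T f \<xi> h a"
proof -
  have ex: "exp (- 2 * complex_of_real pi * \<i> * complex_of_real t) = cis (- (2 * pi * t))" for t
    by (simp add: cis_conv_exp mult_ac)
  then have eq: "f x * cnj (Urep hinv act \<beta> \<Phi> (a, h) \<xi> x) = complex_of_real (\<beta> h powr (-1/2)) * (f x * cnj (\<xi> (act (hinv h) x)) * cis (2 * pi * (\<Phi> x \<bullet> a)))" for x
  proof -
    have "cnj (exp (- 2 * complex_of_real pi * \<i> * complex_of_real (\<Phi> x \<bullet> a))) = cis (2 * pi * (\<Phi> x \<bullet> a))"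
      unfolding ex cis_cnj by simp
    then show ?thesis
      unfolding Urep_def fst_conv snd_conv complex_cnj_mult complex_cnj_complex_of_real by (simp only: mult_ac)
  qed
  have "L2_inner f (Urep hinv act \<beta> \<Phi> (a, h) \<xi>) = (\<integral>x. complex_of_real (\<beta> h powr (-1/2)) * (f x * cnj (\<xi> (act (hinv h) x)) * cis (2 * pi * (\<Phi> x \<bullet> a))) \<partial>lebesgue)"
    unfolding L2_inner_def eq ..
  also have "\<dots> = (\<integral>x. complex_of_real (\<beta> h powr (-1/2)) * (f x * cnj (\<xi> (act (hinv h) x)) * cis (2 * pi * (\<Phi> x \<bullet> a))) \<partial>lborel)"
    by (rule integral_completion) measurable
  also have "\<dots> = complex_of_real (\<beta> h powr (-1/2)) * T f \<xi> h a"
    unfolding T_def by (rule integral_mult_right_zero)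
  finally show ?thesis .
qed

lemma haar_G_integral:
  assumes F[measurable]: "F \<in> borel_measurable (borel \<Otimes>\<^sub>M borel)"
  shows "(\<integral>\<^sup>+g. F g \<partial>haar_G hinv rep dh) = (\<integral>\<^sup>+h. ennreal (1 / al h) * (\<integral>\<^sup>+a. F (a, h) \<partial>lborel) \<partial>dh)"
proof -
  have m: "F \<in> borel_measurable (lborel \<Otimes>\<^sub>M dh)" using F by (simp cong: measurable_cong_sets)
  have "(\<integral>\<^sup>+g. F g \<partial>haar_G hinv rep dh) = (\<integral>\<^sup>+g. ennreal (1 / al (snd g)) * F g \<partial>(lborel \<Otimes>\<^sub>M dh))"
    unfolding haar_G_def al_def[symmetric] by (rule nn_integral_density) (use m in measurable)
  also have "\<dots> = (\<integral>\<^sup>+h. \<integral>\<^sup>+a. ennreal (1 / al h) * F (a, h) \<partial>lborel \<partial>dh)"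
    using m by (subst lborel_dh.nn_integral_snd[symmetric]) auto
  also have "\<dots> = (\<integral>\<^sup>+h. ennreal (1 / al h) * (\<integral>\<^sup>+a. F (a, h) \<partial>lborel) \<partial>dh)"
    by (intro nn_integral_cong nn_integral_cmult) measurable
  finally show ?thesis .
qed

lemma orbit_integral_eq:
  assumes f[measurable]: "f \<in> borel_measurable borel" and \<xi>[measurable]: "\<xi> \<in> borel_measurable borel"
  shows "(\<integral>\<^sup>+g. ennreal ((cmod (L2_inner f (Urep hinv act \<beta> \<Phi> g \<xi>)))\<^sup>2) \<partial>haar_G hinv rep dh) = I f \<xi>"
proof -
  note [measurable] = T_meas[OF f \<xi>] J_meas[OF f \<xi>]
  have eq: "ennreal ((cmod (L2_inner f (Urep hinv act \<beta> \<Phi> g \<xi>)))\<^sup>2) = ennreal (1 / \<beta> (snd g)) * ennreal ((cmod (T f \<xi> (snd g) (fst g)))\<^sup>2)" for g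
  proof -
    have "(\<beta> (snd g) powr (-1/2))\<^sup>2 = 1 / \<beta> (snd g)"
    proof -
      have "\<beta> (snd g) powr (-1/2) = inverse (sqrt (\<beta> (snd g)))"
        using powr_minus[of "\<beta> (snd g)" "1/2"] \<beta>_pos[of "snd g"] by (simp add: powr_half_sqrt)
      then show ?thesis using \<beta>_pos[of "snd g"] by (simp add: inverse_eq_divide power_divide)
    qed
    then have "(cmod (L2_inner f (Urep hinv act \<beta> \<Phi> g \<xi>)))\<^sup>2 = 1 / \<beta> (snd g) * (cmod (T f \<xi> (snd g) (fst g)))\<^sup>2"
      using L2_inner_Urep[OF f \<xi>, of "fst g" "snd g"] by (simp add: norm_mult power_mult_distrib)
    then show ?thesis using \<beta>_pos[of "snd g"]
      by (simp only: ennreal_mult divide_nonneg_nonneg zero_le_one less_imp_le zero_le_power2)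
  qed
  have "(\<integral>\<^sup>+g. ennreal ((cmod (L2_inner f (Urep hinv act \<beta> \<Phi> g \<xi>)))\<^sup>2) \<partial>haar_G hinv rep dh)
     = (\<integral>\<^sup>+h. ennreal (1 / al h) * (\<integral>\<^sup>+a. ennreal (1 / \<beta> h) * ennreal ((cmod (T f \<xi> h a))\<^sup>2) \<partial>lborel) \<partial>dh)"
    unfolding eq by (subst haar_G_integral) auto
  also have "\<dots> = I f \<xi>"
    unfolding I_def
  proof (rule nn_integral_cong)
    fix h
    have [measurable]: "T f \<xi> h \<in> borel_measurable borel" unfolding T_def[abs_def] by measurable
    have "(\<integral>\<^sup>+a. ennreal (1 / \<beta> h) * ennreal ((cmod (T f \<xi> h a))\<^sup>2) \<partial>lborel) = ennreal (1 / \<beta> h) * J f \<xi> h"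
      unfolding J_def by (rule nn_integral_cmult) measurable
    then show "ennreal (1 / al h) * (\<integral>\<^sup>+a. ennreal (1 / \<beta> h) * ennreal ((cmod (T f \<xi> h a))\<^sup>2) \<partial>lborel) = ennreal (1 / (al h * \<beta> h)) * J f \<xi> h"
      using al_pos[of h] \<beta>_pos[of h] by (simp add: mult.assoc[symmetric] ennreal_mult[symmetric] less_imp_le)
  qed
  finally show ?thesis .
qed

section \<open>Moving the group element from the vector to \<open>f\<close>\<close>

lemma T_substitution:
  assumes [measurable]: "f \<in> borel_measurable borel" "\<xi> \<in> borel_measurable borel"
  shows "T f \<xi> h a = complex_of_real (\<beta> h) * (\<integral>x. f (act h x) * cnj (\<xi> x) * cis (2 * pi * (\<Phi> x \<bullet> adjoint (rep h) a)) \<partial>lborel)"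
proof -
  have "(\<integral>x. f (act h (act (hinv h) x)) * cnj (\<xi> (act (hinv h) x)) * cis (2 * pi * (\<Phi> (act (hinv h) x) \<bullet> adjoint (rep h) a)) \<partial>lborel)
     = complex_of_real (\<beta> h) * (\<integral>x. f (act h x) * cnj (\<xi> x) * cis (2 * pi * (\<Phi> x \<bullet> adjoint (rep h) a)) \<partial>lborel)"
    by (rule integral_act[of "\<lambda>x. f (act h x) * cnj (\<xi> x) * cis (2 * pi * (\<Phi> x \<bullet> adjoint (rep h) a))"]) measurable
  moreover have "\<Phi> (act (hinv h) x) \<bullet> adjoint (rep h) a = \<Phi> x \<bullet> a" for x
    using adjoint_works[OF rep_linear, of "\<Phi> (act (hinv h) x)" h a] by (simp add: Phi_equiv)
  ultimately show ?thesis by (simp add: T_def)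
qed

text \<open>Substituting \<open>act h x\<close> moves \<open>h\<close> from the vector to
  \<open>f\<close> and turns the frequency \<open>a\<close> into \<open>adjoint (rep h) a\<close>.
  The first substitution contributes \<open>\<beta> h\<close> squared; the linear one in
  \<open>a\<close> contributes \<open>al h\<close>, the reciprocal of the absolute determinant of
  \<open>rep h\<close>.\<close>

lemma J_substitution:
  assumes f[measurable]: "f \<in> borel_measurable borel" and \<xi>[measurable]: "\<xi> \<in> borel_measurable borel"
  shows "J f \<xi> h = ennreal ((\<beta> h)\<^sup>2 * al h) *
    (\<integral>\<^sup>+a. ennreal ((cmod (\<integral>x. f (act h x) * cnj (\<xi> x) * cis (2 * pi * (\<Phi> x \<bullet> a)) \<partial>lborel))\<^sup>2) \<partial>lborel)"
proof -
  define G where "G a = ennreal ((cmod (\<integral>x. f (act h x) * cnj (\<xi> x) * cis (2 * pi * (\<Phi> x \<bullet> a)) \<partial>lborel))\<^sup>2)" for a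
  have [measurable]: "G \<in> borel_measurable borel" unfolding G_def[abs_def] by measurable
  let ?A = "adjoint (rep h)"
  have linA: "linear ?A" by (rule adjoint_linear[OF rep_linear])
  have detA: "det (matrix ?A) = det (matrix (rep h))"
    by (simp add: matrix_adjoint[OF rep_linear] det_transpose)
  then have nz: "det (matrix ?A) \<noteq> 0" using det_rep[of h] by auto
  have alA: "al h * \<bar>det (matrix ?A)\<bar> = 1"
    using det_rep[of h] unfolding detA by (simp add: al_def alpha_def flip: abs_mult)
  have [measurable]: "?A \<in> borel_measurable borel"
    using linA by (intro borel_measurable_continuous_onI linear_continuous_on) (simp add: linear_conv_bounded_linear)
  have "J f \<xi> h = (\<integral>\<^sup>+a. ennreal ((\<beta> h)\<^sup>2) * G (?A a) \<partial>lborel)"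
    unfolding J_def T_substitution[OF f \<xi>] G_def
    by (intro nn_integral_cong) (simp add: norm_mult power_mult_distrib ennreal_mult)
  also have "\<dots> = ennreal ((\<beta> h)\<^sup>2) * (\<integral>\<^sup>+a. G (?A a) \<partial>lborel)" by (rule nn_integral_cmult) measurable
  also have "(\<integral>\<^sup>+a. G (?A a) \<partial>lborel) = ennreal (al h) * (ennreal \<bar>det (matrix ?A)\<bar> * (\<integral>\<^sup>+a. G (?A a) \<partial>lborel))"
    using alA al_pos[of h] by (simp add: mult.assoc[symmetric] ennreal_mult[symmetric] less_imp_le)
  also have "ennreal \<bar>det (matrix ?A)\<bar> * (\<integral>\<^sup>+a. G (?A a) \<partial>lborel) = (\<integral>\<^sup>+a. G a \<partial>lborel)"
    by (rule nn_integral_linear_substitution[OF linA nz, symmetric]) measurable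
  finally show ?thesis
    using al_pos[of h] by (simp add: G_def mult.assoc ennreal_mult less_imp_le)
qed

text \<open>With \<open>h\<close> fixed the frame identity applies to
  \<open>f (act h x) * b (\<Phi> x)\<close>, which is square integrable because \<open>b\<close> is
  bounded. The constants combine to \<open>\<beta> h\<close>, just the factor for substituting back,
  and by equivariance the weight is then taken at \<open>rep (hinv h) (\<Phi> x)\<close>.\<close>

lemma J_frame:
  assumes f[measurable]: "f \<in> borel_measurable borel" and f2: "integrable lborel (\<lambda>x. (cmod (f x))\<^sup>2)"
    and E[measurable]: "\<And>k::nat. E k \<in> borel_measurable borel"
    and frame: "\<And>F. F \<in> borel_measurable borel \<Longrightarrow> integrable lborel (\<lambda>x. (cmod (F x))\<^sup>2) \<Longrightarrow>
      (\<Sum>k. \<integral>\<^sup>+a. ennreal ((cmod (\<integral>x. F x * complex_of_real (E k x) * cis (2 * pi * (\<Phi> x \<bullet> a)) \<partial>lborel))\<^sup>2) \<partial>lborel)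
       = (\<integral>\<^sup>+x. ennreal ((cmod (F x))\<^sup>2) \<partial>lborel)"
    and b[measurable]: "b \<in> borel_measurable borel" and bC: "\<And>y. \<bar>b y\<bar> \<le> (C::real)"
  shows "(\<Sum>k. ennreal (1 / (al h * \<beta> h)) * J f (\<lambda>x. complex_of_real (b (\<Phi> x) * E k x)) h)
    = (\<integral>\<^sup>+x. ennreal ((cmod (f x))\<^sup>2) * ennreal ((b (rep (hinv h) (\<Phi> x)))\<^sup>2) \<partial>lborel)"
proof -
  define F where "F x = f (act h x) * complex_of_real (b (\<Phi> x))" for x
  have [measurable]: "F \<in> borel_measurable borel" unfolding F_def[abs_def] by measurable
  have sub: "(\<integral>\<^sup>+x. ennreal ((cmod (f x))\<^sup>2) * ennreal ((b (rep (hinv h) (\<Phi> x)))\<^sup>2) \<partial>lborel) = ennreal (\<beta> h) * (\<integral>\<^sup>+x. ennreal ((cmod (F x))\<^sup>2) \<partial>lborel)"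
  proof -
    have "(\<integral>\<^sup>+x. ennreal ((cmod (F (act (hinv h) x)))\<^sup>2) \<partial>lborel) = ennreal (\<beta> h) * (\<integral>\<^sup>+x. ennreal ((cmod (F x))\<^sup>2) \<partial>lborel)"
      by (rule nn_integral_act) measurable
    then show ?thesis by (simp add: F_def Phi_equiv norm_mult power_mult_distrib ennreal_mult)
  qed
  have "(\<integral>\<^sup>+x. ennreal ((cmod (f x))\<^sup>2) * ennreal ((b (rep (hinv h) (\<Phi> x)))\<^sup>2) \<partial>lborel) \<le> (\<integral>\<^sup>+x. ennreal ((cmod (f x))\<^sup>2) * ennreal (C\<^sup>2) \<partial>lborel)"
    using bC by (intro nn_integral_mono mult_left_mono ennreal_leI) (auto simp: abs_le_square_iff[symmetric] intro: order_trans[OF bC abs_ge_self])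
  also have "\<dots> < \<infinity>" using f2 by (simp add: nn_integral_multc ennreal_mult_less_top integrable_iff_bounded)
  finally have "(\<integral>\<^sup>+x. ennreal ((cmod (F x))\<^sup>2) \<partial>lborel) < \<infinity>"
    unfolding sub using \<beta>_pos[of h] by (auto simp: ennreal_mult_less_top)
  then have F2: "integrable lborel (\<lambda>x. (cmod (F x))\<^sup>2)" by (simp add: integrable_iff_bounded)
  have "(\<Sum>k. ennreal (1 / (al h * \<beta> h)) * J f (\<lambda>x. complex_of_real (b (\<Phi> x) * E k x)) h)
    = (\<Sum>k. ennreal (\<beta> h) * (\<integral>\<^sup>+a. ennreal ((cmod (\<integral>x. F x * complex_of_real (E k x) * cis (2 * pi * (\<Phi> x \<bullet> a)) \<partial>lborel))\<^sup>2) \<partial>lborel))"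
  proof (rule suminf_cong)
    fix k
    have "(1 / (al h * \<beta> h)) * ((\<beta> h)\<^sup>2 * al h) = \<beta> h"
      using al_pos[of h] \<beta>_pos[of h] by (simp add: field_simps power2_eq_square)
    then have "ennreal (1 / (al h * \<beta> h)) * ennreal ((\<beta> h)\<^sup>2 * al h) = ennreal (\<beta> h)"
      using al_pos[of h] \<beta>_pos[of h] by (simp add: ennreal_mult[symmetric] less_imp_le)
    then show "ennreal (1 / (al h * \<beta> h)) * J f (\<lambda>x. complex_of_real (b (\<Phi> x) * E k x)) h
      = ennreal (\<beta> h) * (\<integral>\<^sup>+a. ennreal ((cmod (\<integral>x. F x * complex_of_real (E k x) * cis (2 * pi * (\<Phi> x \<bullet> a)) \<partial>lborel))\<^sup>2) \<partial>lborel)"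
      by (subst J_substitution) (simp_all add: F_def mult.assoc[symmetric])
  qed
  also have "\<dots> = ennreal (\<beta> h) * (\<integral>\<^sup>+x. ennreal ((cmod (F x))\<^sup>2) \<partial>lborel)"
    by (simp add: frame F2)
  finally show ?thesis unfolding sub .
qed

lemma J_translate:
  fixes s :: real
  assumes [measurable]: "f \<in> borel_measurable borel" "\<xi> \<in> borel_measurable borel"
  shows "J f (\<lambda>x. complex_of_real s * \<xi> (act (hinv g) x)) h = ennreal (s\<^sup>2) * J f \<xi> (mul h g)"
proof (cases "s = 0")
  case False
  have "T f (\<lambda>x. complex_of_real s * \<xi> (act (hinv g) x)) h a = complex_of_real s * T f \<xi> (mul h g) a" for a
  proof -
    have "T f (\<lambda>x. complex_of_real s * \<xi> (act (hinv g) x)) h a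
      = (\<integral>x. complex_of_real s * (f x * cnj (\<xi> (act (hinv (mul h g)) x)) * cis (2 * pi * (\<Phi> x \<bullet> a))) \<partial>lborel)"
      unfolding T_def inv_mul act_mul by (intro Bochner_Integration.integral_cong) auto
    then show ?thesis unfolding T_def by (simp only: integral_mult_right_zero)
  qed
  then have "J f (\<lambda>x. complex_of_real s * \<xi> (act (hinv g) x)) h = (\<integral>\<^sup>+a. ennreal (s\<^sup>2) * ennreal ((cmod (T f \<xi> (mul h g) a))\<^sup>2) \<partial>lborel)"
    unfolding J_def by (simp add: norm_mult power_mult_distrib ennreal_mult)
  also have "\<dots> = ennreal (s\<^sup>2) * J f \<xi> (mul h g)"
    unfolding J_def by (rule nn_integral_cmult) (simp add: T_def)
  finally show ?thesis .
qed (simp add: J_def T_def)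

end

section \<open>The modular function of \<open>G\<close> restricted to \<open>H\<close>\<close>

locale quasi_regular_modulus = quasi_regular_setting mul e hinv dh rep act \<beta> \<Phi>
  for mul :: "'h::{t2_space, second_countable_topology} \<Rightarrow> 'h \<Rightarrow> 'h" and e hinv dh
    and rep :: "'h \<Rightarrow> real^'n::finite \<Rightarrow> real^'n" and act :: "'h \<Rightarrow> real^'d::finite \<Rightarrow> real^'d" and \<beta> \<Phi> +
  fixes D :: "'h \<Rightarrow> real"
  assumes D_pos: "0 < D k" and D_mul: "D (mul x y) = D x * D y"
    and D_compact: "compact C \<Longrightarrow> \<exists>b. \<forall>k\<in>C. D k \<le> b"
    and D_rt: "A \<in> sets borel \<Longrightarrow> rt k A = ennreal (D k) * emeasure dh A"
begin

lemma nn_integral_right: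
  assumes [measurable]: "F \<in> borel_measurable borel"
  shows "(\<integral>\<^sup>+h. F (mul h k) \<partial>dh) = ennreal (D k) * (\<integral>\<^sup>+h. F h \<partial>dh)"
proof -
  have "distr dh borel (\<lambda>h. mul h k) = density dh (\<lambda>_. ennreal (D k))"
  proof (rule measure_eqI)
    fix A assume "A \<in> sets (distr dh borel (\<lambda>h. mul h k))"
    then have A: "A \<in> sets borel" by simp
    have "emeasure (distr dh borel (\<lambda>h. mul h k)) A = rt k A"
      unfolding rt_def using A by (subst emeasure_distr) auto
    also have "\<dots> = emeasure (density dh (\<lambda>_. ennreal (D k))) A"
      unfolding D_rt[OF A] using A by (subst emeasure_density) (auto simp: nn_integral_cmult_indicator)
    finally show "emeasure (distr dh borel (\<lambda>h. mul h k)) A = emeasure (density dh (\<lambda>_. ennreal (D k))) A" .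
  qed simp
  moreover have "(\<integral>\<^sup>+h. F (mul h k) \<partial>dh) = (\<integral>\<^sup>+h. F h \<partial>distr dh borel (\<lambda>h. mul h k))"
    by (rule nn_integral_distr[symmetric]) measurable
  ultimately show ?thesis by (simp add: nn_integral_density nn_integral_cmult)
qed

text \<open>The reciprocal of \<open>\<Delta>_G\<close>: right translation by \<open>k\<close>
  multiplies the integral over \<open>H\<close> by \<open>D k\<close>, and the density
  \<open>1 / al\<close> of the Haar measure of \<open>G\<close> contributes
  \<open>al k\<close>.\<close>

definition "\<delta> k = al k * D k"

lemma \<delta>_pos: "0 < \<delta> k" using al_pos D_pos by (simp add: \<delta>_def)

lemma \<delta>_mul: "\<delta> (mul x y) = \<delta> x * \<delta> y" by (simp add: \<delta>_def al_mul D_mul)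

lemma \<delta>_e: "\<delta> e = 1" using \<delta>_mul[of e e] \<delta>_pos[of e] by simp

lemma \<delta>_inv: "\<delta> (hinv k) = 1 / \<delta> k"
  using \<delta>_mul[of k "hinv k"] \<delta>_pos[of k] by (simp add: \<delta>_e field_simps)

lemma \<delta>_compact:
  assumes "compact C"
  shows "\<exists>b. \<forall>k\<in>C. \<delta> k \<le> b"
proof -
  obtain b1 where b1: "\<forall>k\<in>C. D k \<le> b1" using D_compact[OF assms] by blast
  have "compact (al ` C)" using al_cont assms by (intro compact_continuous_image) (auto intro: continuous_on_subset)
  then have "bounded (al ` C)" by (rule compact_imp_bounded)
  then obtain b2 where b2: "\<forall>y\<in>al ` C. norm y \<le> b2" unfolding bounded_iff by blast
  have "\<delta> k \<le> b2 * b1" if "k \<in> C" for k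
  proof -
    have "al k \<le> b2" using b2 that by fastforce
    then show ?thesis unfolding \<delta>_def using b1 that al_pos[of k] D_pos[of k] by (intro mult_mono) auto
  qed
  then show ?thesis by blast
qed

text \<open>Replacing \<open>h\<close> by \<open>mul h g\<close> produces
  \<open>al g * \<beta> g\<close> from the weights and \<open>D g\<close> from the Haar integral,
  together \<open>\<beta> g * \<delta> g\<close>, which the squared scalar cancels. The part
  \<open>\<beta> g\<close> alone would make the translation unitary, so the squared norm of the
  vector drops by the factor \<open>\<delta> g\<close>.\<close>

lemma I_translate:
  assumes f[measurable]: "f \<in> borel_measurable borel" and \<xi>[measurable]: "\<xi> \<in> borel_measurable borel"
  shows "I f (\<lambda>x. complex_of_real (1 / sqrt (\<beta> g * \<delta> g)) * \<xi> (act (hinv g) x)) = I f \<xi>"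
proof -
  note [measurable] = J_meas[OF f \<xi>]
  define s where "s = 1 / sqrt (\<beta> g * \<delta> g)"
  have s2: "s\<^sup>2 = 1 / (\<beta> g * \<delta> g)" using \<beta>_pos[of g] \<delta>_pos[of g] by (simp add: s_def power_divide)
  define F where "F h = ennreal (1 / (al h * \<beta> h)) * J f \<xi> h" for h
  have [measurable]: "F \<in> borel_measurable borel" unfolding F_def[abs_def] by measurable
  have "I f (\<lambda>x. complex_of_real s * \<xi> (act (hinv g) x)) = (\<integral>\<^sup>+h. ennreal (1 / D g) * F (mul h g) \<partial>dh)"
    unfolding I_def J_translate[OF f \<xi>]
  proof (rule nn_integral_cong)
    fix h
    have "1 / (al h * \<beta> h) * s\<^sup>2 = 1 / D g * (1 / (al (mul h g) * \<beta> (mul h g)))"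
      unfolding s2 al_mul \<beta>_mul \<delta>_def by (simp only: times_divide_times_eq mult_1_left mult_ac)
    moreover have "ennreal (1 / (al h * \<beta> h) * s\<^sup>2) = ennreal (1 / (al h * \<beta> h)) * ennreal (s\<^sup>2)"
      using al_pos[of h] \<beta>_pos[of h] by (intro ennreal_mult) simp_all
    moreover have "ennreal (1 / D g * (1 / (al (mul h g) * \<beta> (mul h g)))) = ennreal (1 / D g) * ennreal (1 / (al (mul h g) * \<beta> (mul h g)))"
      using D_pos[of g] al_pos[of "mul h g"] \<beta>_pos[of "mul h g"] by (intro ennreal_mult) simp_all
    ultimately have "ennreal (1 / (al h * \<beta> h)) * ennreal (s\<^sup>2) = ennreal (1 / D g) * ennreal (1 / (al (mul h g) * \<beta> (mul h g)))"
      by (simp only:)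
    then show "ennreal (1 / (al h * \<beta> h)) * (ennreal (s\<^sup>2) * J f \<xi> (mul h g)) = ennreal (1 / D g) * F (mul h g)"
      unfolding F_def by (simp add: mult.assoc[symmetric])
  qed
  also have "\<dots> = ennreal (1 / D g) * (\<integral>\<^sup>+h. F (mul h g) \<partial>dh)" by (rule nn_integral_cmult) measurable
  also have "\<dots> = (ennreal (1 / D g) * ennreal (D g)) * (\<integral>\<^sup>+h. F h \<partial>dh)"
    by (subst nn_integral_right) (auto simp: mult.assoc)
  also have "ennreal (1 / D g) * ennreal (D g) = 1" using D_pos[of g] by (simp add: ennreal_mult[symmetric] less_imp_le)
  finally show ?thesis by (simp add: I_def F_def s_def)
qed

lemma dagger_meas:
  assumes [measurable]: "f \<in> borel_measurable M"
  shows "(\<lambda>x. dagger hinv rep (f x) a) \<in> borel_measurable M"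
proof -
  have "dagger hinv rep (f x) a \<bullet> b = a \<bullet> rep (hinv (f x)) b" for x b
    unfolding dagger_def using adjoint_works[OF rep_linear, of b "hinv (f x)" a] by (simp add: inner_commute)
  then have "(\<lambda>x. dagger hinv rep (f x) a \<bullet> b) \<in> borel_measurable M" for b by simp
  then show ?thesis by (subst borel_measurable_euclidean_space) auto
qed

text \<open>Right translation by an element of \<open>G\<close> shifts the vector component, which
  Lebesgue measure ignores, and moves the group component by \<open>k\<close>; what remains is the
  factor \<open>1 / \<delta> k\<close>.\<close>

lemma unimodular_if_\<delta>_trivial:
  assumes \<delta>1: "\<And>k. \<delta> k = 1"
  shows "unimodular_G mul hinv rep dh"
  unfolding unimodular_G_def
proof (intro allI impI)
  fix g0 :: "(real^'n) \<times> 'h" and E assume "E \<in> sets (haar_G hinv rep dh)"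
  moreover have sG: "sets (haar_G hinv rep dh) = sets (borel \<Otimes>\<^sub>M borel)"
    unfolding haar_G_def by (simp cong: sets_pair_measure_cong)
  ultimately have E[measurable]: "E \<in> sets (borel \<Otimes>\<^sub>M borel)" by simp
  define a0 where "a0 = fst g0"
  define k where "k = snd g0"
  \<comment> \<open>\<open>R\<close> is right translation by the inverse of \<open>g0\<close>, so
    the translate of \<open>E\<close> becomes a measurable preimage.\<close>
  define R where "R p = (fst p - dagger hinv rep (mul (snd p) (hinv k)) a0, mul (snd p) (hinv k))" for p :: "(real^'n) \<times> 'h"
  have Rm: "R \<in> measurable (borel \<Otimes>\<^sub>M borel) (borel \<Otimes>\<^sub>M borel)"
  proof -
    have "(\<lambda>p. dagger hinv rep (mul (snd p) (hinv k)) a0) \<in> borel_measurable (borel \<Otimes>\<^sub>M borel)"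
      by (rule dagger_meas) measurable
    then show ?thesis unfolding R_def[abs_def] by measurable
  qed
  have img: "(\<lambda>g. Gmul mul hinv rep g g0) ` E = R -` E"
  proof
    show "(\<lambda>g. Gmul mul hinv rep g g0) ` E \<subseteq> R -` E"
      by (auto simp: Gmul_def R_def a0_def k_def)
    show "R -` E \<subseteq> (\<lambda>g. Gmul mul hinv rep g g0) ` E"
    proof
      fix p assume "p \<in> R -` E"
      moreover have "Gmul mul hinv rep (R p) g0 = p" by (simp add: Gmul_def R_def a0_def k_def)
      ultimately show "p \<in> (\<lambda>g. Gmul mul hinv rep g g0) ` E" by (metis rev_image_eqI vimageE)
    qed
  qed
  have RE[measurable]: "R -` E \<in> sets (borel \<Otimes>\<^sub>M borel)" using measurable_sets[OF Rm E] by (simp add: space_pair_measure)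
  have em: "emeasure (haar_G hinv rep dh) A = (\<integral>\<^sup>+h. ennreal (1 / al h) * (\<integral>\<^sup>+a. indicator A (a, h) \<partial>lborel) \<partial>dh)"
    if A[measurable]: "A \<in> sets (borel \<Otimes>\<^sub>M borel)" for A
  proof -
    have "emeasure (haar_G hinv rep dh) A = (\<integral>\<^sup>+g. indicator A g \<partial>haar_G hinv rep dh)" using A sG by simp
    also have "\<dots> = (\<integral>\<^sup>+h. ennreal (1 / al h) * (\<integral>\<^sup>+a. indicator A (a, h) \<partial>lborel) \<partial>dh)"
      by (rule haar_G_integral) measurable
    finally show ?thesis .
  qed
  define F where "F h = ennreal (1 / al h) * (\<integral>\<^sup>+a. indicator E (a, h) \<partial>lborel)" for h
  have [measurable]: "F \<in> borel_measurable borel" unfolding F_def[abs_def] by measurable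
  have "emeasure (haar_G hinv rep dh) (R -` E) = (\<integral>\<^sup>+h. ennreal (1 / al k) * F (mul h (hinv k)) \<partial>dh)"
    unfolding em[OF RE]
  proof (rule nn_integral_cong)
    fix h
    let ?h = "mul h (hinv k)"
    have "(\<lambda>a. indicator E (a, ?h) :: ennreal) \<in> borel_measurable borel" by measurable
    from lborel_nn_integral_translation[OF this, of "- dagger hinv rep ?h a0"]
    have "(\<integral>\<^sup>+a. indicator (R -` E) (a, h) \<partial>lborel) = (\<integral>\<^sup>+a. indicator E (a, ?h) \<partial>lborel)"
      by (simp add: R_def indicator_def)
    moreover have "1 / al h = 1 / al k * (1 / al ?h)"
      using al_mul[of ?h k] al_pos[of k] al_pos[of h] by simp
    moreover have "ennreal (1 / al k * (1 / al ?h)) = ennreal (1 / al k) * ennreal (1 / al ?h)"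
      using al_pos[of k] al_pos[of ?h] by (intro ennreal_mult) simp_all
    ultimately show "ennreal (1 / al h) * (\<integral>\<^sup>+a. indicator (R -` E) (a, h) \<partial>lborel) = ennreal (1 / al k) * F ?h"
      unfolding F_def by (simp only: mult.assoc)
  qed
  also have "\<dots> = ennreal (1 / al k) * (\<integral>\<^sup>+h. F (mul h (hinv k)) \<partial>dh)" by (rule nn_integral_cmult) measurable
  also have "\<dots> = ennreal (1 / al k) * ennreal (D (hinv k)) * (\<integral>\<^sup>+h. F h \<partial>dh)"
    by (subst nn_integral_right) (auto simp: mult.assoc)
  also have "ennreal (1 / al k) * ennreal (D (hinv k)) = 1"
  proof -
    have "D e = 1" using D_mul[of e e] D_pos[of e] by simp
    then have "D (hinv k) * D k = 1" using D_mul[of "hinv k" k] by simp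
    moreover have "al k * D k = 1" using \<delta>1[of k] by (simp add: \<delta>_def)
    ultimately have "1 / al k * D (hinv k) = 1"
      using al_pos[of k] D_pos[of k] by (simp add: field_simps) (metis mult.commute mult_right_cancel less_irrefl)
    then show ?thesis using al_pos[of k] D_pos[of "hinv k"] by (simp add: ennreal_mult[symmetric] less_imp_le)
  qed
  finally show "emeasure (haar_G hinv rep dh) ((\<lambda>g. Gmul mul hinv rep g g0) ` E) = emeasure (haar_G hinv rep dh) E"
    unfolding img em[OF E] by (simp add: F_def)
qed

lemma \<delta>_expanding:
  assumes "\<not> unimodular_G mul hinv rep dh"
  shows "\<exists>g. 1 < \<delta> g"
proof -
  obtain k where k: "\<delta> k \<noteq> 1" using unimodular_if_\<delta>_trivial assms by blast
  show ?thesis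
  proof (cases "1 < \<delta> k")
    case False
    then have "1 < \<delta> (hinv k)" using k \<delta>_pos[of k] by (simp add: \<delta>_inv)
    then show ?thesis by blast
  qed blast
qed

lemma \<delta>_powers:
  "\<exists>p. \<forall>n. \<delta> (p n) = \<delta> g ^ n"
proof
  show "\<forall>n. \<delta> (rec_nat e (\<lambda>_ x. mul g x) n) = \<delta> g ^ n"
  proof
    fix n show "\<delta> (rec_nat e (\<lambda>_ x. mul g x) n) = \<delta> g ^ n" by (induction n) (simp_all add: \<delta>_e \<delta>_mul)
  qed
qed

end

section \<open>Weights on the orbit space\<close>

text \<open>The tube lemma, by compactness of \<open>C\<close>. It makes sets such as
  \<open>{y. \<exists>h\<in>C. rep h y = p y}\<close> Borel for Borel maps \<open>p\<close>, where a
  quantifier over all of \<open>H\<close> would call for a further argument.\<close>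

lemma closed_compact_relation:
  fixes r :: "'h::t2_space \<Rightarrow> 'a::euclidean_space \<Rightarrow> 'b::euclidean_space"
  assumes C: "compact C" and cont: "continuous_on UNIV (\<lambda>p. r (fst p) (snd p))"
  shows "closed {(v, w). \<exists>h\<in>C. r h v = w}"
  unfolding closed_def
proof (subst open_subopen, intro ballI)
  let ?W = "{p :: ('a \<times> 'b) \<times> 'h. r (snd p) (fst (fst p)) \<noteq> snd (fst p)}"
  have W: "open ?W"
    by (rule open_Collect_neq) (auto intro!: continuous_intros continuous_on_compose2[OF cont, of _ "\<lambda>p. (snd p, fst (fst p))", simplified])
  fix x assume x: "x \<in> - {(v, w). \<exists>h\<in>C. r h v = w}"
  then have "{x} \<times> C \<subseteq> ?W" by auto
  from Elementary_Topology.tube_lemma[OF C W this] obtain X0 where X0: "x \<in> X0" "open X0" "X0 \<times> C \<subseteq> ?W" by blast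
  have "X0 \<subseteq> - {(v, w). \<exists>h\<in>C. r h v = w}" using X0(3) by auto
  with X0 show "\<exists>T. open T \<and> x \<in> T \<and> T \<subseteq> - {(v, w). \<exists>h\<in>C. r h v = w}" by blast
qed

context quasi_regular_setting
begin

text \<open>The representative \<open>p y\<close> plays the role of \<open>o (\<pi> y)\<close>.\<close>

lemma exists_weights:
  fixes Y :: "(real^'n) set" and p :: "real^'n \<Rightarrow> real^'n"
  assumes Y[measurable]: "Y \<in> sets borel" and p[measurable]: "p \<in> borel_measurable borel"
    and Yinv': "\<forall>y\<in>Y. \<forall>h. rep h y \<in> Y"
    and pinv': "\<forall>y\<in>Y. \<forall>h. p (rep h y) = p y"
    and porb': "\<forall>y\<in>Y. \<exists>h. rep h y = p y"
  shows "\<exists>(Dm :: nat \<Rightarrow> (real^'n) set) (b :: nat \<Rightarrow> real^'n \<Rightarrow> real) (Q :: nat \<Rightarrow> 'h set) C.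
    (\<forall>i. Dm i \<in> sets borel) \<and> (\<forall>i. compact (Q i)) \<and>
    (\<forall>i j d k. d \<in> Dm i \<longrightarrow> rep k d \<in> Dm j \<longrightarrow> i = j \<and> k \<in> Q i) \<and>
    (\<forall>i. b i \<in> borel_measurable borel) \<and> (\<forall>i y. \<bar>b i y\<bar> \<le> C) \<and> (\<forall>i y. y \<notin> Dm i \<longrightarrow> b i y = 0) \<and>
    (\<forall>y\<in>Y. compact {h. rep h (p y) = p y} \<longrightarrow> (\<integral>\<^sup>+h. (\<Sum>i. ennreal ((b i (rep (hinv h) y))\<^sup>2)) \<partial>dh) = 1)"
proof -
  note Yinv = Yinv'[rule_format] and pinv = pinv'[rule_format] and porb = porb'[rule_format]
  obtain K :: "nat \<Rightarrow> 'h set" where K: "\<And>i. compact (K i)" "\<And>i. K i \<subseteq> K (Suc i)"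
    "(\<Union>i. interior (K i)) = UNIV" "\<And>C. compact C \<Longrightarrow> \<exists>i. C \<subseteq> interior (K i)" "e \<in> K 0" "interior (K 0) \<noteq> {}"
    by (rule compact_exhaustion) (rule that)
  have Kmono: "K i \<subseteq> K j" if "i \<le> j" for i j using lift_Suc_mono_le[of K, OF K(2) that] .
  have eK: "e \<in> K i" for i using K(5) Kmono[of 0 i] by auto
  have relm: "{y. \<exists>h\<in>C. rep h y = f y} \<in> sets borel" if "compact C" and [measurable]: "f \<in> borel_measurable borel" for C and f :: "real^'n \<Rightarrow> real^'n"
  proof -
    have "closed {(v, w). \<exists>h\<in>C. rep h v = w}" by (rule closed_compact_relation[OF \<open>compact C\<close> rep_cont])
    then have "{(v, w). \<exists>h\<in>C. rep h v = w} \<in> sets borel" by simp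
    moreover have "(\<lambda>y. (y, f y)) \<in> borel_measurable borel" by measurable
    ultimately have "(\<lambda>y. (y, f y)) -` {(v, w). \<exists>h\<in>C. rep h v = w} \<inter> space borel \<in> sets borel"
      by (rule measurable_sets[rotated])
    then show ?thesis by (simp add: vimage_def)
  qed
  \<comment> \<open>Points are sorted by how large their stabilizer is. The complement of
    \<open>S i\<close> is a countable union of relations over the compact sets
    \<open>K j - interior (K i)\<close>, hence Borel.\<close>
  define S where "S i = {w :: real^'n. {h. rep h w = w} \<subseteq> interior (K i)}" for i
  have Sm[measurable]: "S i \<in> sets borel" for i
  proof -
    have "S i = - (\<Union>j. {w. \<exists>h\<in>K j - interior (K i). rep h w = w})"
    proof -
      have "h \<in> (\<Union>j. K j)" for h using K(3) interior_subset by blast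
      then show ?thesis by (auto simp: S_def)
    qed
    moreover have "{w. \<exists>h\<in>K j - interior (K i). rep h w = w} \<in> sets borel" for j
      by (rule relm) (auto intro: compact_diff K(1))
    ultimately show ?thesis by (simp only:) (intro borel_comp sets.countable_UN', auto)
  qed
  define L where "L i = disjointed S i" for i
  have Lm[measurable]: "L i \<in> sets borel" for i
    unfolding L_def disjointed_def by (intro sets.Diff sets.finite_UN) auto
  have Ldisj: "i = j" if "w \<in> L i" "w \<in> L j" for w i j
    using disjoint_family_disjointed[of S] that unfolding L_def disjoint_family_on_def by blast
  have LS: "w \<in> S i" if "w \<in> L i" for w i using disjointed_subset[of S i] that unfolding L_def by blast
  have UL: "\<exists>i. w \<in> L i" if stab: "compact {h. rep h w = w}" for w
  proof -
    obtain i where "{h. rep h w = w} \<subseteq> interior (K i)" using K(4)[OF stab] by blast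
    then have "w \<in> (\<Union>i. S i)" by (auto simp: S_def)
    then show ?thesis unfolding UN_disjointed_eq[of S, symmetric] L_def by blast
  qed
  \<comment> \<open>The piece \<open>Dm i\<close> consists of what inverses of elements of
    \<open>K i\<close> make of the representatives in layer \<open>i\<close>: a compact stretch of
    each orbit belonging to that layer.\<close>
  define Dm where "Dm i = {y \<in> Y. p y \<in> L i \<and> (\<exists>h\<in>K i. rep h y = p y)}" for i
  have Dmm[measurable]: "Dm i \<in> sets borel" for i
  proof -
    have [measurable]: "{y. \<exists>h\<in>K i. rep h y = p y} \<in> sets borel" by (rule relm[OF K(1) p])
    have [measurable]: "p -` L i \<in> sets borel" using measurable_sets[OF p Lm] by simp
    have "Dm i = Y \<inter> p -` L i \<inter> {y. \<exists>h\<in>K i. rep h y = p y}" by (auto simp: Dm_def)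
    then show ?thesis by simp
  qed
  \<comment> \<open>A return \<open>k\<close> from \<open>Dm i\<close> to itself factors as
    \<open>mul (hinv h') (mul s h)\<close> with \<open>h\<close> and \<open>h'\<close> from
    \<open>K i\<close> and \<open>s\<close> in the stabilizer of the representative, itself inside
    \<open>K i\<close>. So all returns lie in one compact set.\<close>
  define Q where "Q i = (\<lambda>t. mul (hinv (fst t)) (mul (fst (snd t)) (snd (snd t)))) ` (K i \<times> K i \<times> K i)" for i
  have Qc: "compact (Q i)" for i
    unfolding Q_def by (intro compact_continuous_image compact_Times K continuous_intros)
  have key: "i = j \<and> k \<in> Q i" if d: "d \<in> Dm i" "rep k d \<in> Dm j" for i j d k
  proof -
    have dY: "d \<in> Y" using d by (simp add: Dm_def)
    have pp: "p (rep k d) = p d" using pinv[OF dY] .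
    have ij: "i = j" using d pp Ldisj by (auto simp: Dm_def)
    obtain h where h: "h \<in> K i" "rep h d = p d" using d(1) by (auto simp: Dm_def)
    obtain h' where h': "h' \<in> K i" "rep h' (rep k d) = p d" using d(2) ij pp by (auto simp: Dm_def)
    let ?s = "mul (mul h' k) (hinv h)"
    have "rep (hinv h) (p d) = d" by (simp add: h(2)[symmetric])
    then have "rep ?s (p d) = p d" using h' by (simp add: rep_mul)
    moreover have "p d \<in> S i" using d(1) LS by (auto simp: Dm_def)
    ultimately have "?s \<in> interior (K i)" by (auto simp: S_def)
    then have "?s \<in> K i" using interior_subset by blast
    moreover have "k = mul (hinv h') (mul ?s h)" by (simp add: assoc)
    ultimately have "k \<in> Q i" unfolding Q_def using h(1) h'(1) by (intro image_eqI[where x="(h', ?s, h)"]) auto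
    with ij show ?thesis by simp
  qed
  \<comment> \<open>\<open>B i y\<close> is the Haar measure of the times that the orbit of
    \<open>y\<close> spends in \<open>Dm i\<close>; left invariance makes it constant along
    orbits.\<close>
  define B where "B i y = (\<integral>\<^sup>+h. indicator (Dm i) (rep (hinv h) y) \<partial>dh)" for i y
  have [measurable]: "B i \<in> borel_measurable borel" for i unfolding B_def[abs_def] by measurable
  have Binv: "B i (rep g y) = B i y" for i g y
  proof -
    have "(\<lambda>h. indicator (Dm i) (rep (hinv h) y) :: ennreal) \<in> borel_measurable borel" by measurable
    from nn_integral_left[OF this, of "hinv g"] show ?thesis
      by (simp add: B_def inv_mul rep_mul)
  qed
  define c where "c = enn2real (emeasure dh (interior (K 0)))"
  have cfin: "emeasure dh (interior (K 0)) < \<infinity>"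
    using emeasure_mono[OF interior_subset[of "K 0"], of dh] dh_compact[OF K(1), of 0] K(1)[of 0]
    by (auto intro: le_less_trans simp: borel_closed compact_imp_closed)
  have c0: "0 < c" and cE: "ennreal c = emeasure dh (interior (K 0))"
    using dh_open[OF open_interior K(6)] cfin by (simp_all add: c_def enn2real_positive_iff)
  \<comment> \<open>Starting from the representative, all times in \<open>interior (K 0)\<close> lie
    in the piece, which gives a lower bound \<open>c\<close> common to all \<open>i\<close>;
    compactness of the returns gives finiteness.\<close>
  have Bbounds: "ennreal c \<le> B i y \<and> B i y < \<infinity>" if y: "y \<in> Y" "p y \<in> L i" for i y
  proof -
    obtain g where g: "rep g y = p y" using porb[OF y(1)] by blast
    have BB: "B i y = B i (p y)" using Binv[of i g y] by (simp add: g)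
    have pY: "p y \<in> Y" using Yinv[OF y(1), of g] by (simp add: g)
    have ppy: "p (p y) = p y" using pinv[OF y(1), of g] by (simp add: g)
    have pD: "p y \<in> Dm i" using y(2) pY ppy eK[of i] by (auto simp: Dm_def rep_unit intro!: bexI[of _ e])
    have "indicator (interior (K 0)) h \<le> (indicator (Dm i) (rep (hinv h) (p y)) :: ennreal)" for h
    proof (cases "h \<in> interior (K 0)")
      case True
      then have "h \<in> K i" using interior_subset[of "K 0"] Kmono[of 0 i] by auto
      then have "rep (hinv h) (p y) \<in> Dm i"
        using y(2) Yinv[OF pY] pinv[OF pY] ppy by (auto simp: Dm_def intro!: bexI[of _ h])
      then show ?thesis by (simp add: indicator_def)
    qed simp
    then have "(\<integral>\<^sup>+h. indicator (interior (K 0)) h \<partial>dh) \<le> B i (p y)" unfolding B_def by (intro nn_integral_mono)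
    then have "ennreal c \<le> B i (p y)" by (simp add: cE)
    moreover have "B i (p y) < \<infinity>"
    proof -
      have "compact (hinv ` Q i)" using Qc[of i] by (intro compact_continuous_image continuous_on_subset[OF cont_inv]) auto
      then have Qi: "emeasure dh (hinv ` Q i) < \<infinity>" "hinv ` Q i \<in> sets borel"
        using dh_compact by (auto intro: borel_closed compact_imp_closed)
      have "indicator (Dm i) (rep (hinv h) (p y)) \<le> (indicator (hinv ` Q i) h :: ennreal)" for h
        using key[OF pD, of "hinv h" i] by (auto simp: indicator_def image_iff) (metis inv_inv)
      then have "B i (p y) \<le> (\<integral>\<^sup>+h. indicator (hinv ` Q i) h \<partial>dh)" unfolding B_def by (intro nn_integral_mono)
      with Qi show ?thesis by (auto intro: le_less_trans)
    qed
    ultimately show ?thesis by (simp add: BB)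
  qed
  \<comment> \<open>Dividing by the square root of the time spent in the piece makes the squares
    integrate to \<open>1\<close> along an orbit. The common lower bound \<open>c\<close> bounds all
    weights by one constant.\<close>
  define b where "b i y = (if y \<in> Dm i then 1 / sqrt (enn2real (B i y)) else 0)" for i y
  have bm: "b i \<in> borel_measurable borel" for i unfolding b_def[abs_def] by measurable
  have bC: "\<bar>b i y\<bar> \<le> 1 / sqrt c" for i y
  proof (cases "y \<in> Dm i")
    case True
    then have "ennreal c \<le> B i y" "B i y < \<infinity>" using Bbounds[of y i] by (auto simp: Dm_def)
    then have "c \<le> enn2real (B i y)" using c0 by (metis enn2real_ennreal enn2real_mono infinity_ennreal_def less_imp_le)
    then show ?thesis using True c0 by (auto simp: b_def intro!: divide_left_mono mult_pos_pos)
  qed (use c0 in \<open>simp add: b_def\<close>)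
  have tot: "(\<integral>\<^sup>+h. (\<Sum>i. ennreal ((b i (rep (hinv h) y))\<^sup>2)) \<partial>dh) = 1" if y: "y \<in> Y" and st: "compact {h. rep h (p y) = p y}" for y
  proof -
    obtain i where i: "p y \<in> L i" using UL[OF st] by blast
    have Bi: "ennreal c \<le> B i y" "B i y < \<infinity>" using Bbounds[OF y i] by auto
    define Br where "Br = enn2real (B i y)"
    have Br: "B i y = ennreal Br" "0 < Br"
      using Bi c0 by (auto simp: Br_def enn2real_positive_iff less_le_trans[of 0 "ennreal c"])
    have "(\<Sum>j. ennreal ((b j (rep (hinv h) y))\<^sup>2)) = ennreal (1 / Br) * indicator (Dm i) (rep (hinv h) y)" for h
    proof -
      \<comment> \<open>Along an orbit only the layer of its representative contributes.\<close>
      have z: "b j (rep (hinv h) y) = 0" if "j \<noteq> i" for j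
        using pinv[OF y, of "hinv h"] i Ldisj that by (auto simp: b_def Dm_def)
      have "(\<Sum>j. ennreal ((b j (rep (hinv h) y))\<^sup>2)) = (\<Sum>j\<in>{i}. ennreal ((b j (rep (hinv h) y))\<^sup>2))"
        by (rule suminf_finite) (auto simp: z)
      also have "\<dots> = ennreal (1 / Br) * indicator (Dm i) (rep (hinv h) y)"
        using Binv[of i "hinv h" y] Br(2) by (auto simp: b_def Br_def[symmetric] power_divide)
      finally show ?thesis .
    qed
    then have "(\<integral>\<^sup>+h. (\<Sum>i. ennreal ((b i (rep (hinv h) y))\<^sup>2)) \<partial>dh) = ennreal (1 / Br) * B i y"
      unfolding B_def by (simp add: nn_integral_cmult)
    also have "\<dots> = 1" using Br by (simp add: ennreal_mult[symmetric])
    finally show ?thesis .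
  qed
  show ?thesis
    by (rule exI[of _ Dm], rule exI[of _ b], rule exI[of _ Q], rule exI[of _ "1 / sqrt c"])
       (intro conjI allI ballI impI; (rule Dmm | rule Qc | (rule key[THEN conjunct1]; assumption) | (rule key[THEN conjunct2]; assumption) | rule bm | rule bC | (simp add: b_def; fail) | (rule tot; assumption)))
qed

end

section \<open>Combining a tight family into one vector\<close>

lemma nn_integral_finite_bounded_support:
  fixes \<psi> :: "'a::euclidean_space \<Rightarrow> complex"
  assumes [measurable]: "\<psi> \<in> borel_measurable borel" and C: "\<And>x. cmod (\<psi> x) \<le> C" and b: "bounded {x. \<psi> x \<noteq> 0}"
  shows "(\<integral>\<^sup>+x. ennreal ((cmod (\<psi> x))\<^sup>2) \<partial>lborel) < \<infinity>"
proof -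
  obtain r where "{x. \<psi> x \<noteq> 0} \<subseteq> ball 0 r" using bounded_subset_ballD[OF b, of 0] by (elim exE conjE)
  then have r: "{x. \<psi> x \<noteq> 0} \<subseteq> cball 0 r" using ball_subset_cball by (rule subset_trans)
  have "(\<integral>\<^sup>+x. ennreal ((cmod (\<psi> x))\<^sup>2) \<partial>lborel) \<le> (\<integral>\<^sup>+x. ennreal (C\<^sup>2) * indicator (cball (0::'a) r) x \<partial>lborel)"
  proof (intro nn_integral_mono)
    fix x show "ennreal ((cmod (\<psi> x))\<^sup>2) \<le> ennreal (C\<^sup>2) * indicator (cball 0 r) x"
      using r C[of x] by (cases "\<psi> x = 0") (auto simp: indicator_def intro!: ennreal_leI power_mono)
  qed
  also have "\<dots> = ennreal (C\<^sup>2) * emeasure lborel (cball (0::'a) r)" by (simp add: nn_integral_cmult_indicator)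
  also have "\<dots> < \<infinity>" using emeasure_bounded_finite[of "cball (0::'a) r"] by (simp add: ennreal_mult_less_top)
  finally show ?thesis .
qed

lemma integrable_mult_cnj_square:
  fixes f g :: "'a \<Rightarrow> complex"
  assumes [measurable]: "f \<in> borel_measurable M" "g \<in> borel_measurable M"
    and "integrable M (\<lambda>x. (cmod (f x))\<^sup>2)" "integrable M (\<lambda>x. (cmod (g x))\<^sup>2)"
  shows "integrable M (\<lambda>x. f x * cnj (g x))"
proof (rule Bochner_Integration.integrable_bound[OF Bochner_Integration.integrable_add[OF assms(3,4)]])
  have "cnj \<in> borel_measurable borel" by (intro borel_measurable_continuous_onI continuous_intros)
  then have [measurable]: "(\<lambda>x. cnj (g x)) \<in> borel_measurable M" by (rule measurable_compose[rotated]) simp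
  show "(\<lambda>x. f x * cnj (g x)) \<in> borel_measurable M" by measurable
  have "cmod (f x) * cmod (g x) \<le> (cmod (f x))\<^sup>2 + (cmod (g x))\<^sup>2" for x
    using sum_squares_bound[of "cmod (f x)" "cmod (g x)"] mult_nonneg_nonneg[of "cmod (f x)" "cmod (g x)"] norm_ge_zero[of "f x"] norm_ge_zero[of "g x"]
    by linarith
  then show "AE x in M. norm (f x * cnj (g x)) \<le> norm ((cmod (f x))\<^sup>2 + (cmod (g x))\<^sup>2)"
    by (simp add: norm_mult)
qed

context quasi_regular_setting
begin

text \<open>The vectors are \<open>b i (\<Phi> x) * E k x\<close> for all pairs
  \<open>(i, k)\<close>. For fixed \<open>i\<close> and \<open>h\<close> the sum over
  \<open>k\<close> is a frame identity, leaving the integral of the squared modulus of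
  \<open>f\<close> against the squared weight; the weights then integrate to \<open>1\<close> over
  \<open>i\<close> and \<open>h\<close>. Each vector inherits the piece \<open>Dm i\<close> of its
  weight, which confines its returns to a compact set.\<close>

lemma exists_tight_family:
  fixes Y :: "(real^'n) set" and p :: "real^'n \<Rightarrow> real^'n" and E :: "nat \<Rightarrow> real^'d \<Rightarrow> real"
  assumes Y: "Y \<in> sets borel" and p: "p \<in> borel_measurable borel"
    and Yinv: "\<forall>y\<in>Y. \<forall>h. rep h y \<in> Y"
    and pinv: "\<forall>y\<in>Y. \<forall>h. p (rep h y) = p y"
    and porb: "\<forall>y\<in>Y. \<exists>h. rep h y = p y"
    and E[measurable]: "\<And>k. E k \<in> borel_measurable borel" and Eb: "\<And>k. \<exists>C. \<forall>x. \<bar>E k x\<bar> \<le> C"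
    and Es: "\<And>k. bounded {x. E k x \<noteq> 0}"
    and frame: "\<And>F. F \<in> borel_measurable borel \<Longrightarrow> integrable lborel (\<lambda>x. (cmod (F x))\<^sup>2) \<Longrightarrow>
      (\<Sum>k. \<integral>\<^sup>+a. ennreal ((cmod (\<integral>x. F x * complex_of_real (E k x) * cis (2 * pi * (\<Phi> x \<bullet> a)) \<partial>lborel))\<^sup>2) \<partial>lborel)
       = (\<integral>\<^sup>+x. ennreal ((cmod (F x))\<^sup>2) \<partial>lborel)"
    and good: "AE x in lborel. \<Phi> x \<in> Y \<and> compact {h. rep h (p (\<Phi> x)) = p (\<Phi> x)}"
  shows "\<exists>(A :: nat \<Rightarrow> (real^'n) set) (Q :: nat \<Rightarrow> 'h set) (\<xi> :: nat \<Rightarrow> real^'d \<Rightarrow> complex).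
    (\<forall>m. A m \<in> sets borel) \<and> (\<forall>m. compact (Q m)) \<and>
    (\<forall>l m y k. y \<in> A m \<longrightarrow> rep k y \<in> A l \<longrightarrow> k \<in> Q m) \<and>
    (\<forall>m. \<xi> m \<in> borel_measurable borel) \<and> (\<forall>m x. \<Phi> x \<notin> A m \<longrightarrow> \<xi> m x = 0) \<and>
    (\<forall>m. (\<integral>\<^sup>+x. ennreal ((cmod (\<xi> m x))\<^sup>2) \<partial>lborel) < \<infinity>) \<and>
    (\<forall>f. f \<in> borel_measurable borel \<longrightarrow> integrable lborel (\<lambda>x. (cmod (f x))\<^sup>2) \<longrightarrow>
      (\<Sum>m. I f (\<xi> m)) = (\<integral>\<^sup>+x. ennreal ((cmod (f x))\<^sup>2) \<partial>lborel))"
proof -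
  from exists_weights[OF Y p Yinv pinv porb]
  obtain Dm :: "nat \<Rightarrow> (real^'n) set" and b :: "nat \<Rightarrow> real^'n \<Rightarrow> real" and Q :: "nat \<Rightarrow> 'h set" and C
    where Dm[measurable]: "\<forall>i. Dm i \<in> sets borel" and Q: "\<forall>i. compact (Q i)"
    and key: "\<forall>i j d k. d \<in> Dm i \<longrightarrow> rep k d \<in> Dm j \<longrightarrow> i = j \<and> k \<in> Q i"
    and b: "\<forall>i. b i \<in> borel_measurable borel" and bC: "\<forall>i y. \<bar>b i y\<bar> \<le> C"
    and b0: "\<forall>i y. y \<notin> Dm i \<longrightarrow> b i y = 0"
    and tot: "\<forall>y\<in>Y. compact {h. rep h (p y) = p y} \<longrightarrow> (\<integral>\<^sup>+h. (\<Sum>i. ennreal ((b i (rep (hinv h) y))\<^sup>2)) \<partial>dh) = 1"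
    by (elim exE conjE) (rule that)
  have bm[measurable]: "b i \<in> borel_measurable borel" for i using b by blast
  define \<psi> where "\<psi> ik x = complex_of_real (b (fst ik) (\<Phi> x) * E (snd ik) x)" for ik x
  have [measurable]: "\<psi> ik \<in> borel_measurable borel" for ik unfolding \<psi>_def[abs_def] by measurable
  define \<xi> where "\<xi> m = \<psi> (prod_decode m)" for m
  define A where "A m = Dm (fst (prod_decode m))" for m
  define Q' where "Q' m = Q (fst (prod_decode m))" for m
  have "A m \<in> sets borel" for m using Dm by (simp add: A_def)
  moreover have "compact (Q' m)" for m using Q by (simp add: Q'_def)
  moreover have "k \<in> Q' m" if "y \<in> A m" "rep k y \<in> A l" for l m y k
    using key that by (auto simp: A_def Q'_def)
  moreover have "\<xi> m \<in> borel_measurable borel" for m by (simp add: \<xi>_def)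
  moreover have "\<xi> m x = 0" if "\<Phi> x \<notin> A m" for m x
    using b0 that by (simp add: \<xi>_def \<psi>_def A_def)
  moreover have "(\<integral>\<^sup>+x. ennreal ((cmod (\<xi> m x))\<^sup>2) \<partial>lborel) < \<infinity>" for m
  proof -
    obtain i k where ik: "prod_decode m = (i, k)" by force
    obtain C' where C': "\<forall>x. \<bar>E k x\<bar> \<le> C'" using Eb[of k] by blast
    show ?thesis
    proof (rule nn_integral_finite_bounded_support)
      show "\<xi> m \<in> borel_measurable borel" by (simp add: \<xi>_def)
      show "cmod (\<xi> m x) \<le> C * C'" for x
      proof -
        have "\<bar>b i (\<Phi> x)\<bar> * \<bar>E k x\<bar> \<le> C * C'"
          using bC C' order_trans[OF abs_ge_zero, of "b i (\<Phi> x)" C] by (intro mult_mono) auto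
        then show ?thesis by (simp add: \<xi>_def \<psi>_def ik norm_mult)
      qed
      show "bounded {x. \<xi> m x \<noteq> 0}"
        by (rule bounded_subset[OF Es[of k]]) (auto simp: \<xi>_def \<psi>_def ik)
    qed
  qed
  moreover have "(\<Sum>m. I f (\<xi> m)) = (\<integral>\<^sup>+x. ennreal ((cmod (f x))\<^sup>2) \<partial>lborel)"
    if f[measurable]: "f \<in> borel_measurable borel" and f2: "integrable lborel (\<lambda>x. (cmod (f x))\<^sup>2)" for f
  proof -
    have inner: "(\<Sum>k. I f (\<psi> (i, k))) = (\<integral>\<^sup>+h. \<integral>\<^sup>+x. ennreal ((cmod (f x))\<^sup>2) * ennreal ((b i (rep (hinv h) (\<Phi> x)))\<^sup>2) \<partial>lborel \<partial>dh)" for i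
    proof -
      note [measurable] = J_meas[OF f]
      have "(\<Sum>k. I f (\<psi> (i, k))) = (\<integral>\<^sup>+h. (\<Sum>k. ennreal (1 / (al h * \<beta> h)) * J f (\<psi> (i, k)) h) \<partial>dh)"
        unfolding I_def by (rule nn_integral_suminf[symmetric]) measurable
      also have "\<dots> = (\<integral>\<^sup>+h. \<integral>\<^sup>+x. ennreal ((cmod (f x))\<^sup>2) * ennreal ((b i (rep (hinv h) (\<Phi> x)))\<^sup>2) \<partial>lborel \<partial>dh)"
      proof (rule nn_integral_cong)
        fix h
        have "\<bar>b i y\<bar> \<le> C" for y using bC by blast
        from J_frame[OF f f2 E frame bm this, of h]
        show "(\<Sum>k. ennreal (1 / (al h * \<beta> h)) * J f (\<psi> (i, k)) h) = (\<integral>\<^sup>+x. ennreal ((cmod (f x))\<^sup>2) * ennreal ((b i (rep (hinv h) (\<Phi> x)))\<^sup>2) \<partial>lborel)"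
          by (simp add: \<psi>_def[abs_def])
      qed
      finally show ?thesis .
    qed
    have "(\<Sum>m. I f (\<xi> m)) = (\<Sum>i. \<Sum>k. I f (\<psi> (i, k)))"
      unfolding \<xi>_def by (rule suminf_ennreal_2dimen[of _ "\<lambda>ik. I f (\<psi> ik)"]) simp
    also have "\<dots> = (\<integral>\<^sup>+h. (\<Sum>i. \<integral>\<^sup>+x. ennreal ((cmod (f x))\<^sup>2) * ennreal ((b i (rep (hinv h) (\<Phi> x)))\<^sup>2) \<partial>lborel) \<partial>dh)"
      unfolding inner by (rule nn_integral_suminf[symmetric]) measurable
    also have "\<dots> = (\<integral>\<^sup>+h. \<integral>\<^sup>+x. (\<Sum>i. ennreal ((cmod (f x))\<^sup>2) * ennreal ((b i (rep (hinv h) (\<Phi> x)))\<^sup>2)) \<partial>lborel \<partial>dh)"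
      by (intro nn_integral_cong nn_integral_suminf[symmetric]) measurable
    also have "\<dots> = (\<integral>\<^sup>+x. \<integral>\<^sup>+h. (\<Sum>i. ennreal ((cmod (f x))\<^sup>2) * ennreal ((b i (rep (hinv h) (\<Phi> x)))\<^sup>2)) \<partial>dh \<partial>lborel)"
      by (rule dh_lborel.Fubini'[symmetric]) measurable
    also have "\<dots> = (\<integral>\<^sup>+x. ennreal ((cmod (f x))\<^sup>2) * (\<integral>\<^sup>+h. (\<Sum>i. ennreal ((b i (rep (hinv h) (\<Phi> x)))\<^sup>2)) \<partial>dh) \<partial>lborel)"
      unfolding ennreal_suminf_cmult by (intro nn_integral_cong nn_integral_cmult) measurable
    also have "\<dots> = (\<integral>\<^sup>+x. ennreal ((cmod (f x))\<^sup>2) \<partial>lborel)"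
      by (rule nn_integral_cong_AE) (use good in eventually_elim, use tot in auto)
    finally show ?thesis .
  qed
  ultimately show ?thesis
    by (intro exI[of _ A] exI[of _ Q'] exI[of _ \<xi>] conjI allI impI) blast+
qed

end

context quasi_regular_modulus
begin

text \<open>Moving the \<open>m\<close>-th vector by \<open>g m\<close> with \<open>\<delta> (g m)\<close> growing fast makes the supports disjoint over
  \<open>\<real>\<^sup>n\<close> and the norms summable, while the orbit integrals do not change.\<close>

lemma combine_translates:
  fixes A :: "nat \<Rightarrow> (real^'n) set" and Q :: "nat \<Rightarrow> 'h set" and \<xi> :: "nat \<Rightarrow> real^'d \<Rightarrow> complex"
  assumes ac: "\<And>N. N \<in> null_sets lborel \<Longrightarrow> AE x in lborel. \<Phi> x \<notin> N"
    and A[measurable]: "\<And>m. A m \<in> sets borel" and Q: "\<And>m. compact (Q m)"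
    and key: "\<And>l m y k. y \<in> A m \<Longrightarrow> rep k y \<in> A l \<Longrightarrow> k \<in> Q m"
    and \<xi>[measurable]: "\<And>m. \<xi> m \<in> borel_measurable borel" and \<xi>0: "\<And>m x. \<Phi> x \<notin> A m \<Longrightarrow> \<xi> m x = 0"
    and \<xi>2: "\<And>m. (\<integral>\<^sup>+x. ennreal ((cmod (\<xi> m x))\<^sup>2) \<partial>lborel) < \<infinity>"
    and g0: "1 < \<delta> g0"
  shows "\<exists>\<eta>. \<eta> \<in> borel_measurable borel \<and> integrable lborel (\<lambda>x. (cmod (\<eta> x))\<^sup>2) \<and>
    (\<forall>f. f \<in> borel_measurable borel \<longrightarrow> integrable lborel (\<lambda>x. (cmod (f x))\<^sup>2) \<longrightarrow> I f \<eta> = (\<Sum>m. I f (\<xi> m)))"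
proof -
  define N where "N m = enn2real (\<integral>\<^sup>+x. ennreal ((cmod (\<xi> m x))\<^sup>2) \<partial>lborel)" for m
  have N0: "0 \<le> N m" for m by (simp add: N_def)
  have NE: "(\<integral>\<^sup>+x. ennreal ((cmod (\<xi> m x))\<^sup>2) \<partial>lborel) = ennreal (N m)" for m using \<xi>2[of m] by (simp add: N_def)
  have "\<forall>m. \<exists>B. \<forall>k\<in>Q m. \<delta> k \<le> B" using \<delta>_compact[OF Q] by blast
  then obtain M where M: "\<And>m k. k \<in> Q m \<Longrightarrow> \<delta> k \<le> M m" by metis
  \<comment> \<open>The exponent serves two ends: beyond \<open>M m\<close> no return can produce an
    overlap, and beyond \<open>2 ^ m * (N m + 1)\<close> the rescaled norms are summable.\<close>
  have "\<forall>m. \<exists>q. max (M m) (2 ^ m * (N m + 1)) < \<delta> g0 ^ q" using real_arch_pow[OF g0] by blast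
  then obtain q where q: "\<And>m. max (M m) (2 ^ m * (N m + 1)) < \<delta> g0 ^ q m" by metis
  \<comment> \<open>Cumulative sums guarantee a gap of at least \<open>q m\<close> between
    \<open>n m\<close> and every earlier \<open>n l\<close>.\<close>
  define n where "n m = (\<Sum>j\<le>m. q j)" for m
  obtain p where p: "\<And>i. \<delta> (p i) = \<delta> g0 ^ i" using \<delta>_powers[of g0] by blast
  define g where "g m = p (n m)" for m
  have dg: "\<delta> (g m) = \<delta> g0 ^ n m" for m by (simp add: g_def p)
  have nlm: "n l + q m \<le> n m" if "l < m" for l m
  proof -
    have "n m = (\<Sum>j<m. q j) + q m" by (simp add: n_def lessThan_Suc_atMost[symmetric])
    moreover have "n l \<le> (\<Sum>j<m. q j)" unfolding n_def using that by (intro sum_mono2) auto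
    ultimately show ?thesis by simp
  qed
  have dlarge: "2 ^ m * (N m + 1) \<le> \<delta> (g m)" for m
  proof -
    have "q m \<le> n m" unfolding n_def by (rule member_le_sum) auto
    then have "\<delta> g0 ^ q m \<le> \<delta> g0 ^ n m" using g0 by (intro power_increasing) auto
    with q[of m] show ?thesis by (simp add: dg)
  qed
  define E where "E m = {y. rep (hinv (g m)) y \<in> A m}" for m
  have Em[measurable]: "E m \<in> sets borel" for m unfolding E_def by measurable
  \<comment> \<open>A common point would make \<open>mul (hinv (g l)) (g m)\<close> carry a point of
    \<open>A m\<close> into \<open>A l\<close>, hence an element of \<open>Q m\<close>; but its
    value under \<open>\<delta>\<close> exceeds \<open>M m\<close>.\<close>
  have Edisj': False if lm: "l < m" and y: "y \<in> E l" "y \<in> E m" for l m y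
  proof -
    have "rep (mul (hinv (g l)) (g m)) (rep (hinv (g m)) y) = rep (hinv (g l)) y" by (simp add: rep_mul)
    then have "mul (hinv (g l)) (g m) \<in> Q m" using y key[of "rep (hinv (g m)) y" m "mul (hinv (g l)) (g m)" l] by (simp add: E_def)
    then have "\<delta> (mul (hinv (g l)) (g m)) \<le> M m" by (rule M)
    moreover have "\<delta> (mul (hinv (g l)) (g m)) = \<delta> g0 ^ n m / \<delta> g0 ^ n l" by (simp add: \<delta>_mul \<delta>_inv dg)
    moreover have "\<delta> g0 ^ q m \<le> \<delta> g0 ^ n m / \<delta> g0 ^ n l"
    proof -
      have "\<delta> g0 ^ (n l + q m) \<le> \<delta> g0 ^ n m" using g0 nlm[OF lm] by (intro power_increasing) auto
      then show ?thesis using \<delta>_pos[of g0] by (simp add: pos_le_divide_eq power_add mult.commute)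
    qed
    ultimately show False using q[of m] by simp
  qed
  have Edisj: "l = m" if "y \<in> E l" "y \<in> E m" for l m y
    using Edisj'[of l m y] Edisj'[of m l y] that by (cases l m rule: linorder_cases) auto
  define \<xi>' where "\<xi>' m x = complex_of_real (1 / sqrt (\<beta> (g m) * \<delta> (g m))) * \<xi> m (act (hinv (g m)) x)" for m x
  have \<xi>'m[measurable]: "\<xi>' m \<in> borel_measurable borel" for m unfolding \<xi>'_def[abs_def] by measurable
  have \<xi>'0: "\<xi>' m x = 0" if "\<Phi> x \<notin> E m" for m x
    using \<xi>0[of "act (hinv (g m)) x" m] that by (simp add: \<xi>'_def E_def Phi_equiv)
  \<comment> \<open>The terms live over the disjoint sets \<open>E m\<close>, so at each point at
    most one of them is non-zero.\<close>
  define \<eta> where "\<eta> x = (\<Sum>m. \<xi>' m x)" for x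
  have \<eta>m[measurable]: "\<eta> \<in> borel_measurable borel" unfolding \<eta>_def[abs_def] by measurable
  have \<eta>E: "\<eta> x = \<xi>' m x" if x: "\<Phi> x \<in> E m" for x m
  proof -
    have "\<xi>' l x = 0" if "l \<noteq> m" for l using \<xi>'0[of x l] Edisj[of "\<Phi> x" l m] x that by blast
    then have "(\<Sum>l. \<xi>' l x) = (\<Sum>l\<in>{m}. \<xi>' l x)" by (intro suminf_finite) auto
    then show ?thesis by (simp add: \<eta>_def)
  qed
  have \<eta>0: "\<eta> x = 0" if "\<Phi> x \<notin> (\<Union>m. E m)" for x
    using \<xi>'0[of x] that by (simp add: \<eta>_def)
  \<comment> \<open>The factor \<open>\<beta> (g m)\<close> from the substitution cancels against
    the scalar, leaving \<open>N m / \<delta> (g m)\<close>.\<close>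
  have n2: "(\<integral>\<^sup>+x. ennreal ((cmod (\<xi>' m x))\<^sup>2) \<partial>lborel) \<le> ennreal ((1/2) ^ m)" for m
  proof -
    have "ennreal ((cmod (\<xi>' m x))\<^sup>2) = ennreal (1 / (\<beta> (g m) * \<delta> (g m))) * ennreal ((cmod (\<xi> m (act (hinv (g m)) x)))\<^sup>2)" for x
      using \<beta>_pos[of "g m"] \<delta>_pos[of "g m"]
      by (simp add: \<xi>'_def norm_mult power_mult_distrib ennreal_mult[symmetric] power_divide norm_divide)
    then have "(\<integral>\<^sup>+x. ennreal ((cmod (\<xi>' m x))\<^sup>2) \<partial>lborel) = ennreal (1 / (\<beta> (g m) * \<delta> (g m))) * (\<integral>\<^sup>+x. ennreal ((cmod (\<xi> m (act (hinv (g m)) x)))\<^sup>2) \<partial>lborel)"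
      by (simp add: nn_integral_cmult)
    also have "\<dots> = ennreal (1 / (\<beta> (g m) * \<delta> (g m))) * (ennreal (\<beta> (g m)) * ennreal (N m))"
      using nn_integral_act[of "\<lambda>x. ennreal ((cmod (\<xi> m x))\<^sup>2)" "g m"] by (simp add: NE)
    also have "\<dots> = ennreal (N m / \<delta> (g m))"
      using \<beta>_pos[of "g m"] \<delta>_pos[of "g m"] N0[of m] by (simp add: ennreal_mult[symmetric] less_imp_le)
    also have "\<dots> \<le> ennreal ((1/2) ^ m)"
    proof (rule ennreal_leI)
      have "2 ^ m * N m \<le> \<delta> (g m)" using dlarge[of m] by (simp add: algebra_simps) (smt (verit) zero_le_power)
      then show "N m / \<delta> (g m) \<le> (1/2) ^ m" using \<delta>_pos[of "g m"] by (simp add: power_divide field_simps)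
    qed
    finally show ?thesis .
  qed
  have \<eta>2: "integrable lborel (\<lambda>x. (cmod (\<eta> x))\<^sup>2)"
  proof -
    have "ennreal ((cmod (\<eta> x))\<^sup>2) \<le> (\<Sum>m. ennreal ((cmod (\<xi>' m x))\<^sup>2))" for x
    proof (cases "\<Phi> x \<in> (\<Union>m. E m)")
      case True
      then obtain m where "\<Phi> x \<in> E m" by blast
      then have "ennreal ((cmod (\<eta> x))\<^sup>2) = (\<Sum>l\<in>{m}. ennreal ((cmod (\<xi>' l x))\<^sup>2))" using \<eta>E by simp
      also have "\<dots> \<le> (\<Sum>m. ennreal ((cmod (\<xi>' m x))\<^sup>2))" by (rule sum_le_suminf) auto
      finally show ?thesis .
    qed (simp add: \<eta>0)
    then have "(\<integral>\<^sup>+x. ennreal ((cmod (\<eta> x))\<^sup>2) \<partial>lborel) \<le> (\<integral>\<^sup>+x. (\<Sum>m. ennreal ((cmod (\<xi>' m x))\<^sup>2)) \<partial>lborel)"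
      by (rule nn_integral_mono)
    also have "\<dots> = (\<Sum>m. \<integral>\<^sup>+x. ennreal ((cmod (\<xi>' m x))\<^sup>2) \<partial>lborel)" by (rule nn_integral_suminf) measurable
    also have "\<dots> \<le> (\<Sum>m. ennreal ((1/2) ^ m))" using n2 by (intro suminf_le) auto
    also have "\<dots> = ennreal (\<Sum>m. (1/2) ^ m)"
      by (rule suminf_ennreal2) (simp, rule summable_geometric, simp)
    also have "\<dots> < \<infinity>" unfolding infinity_ennreal_def by (rule ennreal_less_top)
    finally show ?thesis by (simp add: integrable_iff_bounded)
  qed
  have If: "I f \<eta> = (\<Sum>m. I f (\<xi> m))" if f[measurable]: "f \<in> borel_measurable borel" and f2: "integrable lborel (\<lambda>x. (cmod (f x))\<^sup>2)" for f
  proof -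
    note [measurable] = J_meas[OF f]
    \<comment> \<open>At each \<open>h\<close> the sets \<open>E m\<close> are pulled back by
      \<open>rep (hinv h)\<close> and stay disjoint, so the square integrals of the Fourier
      integrals add up.\<close>
    have J: "J f \<eta> h = (\<Sum>m. J f (\<xi>' m) h)" for h
    proof -
      define u where "u x = f x * cnj (\<eta> (act (hinv h) x))" for x
      define F where "F m = {y. rep (hinv h) y \<in> E m}" for m
      have [measurable]: "F m \<in> sets borel" for m unfolding F_def by measurable
      have "(\<integral>\<^sup>+x. ennreal ((cmod (\<eta> (act (hinv h) x)))\<^sup>2) \<partial>lborel) = ennreal (\<beta> h) * (\<integral>\<^sup>+x. ennreal ((cmod (\<eta> x))\<^sup>2) \<partial>lborel)"
        by (rule nn_integral_act) measurable
      also have "\<dots> < \<infinity>" using \<eta>2 by (simp add: integrable_iff_bounded ennreal_mult_less_top)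
      finally have "integrable lborel (\<lambda>x. (cmod (\<eta> (act (hinv h) x)))\<^sup>2)" by (simp add: integrable_iff_bounded)
      then have ui: "integrable lborel u"
        unfolding u_def[abs_def] by (intro integrable_mult_cnj_square f2) measurable
      have dF: "disjoint_family F" unfolding disjoint_family_on_def F_def using Edisj by blast
      have u0: "u x = 0" if "\<Phi> x \<notin> (\<Union>k. F k)" for x
        using \<eta>0[of "act (hinv h) x"] that by (simp add: u_def F_def Phi_equiv)
      have uF: "u x * complex_of_real (indicator (F m) (\<Phi> x)) = f x * cnj (\<xi>' m (act (hinv h) x))" for x m
        using \<eta>E[of "act (hinv h) x" m] \<xi>'0[of "act (hinv h) x" m] by (simp add: u_def F_def Phi_equiv indicator_def)
      have "J f \<eta> h = (\<integral>\<^sup>+a. ennreal ((cmod (\<integral>x. u x * cis (2 * pi * (\<Phi> x \<bullet> a)) \<partial>lborel))\<^sup>2) \<partial>lborel)"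
        by (simp add: J_def T_def u_def)
      also have "\<dots> = (\<Sum>m. \<integral>\<^sup>+a. ennreal ((cmod (\<integral>x. (u x * complex_of_real (indicator (F m) (\<Phi> x))) * cis (2 * pi * (\<Phi> x \<bullet> a)) \<partial>lborel))\<^sup>2) \<partial>lborel)"
        by (rule plancherel_disjoint_images[OF Phi_meas ac ui _ dF u0]) simp_all
      also have "\<dots> = (\<Sum>m. J f (\<xi>' m) h)" unfolding uF by (simp add: J_def T_def)
      finally show ?thesis .
    qed
    have "I f \<eta> = (\<integral>\<^sup>+h. (\<Sum>m. ennreal (1 / (al h * \<beta> h)) * J f (\<xi>' m) h) \<partial>dh)"
      unfolding I_def J by simp
    also have "\<dots> = (\<Sum>m. I f (\<xi>' m))" unfolding I_def by (rule nn_integral_suminf) measurable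
    also have "\<dots> = (\<Sum>m. I f (\<xi> m))" unfolding \<xi>'_def by (simp only: I_translate[OF f \<xi>])
    finally show ?thesis .
  qed
  show ?thesis
  proof (rule exI[of _ \<eta>], rule conjI[OF \<eta>m conjI[OF \<eta>2]], intro allI impI)
    fix f :: "real^'d \<Rightarrow> complex"
    assume "f \<in> borel_measurable borel" "integrable lborel (\<lambda>x. (cmod (f x))\<^sup>2)"
    then show "I f \<eta> = (\<Sum>m. I f (\<xi> m))" by (rule If)
  qed
qed

end

section \<open>The reproducing vector\<close>

text \<open>Orbit integrals are computed for Borel functions, whereas \<open>L2\<close> admits all
  Lebesgue measurable ones; real and imaginary parts are treated separately.\<close>

lemma L2_borel_representative:
  fixes f :: "'a::euclidean_space \<Rightarrow> complex"
  assumes "L2 f"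
  shows "\<exists>f'. f' \<in> borel_measurable borel \<and> (AE x in lborel. f x = f' x)"
proof -
  have f: "f \<in> borel_measurable (completion lborel)" using assms by (simp add: L2_def)
  have "(\<lambda>x. Re (f x)) \<in> borel_measurable (completion lborel)" using f by measurable
  from completion_ex_borel_measurable_real[OF this]
  obtain u where u: "u \<in> borel_measurable lborel" "AE x in lborel. Re (f x) = u x" by blast
  have "(\<lambda>x. Im (f x)) \<in> borel_measurable (completion lborel)" using f by measurable
  from completion_ex_borel_measurable_real[OF this]
  obtain v where v: "v \<in> borel_measurable lborel" "AE x in lborel. Im (f x) = v x" by blast
  have "(\<lambda>x. Complex (u x) (v x)) \<in> borel_measurable borel"
    using u(1) v(1) by (subst borel_measurable_complex_iff) simp
  moreover have "AE x in lborel. f x = Complex (u x) (v x)"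
    using u(2) v(2) by eventually_elim (simp add: complex_eq_iff)
  ultimately show ?thesis by (intro exI conjI)
qed

lemma (in quasi_regular_setting) Urep_meas:
  assumes [measurable]: "\<eta> \<in> borel_measurable borel"
  shows "Urep hinv act \<beta> \<Phi> g \<eta> \<in> borel_measurable borel"
  unfolding Urep_def[abs_def] by measurable

text \<open>Passing to a Borel representative of \<open>f\<close> alters neither its norm nor its
  coefficients.\<close>

lemma (in quasi_regular_setting) reproducing_if_borel:
  assumes \<eta>[measurable]: "\<eta> \<in> borel_measurable borel"
    and rp: "\<And>f. f \<in> borel_measurable borel \<Longrightarrow> integrable lborel (\<lambda>x. (cmod (f x))\<^sup>2) \<Longrightarrow>
      I f \<eta> = (\<integral>\<^sup>+x. ennreal ((cmod (f x))\<^sup>2) \<partial>lborel)"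
    and L: "L2 f"
  shows "ennreal (L2_norm_sq f)
    = (\<integral>\<^sup>+ g. ennreal ((cmod (L2_inner f (Urep hinv act \<beta> \<Phi> g \<eta>)))\<^sup>2) \<partial>haar_G hinv rep dh)"
proof -
  obtain f' where f'[measurable]: "f' \<in> borel_measurable borel" and ae: "AE x in lborel. f x = f' x"
    using L2_borel_representative[OF L] by blast
  have fm[measurable]: "f \<in> borel_measurable lebesgue" and fi: "integrable lebesgue (\<lambda>x. (cmod (f x))\<^sup>2)"
    using L by (auto simp: L2_def)
  have f'l[measurable]: "f' \<in> borel_measurable lebesgue" by (rule measurable_completion) simp
  have ael: "AE x in lebesgue. f x = f' x" using ae by (rule AE_completion)
  then have sq: "AE x in lebesgue. (cmod (f x))\<^sup>2 = (cmod (f' x))\<^sup>2" by eventually_elim simp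
  have "integrable lebesgue (\<lambda>x. (cmod (f' x))\<^sup>2)"
    by (rule integrable_cong_AE_imp[OF fi _ sq]) measurable
  then have f'2: "integrable lborel (\<lambda>x. (cmod (f' x))\<^sup>2)" by (subst (asm) integrable_completion) measurable
  have inner: "L2_inner f' (Urep hinv act \<beta> \<Phi> g \<eta>) = L2_inner f (Urep hinv act \<beta> \<Phi> g \<eta>)" for g
  proof -
    have "(\<lambda>x. cnj (Urep hinv act \<beta> \<Phi> g \<eta> x)) \<in> borel_measurable borel"
      by (rule borel_measurable_cnj_comp[OF Urep_meas[OF \<eta>]])
    then have [measurable]: "(\<lambda>x. cnj (Urep hinv act \<beta> \<Phi> g \<eta> x)) \<in> borel_measurable lebesgue"
      by (intro measurable_completion) simp
    have "AE x in lebesgue. f' x * cnj (Urep hinv act \<beta> \<Phi> g \<eta> x) = f x * cnj (Urep hinv act \<beta> \<Phi> g \<eta> x)"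
      using ael by eventually_elim simp
    then show ?thesis unfolding L2_inner_def by (rule integral_cong_AE[rotated 2]) measurable
  qed
  have "L2_norm_sq f = (\<integral>x. (cmod (f' x))\<^sup>2 \<partial>lebesgue)"
    unfolding L2_norm_sq_def by (rule integral_cong_AE[OF _ _ sq]) measurable
  also have "\<dots> = (\<integral>x. (cmod (f' x))\<^sup>2 \<partial>lborel)" by (rule integral_completion) measurable
  finally have "ennreal (L2_norm_sq f) = (\<integral>\<^sup>+x. ennreal ((cmod (f' x))\<^sup>2) \<partial>lborel)"
    using nn_integral_eq_integral[OF f'2] by simp
  also have "\<dots> = I f' \<eta>" by (rule rp[OF f' f'2, symmetric])
  also have "\<dots> = (\<integral>\<^sup>+ g. ennreal ((cmod (L2_inner f' (Urep hinv act \<beta> \<Phi> g \<eta>)))\<^sup>2) \<partial>haar_G hinv rep dh)"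
    by (rule orbit_integral_eq[OF f' \<eta>, symmetric])
  finally show ?thesis unfolding inner .
qed

text \<open>An open set is a countable union of compact boxes, so its image is a countable union of
  compact sets.\<close>

lemma borel_image_of_open:
  fixes f :: "'a::euclidean_space \<Rightarrow> 'b::t2_space"
  assumes "continuous_on UNIV f" "open X"
  shows "f ` X \<in> sets borel"
proof -
  obtain \<D> where \<D>: "countable \<D>" "\<And>B. B \<in> \<D> \<Longrightarrow> \<exists>a b. B = cbox a b" "\<Union>\<D> = X"
    using open_countable_Union_open_cbox[OF \<open>open X\<close>] by metis
  have "f ` B \<in> sets borel" if "B \<in> \<D>" for B
  proof -
    have "compact B" using \<D>(2)[OF that] compact_cbox by blast
    then show ?thesis
      using continuous_on_subset[OF assms(1)] by (intro borel_closed compact_imp_closed compact_continuous_image) auto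
  qed
  then have "(\<Union>B\<in>\<D>. f ` B) \<in> sets borel" using \<D>(1) by (intro sets.countable_UN'') auto
  moreover have "f ` X = (\<Union>B\<in>\<D>. f ` B)" unfolding \<D>(3)[symmetric] by blast
  ultimately show ?thesis by simp
qed

theorem mainTheorem15:
  fixes mul :: "'h::{t2_space, second_countable_topology} \<Rightarrow> 'h \<Rightarrow> 'h"
    and e :: 'h and hinv :: "'h \<Rightarrow> 'h"
    and dh :: "'h measure"
    and rep :: "'h \<Rightarrow> real^'n::finite \<Rightarrow> real^'n"
    and act :: "'h \<Rightarrow> real^'d::finite \<Rightarrow> real^'d"
    and \<beta> :: "'h \<Rightarrow> real"
    and \<Phi> :: "real^'d \<Rightarrow> real^'n"
    and \<Phi>' :: "real^'d \<Rightarrow> ((real^'d) \<Rightarrow>\<^sub>L (real^'n))"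
    and X :: "(real^'d) set"
    and \<pi> :: "real^'n \<Rightarrow> 'z::{t2_space, second_countable_topology}"
    and sec :: "'z \<Rightarrow> real^'n"
    and lam :: "'z measure"
  assumes H_group: "lcsc_group mul e hinv"
    and H_haar: "left_haar_measure mul dh"
    (* continuous linear representation h[.] of H on R^n *)
    and rep_linear: "\<And>h. linear (rep h)"
    and rep_unit: "rep e = id"
    and rep_mul: "\<And>h k. rep (mul h k) = rep h \<circ> rep k"
    and rep_cont: "continuous_on UNIV (\<lambda>p. rep (fst p) (snd p))"
    (* (H1) *)
    and act_unit: "act e = id"
    and act_mul: "\<And>h k. act (mul h k) = act h \<circ> act k"
    and act_cont: "continuous_on UNIV (\<lambda>p. act (fst p) (snd p))"
    and act_smooth: "\<And>h. smooth_map (act h)"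
    and act_leb: "\<And>h E. E \<in> sets borel \<Longrightarrow>
                    emeasure lebesgue (act h ` E) = ennreal (\<beta> h) * emeasure lebesgue E"
    (* (H2) *)
    and Phi_deriv: "\<And>x. (\<Phi> has_derivative blinfun_apply (\<Phi>' x)) (at x)"
    and Phi'_cont: "continuous_on UNIV \<Phi>'"
    and Phi_equiv: "\<And>h x. \<Phi> (act h x) = rep h (\<Phi> x)"
    (* Assumption 1 *)
    and crit_null: "{x. rank (matrix (blinfun_apply (\<Phi>' x))) < CARD('n)} \<in> null_sets lebesgue"
    and X_open: "open X"
    and X_inv: "\<And>h x. x \<in> X \<Longrightarrow> act h x \<in> X"
    and X_regular: "\<And>x. x \<in> X \<Longrightarrow> rank (matrix (blinfun_apply (\<Phi>' x))) = CARD('n)"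
    and X_conull: "- X \<in> null_sets lebesgue"
    (* Assumption 2 *)
    and orbits_lc: "\<And>y. y \<in> \<Phi> ` X \<Longrightarrow> locally_closed_in (\<Phi> ` X) (range (\<lambda>h. rep h y))"
    (* Z, \<pi>, o, \<lambda> *)
    and Z_lc: "locally_compact_space (euclidean :: 'z topology)"
    and pi_meas: "\<pi> \<in> measurable (restrict_space borel (\<Phi> ` X)) borel"
    and pi_orbits: "\<And>y y'. y \<in> \<Phi> ` X \<Longrightarrow> y' \<in> \<Phi> ` X \<Longrightarrow>
                      \<pi> y = \<pi> y' \<longleftrightarrow> (\<exists>h. rep h y = y')"
    and sec_meas: "sec \<in> borel_measurable borel"
    and sec_in: "\<And>z. sec z \<in> \<Phi> ` X"
    and sec_section: "\<And>z. \<pi> (sec z) = z"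
    and lam_sets: "sets lam = sets borel"
    and lam_null: "\<And>E. E \<in> sets borel \<Longrightarrow>
                     (E \<in> null_sets lam \<longleftrightarrow> (\<pi> -` E \<inter> \<Phi> ` X) \<in> null_sets lebesgue)"
    (* hypotheses of the theorem *)
    and non_unimodular: "\<not> unimodular_G mul hinv rep dh"
    and stab_compact: "AE z in lam. compact {h. rep h (sec z) = sec z}"
  shows "\<exists>\<eta>. L2 \<eta> \<and>
           (\<forall>f. L2 f \<longrightarrow>
              ennreal (L2_norm_sq f)
                = (\<integral>\<^sup>+ g. ennreal ((cmod (L2_inner f (Urep hinv act \<beta> \<Phi> g \<eta>)))\<^sup>2)
                      \<partial>haar_G hinv rep dh))"
proof -
  have Phi_cont: "continuous_on UNIV \<Phi>"
    using Phi_deriv by (intro continuous_at_imp_continuous_on ballI has_derivative_continuous)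
  interpret quasi_regular_setting mul e hinv dh rep act \<beta> \<Phi>
    by (intro quasi_regular_setting.intro haar_group.intro quasi_regular_setting_axioms.intro) (fact H_group H_haar rep_linear rep_unit rep_mul rep_cont act_unit act_mul act_cont act_leb Phi_cont Phi_equiv)+
  obtain D where D: "\<forall>k. 0 < D k" "\<forall>x y. D (mul x y) = D x * D y" "\<forall>C. compact C \<longrightarrow> (\<exists>b. \<forall>k\<in>C. D k \<le> b)"
    "\<forall>k A. A \<in> sets borel \<longrightarrow> rt k A = ennreal (D k) * emeasure dh A"
    using right_haar_modulus by (elim exE conjE)
  interpret quasi_regular_modulus mul e hinv dh rep act \<beta> \<Phi> D
    by unfold_locales (use D in blast)+
  define Y where "Y = \<Phi> ` X"
  have Y[measurable]: "Y \<in> sets borel" unfolding Y_def by (rule borel_image_of_open[OF Phi_cont X_open])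
  have XB: "X \<in> sets borel" using X_open by simp
  have "- X \<in> null_sets lborel"
    using X_conull XB by (subst null_sets_completion_iff[symmetric]) (auto intro: borel_comp)
  then have aeX: "AE x in lborel. x \<in> X" using AE_not_in by fastforce
  have Xne: "X \<noteq> {}"
  proof
    assume "X = {}"
    with X_conull have "emeasure lborel (UNIV :: (real^'d) set) = 0" by auto
    then show False by simp
  qed
  \<comment> \<open>Submersions pull null sets back to null sets. This carries statements about
    almost every \<open>y\<close> over to almost every \<open>x\<close>, and also supplies the
    push-forward densities.\<close>
  have ac: "AE x in lborel. \<Phi> x \<notin> N" if N: "N \<in> null_sets lborel" for N
  proof -
    have "AE x in lborel. x \<in> X \<longrightarrow> \<Phi> x \<notin> N"
      by (rule vimage_null_of_submersion[OF Phi_deriv Phi'_cont _ N]) (rule X_regular)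
    with aeX show ?thesis by eventually_elim simp
  qed
  \<comment> \<open>Extended by \<open>0\<close> off \<open>Y\<close> to a total map, which is Borel
    because \<open>Y\<close> is.\<close>
  define p where "p y = (if y \<in> Y then sec (\<pi> y) else 0)" for y
  have p: "p \<in> borel_measurable borel"
  proof -
    have "(\<lambda>y. sec (\<pi> y)) \<in> measurable (restrict_space borel Y) borel"
      using measurable_compose[OF pi_meas sec_meas] by (simp add: Y_def)
    then show ?thesis
      unfolding p_def[abs_def] by (subst measurable_If_restrict_space_iff) auto
  qed
  have Yinv: "\<forall>y\<in>Y. \<forall>h. rep h y \<in> Y"
    using X_inv by (auto simp: Y_def Phi_equiv[symmetric])
  have pinv: "\<forall>y\<in>Y. \<forall>h. p (rep h y) = p y"
  proof (intro ballI allI)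
    fix y h assume y: "y \<in> Y"
    then have ry: "rep h y \<in> Y" using Yinv by blast
    then have "\<pi> y = \<pi> (rep h y)" using pi_orbits[of y "rep h y"] y unfolding Y_def by blast
    then show "p (rep h y) = p y" using y ry by (simp add: p_def)
  qed
  have porb: "\<forall>y\<in>Y. \<exists>h. rep h y = p y"
  proof
    fix y assume y: "y \<in> Y"
    have "\<exists>h. rep h y = sec (\<pi> y)"
      using pi_orbits[of y "sec (\<pi> y)"] sec_in sec_section y by (simp add: Y_def)
    then show "\<exists>h. rep h y = p y" using y by (simp add: p_def)
  qed
  \<comment> \<open>The exceptional set in \<open>Z\<close> is enclosed in a Borel null set,
    transferred to \<open>Y\<close> by the description of the null sets of \<open>lam\<close>, and
    from there to almost every \<open>x\<close> by \<open>ac\<close>.\<close>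
  have good: "AE x in lborel. \<Phi> x \<in> Y \<and> compact {h. rep h (p (\<Phi> x)) = p (\<Phi> x)}"
  proof -
    have sp: "space lam = UNIV" using sets_eq_imp_space_eq[OF lam_sets] by simp
    obtain N where N: "{z \<in> space lam. \<not> compact {h. rep h (sec z) = sec z}} \<subseteq> N" "emeasure lam N = 0" "N \<in> sets lam"
      using stab_compact by (rule AE_E)
    have NB: "N \<in> sets borel" using N(3) lam_sets by simp
    have "N \<in> null_sets lam" using N by auto
    then have nl: "\<pi> -` N \<inter> Y \<in> null_sets lebesgue" using lam_null[OF NB] by (simp add: Y_def)
    have "\<pi> -` N \<inter> space (restrict_space borel Y) \<in> sets (restrict_space borel Y)"
      using pi_meas NB unfolding Y_def by (rule measurable_sets)
    then have "\<pi> -` N \<inter> Y \<in> sets borel" by (simp add: sets_restrict_space_iff space_restrict_space)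
    then have "\<pi> -` N \<inter> Y \<in> null_sets lborel" using nl by (subst null_sets_completion_iff[symmetric]) auto
    from ac[OF this] aeX show ?thesis
    proof eventually_elim
      fix x assume x: "\<Phi> x \<notin> \<pi> -` N \<inter> Y" "x \<in> X"
      then have "\<Phi> x \<in> Y" by (simp add: Y_def)
      with x N(1) show "\<Phi> x \<in> Y \<and> compact {h. rep h (p (\<Phi> x)) = p (\<Phi> x)}" by (auto simp: p_def sp)
    qed
  qed
  obtain E :: "nat \<Rightarrow> real^'d \<Rightarrow> real" where E: "\<forall>k. E k \<in> borel_measurable borel" "\<forall>k. \<exists>C. \<forall>x. \<bar>E k x\<bar> \<le> C"
    "\<forall>k. bounded {x. E k x \<noteq> 0}"
    and fr: "\<forall>F. F \<in> borel_measurable borel \<longrightarrow> integrable lborel (\<lambda>x. (cmod (F x))\<^sup>2) \<longrightarrow>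
      (\<Sum>k. \<integral>\<^sup>+a. ennreal ((cmod (\<integral>x. F x * complex_of_real (E k x) * cis (2 * pi * (\<Phi> x \<bullet> a)) \<partial>lborel))\<^sup>2) \<partial>lborel)
       = (\<integral>\<^sup>+x. ennreal ((cmod (F x))\<^sup>2) * indicator X x \<partial>lborel)"
    by (rule exE[OF parseval_frame_along_submersion[OF Phi_deriv Phi'_cont _ XB Xne]]) (erule X_regular, elim conjE, rule that)
  have frame: "(\<Sum>k. \<integral>\<^sup>+a. ennreal ((cmod (\<integral>x. F x * complex_of_real (E k x) * cis (2 * pi * (\<Phi> x \<bullet> a)) \<partial>lborel))\<^sup>2) \<partial>lborel)
       = (\<integral>\<^sup>+x. ennreal ((cmod (F x))\<^sup>2) \<partial>lborel)"
    if "F \<in> borel_measurable borel" "integrable lborel (\<lambda>x. (cmod (F x))\<^sup>2)" for F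
  proof -
    have "(\<integral>\<^sup>+x. ennreal ((cmod (F x))\<^sup>2) * indicator X x \<partial>lborel) = (\<integral>\<^sup>+x. ennreal ((cmod (F x))\<^sup>2) \<partial>lborel)"
      by (rule nn_integral_cong_AE) (use aeX in eventually_elim, simp)
    then show ?thesis using fr[rule_format, OF that] by simp
  qed
  obtain A :: "nat \<Rightarrow> (real^'n) set" and Q :: "nat \<Rightarrow> 'h set" and \<xi> :: "nat \<Rightarrow> real^'d \<Rightarrow> complex"
    where A: "\<forall>m. A m \<in> sets borel" and Q: "\<forall>m. compact (Q m)"
      and key: "\<forall>l m y k. y \<in> A m \<longrightarrow> rep k y \<in> A l \<longrightarrow> k \<in> Q m"
      and \<xi>: "\<forall>m. \<xi> m \<in> borel_measurable borel" and \<xi>0: "\<forall>m x. \<Phi> x \<notin> A m \<longrightarrow> \<xi> m x = 0"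
      and \<xi>2: "\<forall>m. (\<integral>\<^sup>+x. ennreal ((cmod (\<xi> m x))\<^sup>2) \<partial>lborel) < \<infinity>"
      and tight: "\<forall>f. f \<in> borel_measurable borel \<longrightarrow> integrable lborel (\<lambda>x. (cmod (f x))\<^sup>2) \<longrightarrow>
        (\<Sum>m. I f (\<xi> m)) = (\<integral>\<^sup>+x. ennreal ((cmod (f x))\<^sup>2) \<partial>lborel)"
    by (rule exE[OF exists_tight_family[OF Y p Yinv pinv porb E(1)[rule_format] E(2)[rule_format] E(3)[rule_format] _ good]])
      ((rule frame; assumption), elim exE conjE, rule that)
  \<comment> \<open>Here non-unimodularity enters: the powers of \<open>g0\<close> make
    \<open>\<delta>\<close> as large as desired.\<close>
  obtain g0 where g0: "1 < \<delta> g0" using \<delta>_expanding[OF non_unimodular] by blast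
  obtain \<eta> where \<eta>: "\<eta> \<in> borel_measurable borel" "integrable lborel (\<lambda>x. (cmod (\<eta> x))\<^sup>2)"
    and If: "\<forall>f. f \<in> borel_measurable borel \<longrightarrow> integrable lborel (\<lambda>x. (cmod (f x))\<^sup>2) \<longrightarrow> I f \<eta> = (\<Sum>m. I f (\<xi> m))"
    by (rule exE[OF combine_translates[of A Q \<xi> g0, OF _ A[rule_format] Q[rule_format] _ \<xi>[rule_format] _ \<xi>2[rule_format] g0]])
      (erule ac, (rule key[rule_format]; assumption), (rule \<xi>0[rule_format]; assumption), elim exE conjE, rule that)
  have "L2 \<eta>"
    unfolding L2_def
  proof
    show "\<eta> \<in> borel_measurable lebesgue" using \<eta>(1) by (intro measurable_completion) simp
    show "integrable lebesgue (\<lambda>x. (cmod (\<eta> x))\<^sup>2)" using \<eta> by (subst integrable_completion) auto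
  qed
  moreover have "I f \<eta> = (\<integral>\<^sup>+x. ennreal ((cmod (f x))\<^sup>2) \<partial>lborel)"
    if "f \<in> borel_measurable borel" "integrable lborel (\<lambda>x. (cmod (f x))\<^sup>2)" for f
    using If[rule_format, OF that] tight[rule_format, OF that] by simp
  ultimately show ?thesis
    using reproducing_if_borel[OF \<eta>(1)] by blast
qed

end
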